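(* Let $k\ge 0$ be a real number and let $r\ge 2$ be an integer. For integers $N\ge 1$ put $$I_r(k)=\int_{\mathbb T}\Big|\sum_{\substack{f\in\mathcal M\\ \deg f\le N}}a_r(f)e(f\alpha)\Big|^k\,d\alpha .$$ Then for all integers $N\ge 1$, $$I_r(k)\asymp\begin{cases} q^{Nk/(r+1)} & \text{if } k<1+1/r,\\ N q^{N/r} & \text{if } k=1+1/r,\\ q^{N(k-1)} & \text{if } k>1+1/r,\end{cases}$$ where the implicit constants may depend on $k$, $q$ and $r$ (but not on $N$).
   Context: Let $q=p^h$ with $p$ prime and $h\ge 1$ an integer. $\mathbb F_q((1/t))$ is the field of formal Laurent series $\alpha=\sum_{i\le M}\alpha_i t^i$ ($M\in\mathbb Z$, $\alpha_i\in\mathbb F_q$); $\operatorname{ord}(\alpha)$ is the largest $i$ with $\alpha_i\ne0$, with $\operatorname{ord}(0)=-\infty$, and $|\alpha|=q^{\operatorname{ord}(\alpha)}$, $|0|=0$. The torus is $\mathbb T=\{\alpha\in\mathbb F_q((1/t)):|\alpha|<1\}$, and $d\alpha$ is the Haar measure on $\mathbb F_q((1/t))$ normalized by $\int_{\mathbb T}1\,d\alpha=1$. Put $e_q(c)=\exp(2\pi i\operatorname{tr}(c)/p)$ for $c\in\mathbb F_q$, where $\operatorname{tr}:\mathbb F_q\to\mathbb F_p$ is the trace map, and $e(\alpha)=e_q(\alpha_{-1})$. $\mathcal M$ is the set of monic polynomials in $\mathbb F_q[t]$. A nonzero polynomial is $r$-free if it is not divisible by $\pi^r$ for any irreducible $\pi\in\mathbb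 F_q[t]$; $0$ is not $r$-free. $a_r$ is the indicator function of the $r$-free polynomials. $X\asymp Y$ means $X\le C_1Y$ and $Y\le C_2X$ for some constants $C_1,C_2>0$. *)

theory Defs
  imports
    "HOL-Analysis.Analysis"
    "HOL-Computational_Algebra.Computational_Algebra"
begin

text \<open>
  The field of formal Laurent series in \<open>1/t\<close> over the finite field \<open>'a\<close> is the type
  \<open>'a fls\<close>, whose formal variable \<open>fls_X\<close> plays the role of \<open>1/t\<close>; thus \<open>t\<close> is \<open>fls_X_inv\<close>,
  and the coefficient of \<open>t\<^sup>i\<close> is the library's coefficient at \<open>-i\<close>.
\<close>

definition t_coeff :: "'a::zero fls \<Rightarrow> int \<Rightarrow> 'a" where
  "t_coeff \<alpha> i = fls_nth \<alpha> (- i)"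

text \<open>
  For \<open>\<alpha> \<noteq> 0\<close> the order, i.e. the largest \<open>i\<close> with \<open>t_coeff \<alpha> i \<noteq> 0\<close>, is \<open>- fls_subdegree \<alpha>\<close>.
\<close>

definition laurent_abs :: "'a::finite_field fls \<Rightarrow> real" where
  "laurent_abs \<alpha> = (if \<alpha> = 0 then 0 else real CARD('a) powi (- fls_subdegree \<alpha>))"

definition torus :: "'a::finite_field fls set" where
  "torus = {\<alpha>. laurent_abs \<alpha> < 1}"

definition laurent_of_poly :: "'a::comm_ring_1 poly \<Rightarrow> 'a fls" where
  "laurent_of_poly f = (\<Sum>i\<le>degree f. fls_const (coeff f i) * fls_X_inv ^ i)"

lemma t_coeff_laurent_of_poly:
  "t_coeff (laurent_of_poly f) i = (if i < 0 then 0 else coeff f (nat i))"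
proof -
  have "t_coeff (laurent_of_poly f) i =
      (\<Sum>j\<le>degree f. if int j = i then coeff f j else 0)"
    unfolding t_coeff_def laurent_of_poly_def fls_nth_sum
    by (intro sum.cong) auto
  also have "\<dots> = (if i < 0 then 0 else coeff f (nat i))"
  proof (cases "i < 0")
    case False
    then have "(\<Sum>j\<le>degree f. if int j = i then coeff f j else 0) =
        (\<Sum>j\<le>degree f. if j = nat i then coeff f j else 0)"
      by (intro sum.cong) auto
    also have "\<dots> = coeff f (nat i)"
      by (auto simp: coeff_eq_0)
    finally show ?thesis using False by simp
  qed (auto intro!: sum.neutral)
  finally show ?thesis .
qed

text \<open>
  The Borel sets are those of the library's metric on \<open>'a fls\<close>, which takes powers of \<open>2\<close> instead
  of powers of \<open>CARD('a)\<close> and hence induces the same topology as \<open>laurent_abs\<close>.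
\<close>

definition normalized_haar :: "'a::finite_field fls measure \<Rightarrow> bool" where
  "normalized_haar \<mu> \<longleftrightarrow>
     sets \<mu> = sets borel \<and>
     (\<forall>\<beta>. \<forall>A \<in> sets borel. emeasure \<mu> ((+) \<beta> ` A) = emeasure \<mu> A) \<and>
     (\<forall>K. compact K \<longrightarrow> emeasure \<mu> K < \<infinity>) \<and>
     emeasure \<mu> torus = 1"

text \<open>
  The trace from the field with \<open>p ^ h\<close> elements to its prime field, as the sum of the Galois
  conjugates; its value is an element of \<open>'a\<close> lying in the prime field.
\<close>

definition field_trace :: "nat \<Rightarrow> nat \<Rightarrow> 'a::finite_field \<Rightarrow> 'a" where
  "field_trace p h c = (\<Sum>i<h. c ^ (p ^ i))"

definition residue_rep :: "nat \<Rightarrow> 'a::finite_field \<Rightarrow> nat" where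
  "residue_rep p c = (THE n. n < p \<and> of_nat n = c)"

lemma residue_rep_field_trace:
  fixes c :: "'a::finite_field"
  assumes p: "prime p" and h: "h \<ge> 1" and card: "CARD('a) = p ^ h"
  shows "residue_rep p (field_trace p h c) < p"
    and "of_nat (residue_rep p (field_trace p h c)) = field_trace p h c"
proof -
  have char: "CHAR('a) = p"
  proof -
    have pr: "prime CHAR('a)"
      by (rule prime_CHAR_semidom) (simp add: finite_imp_CHAR_pos)
    have "(\<Sum>x\<in>UNIV. x) = (\<Sum>x\<in>UNIV. x + (1::'a))"
      by (rule sum.reindex_bij_witness[of _ "\<lambda>x. x + 1" "\<lambda>x. x - 1"]) auto
    then have "of_nat CARD('a) = (0::'a)"
      by (simp add: sum.distrib)
    then have "CHAR('a) dvd CARD('a)"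
      by (simp only: of_nat_eq_0_iff_char_dvd)
    then have "CHAR('a) dvd p"
      using pr card prime_dvd_power by metis
    then show ?thesis
      using pr p primes_dvd_imp_eq by blast
  qed
  let ?s = "field_trace p h c"
  let ?P = "monom 1 p - monom 1 1 :: 'a poly"
  have fix_s: "?s ^ p = ?s"
  proof -
    have "?s ^ p = (\<Sum>i<h. (c ^ (p ^ i)) ^ p)"
      unfolding field_trace_def using p char by (metis freshmans_dream_sum)
    also have "\<dots> = (\<Sum>i<h. c ^ (p ^ Suc i))"
      by (simp add: power_mult mult.commute flip: power_mult)
    also have "\<dots> + c = (\<Sum>i<Suc h. c ^ (p ^ i))"
      by (subst sum.lessThan_Suc_shift) (simp add: add.commute)
    also have "\<dots> = ?s + c"
      using finite_field_power_card_eq_same[of c] by (simp add: field_trace_def card)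
    finally show ?thesis by simp
  qed
  have inj: "inj_on (of_nat :: nat \<Rightarrow> 'a) {..<p}"
  proof (rule linorder_inj_onI)
    fix m n :: nat
    assume mn: "m < n" "m \<in> {..<p}" "n \<in> {..<p}"
    show "(of_nat m :: 'a) \<noteq> of_nat n"
    proof
      assume "(of_nat m :: 'a) = of_nat n"
      then have "of_nat (n - m) = (0 :: 'a)"
        using mn by (simp add: of_nat_diff)
      then have "p dvd n - m"
        by (simp only: of_nat_eq_0_iff_char_dvd char)
      then show False
        using mn by (auto dest: dvd_imp_le)
    qed
  qed auto
  have roots: "(of_nat n :: 'a) ^ p = of_nat n" for n
  proof (induction n)
    case 0
    then show ?case using p by (simp add: prime_gt_0_nat)
  next
    case (Suc n)
    have "(1 + of_nat n :: 'a) ^ p = 1 ^ p + of_nat n ^ p"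
      using p char by (metis freshmans_dream)
    then show ?case using Suc by simp
  qed
  have "coeff ?P p = 1" using prime_gt_1_nat[OF p] by simp
  then have nz: "?P \<noteq> 0" by (metis coeff_0 zero_neq_one)
  have deg: "degree ?P \<le> p"
    using prime_gt_1_nat[OF p] by (intro degree_diff_le) (auto intro: order.trans[OF degree_monom_le])
  have sub: "of_nat ` {..<p} \<subseteq> {x. poly ?P x = 0}"
    using roots by (auto simp: poly_monom)
  have "card {x. poly ?P x = 0} \<le> card ((of_nat :: nat \<Rightarrow> 'a) ` {..<p})"
    using card_poly_roots_bound[OF nz] deg by (simp add: card_image[OF inj])
  then have "of_nat ` {..<p} = {x. poly ?P x = 0}"
    using sub by (intro card_seteq poly_roots_finite nz)
  moreover have "?s \<in> {x. poly ?P x = 0}"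
    using fix_s by (simp add: poly_monom)
  ultimately obtain n where n: "n < p" "of_nat n = ?s"
    by (metis (no_types, lifting) imageE lessThan_iff)
  have "\<exists>!n. n < p \<and> of_nat n = ?s"
    using n inj by (metis inj_onD lessThan_iff)
  from theI'[OF this]
  show "residue_rep p ?s < p" "of_nat (residue_rep p ?s) = ?s"
    by (auto simp: residue_rep_def)
qed

definition e_q :: "nat \<Rightarrow> nat \<Rightarrow> 'a::finite_field \<Rightarrow> complex" where
  "e_q p h c = exp (2 * of_real pi * \<i> * of_nat (residue_rep p (field_trace p h c)) / of_nat p)"

definition e_char :: "nat \<Rightarrow> nat \<Rightarrow> 'a::finite_field fls \<Rightarrow> complex" where
  "e_char p h \<alpha> = e_q p h (t_coeff \<alpha> (-1))"

definition r_free :: "nat \<Rightarrow> 'a::field poly \<Rightarrow> bool" where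
  "r_free r f \<longleftrightarrow> f \<noteq> 0 \<and> (\<forall>\<pi>. irreducible \<pi> \<longrightarrow> \<not> \<pi> ^ r dvd f)"

definition r_free_sum :: "nat \<Rightarrow> nat \<Rightarrow> nat \<Rightarrow> nat \<Rightarrow> 'a::finite_field fls \<Rightarrow> complex" where
  "r_free_sum p h r N \<alpha> =
     (\<Sum>f | lead_coeff f = 1 \<and> degree f \<le> N.
        (if r_free r f then 1 else 0) * e_char p h (laurent_of_poly f * \<alpha>))"

lemma finite_monic_degree_le:
  "finite {f :: 'a::finite_field poly. lead_coeff f = 1 \<and> degree f \<le> N}"
proof (rule finite_subset)
  show "{f :: 'a poly. lead_coeff f = 1 \<and> degree f \<le> N}
      \<subseteq> Poly ` {xs. set xs \<subseteq> UNIV \<and> length xs \<le> Suc N}"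
  proof
    fix f :: "'a poly"
    assume f: "f \<in> {f. lead_coeff f = 1 \<and> degree f \<le> N}"
    have "length (coeffs f) \<le> Suc N"
      using f by (cases "f = 0") (auto simp: length_coeffs_degree)
    then show "f \<in> Poly ` {xs. set xs \<subseteq> UNIV \<and> length xs \<le> Suc N}"
      by (intro image_eqI[of _ _ "coeffs f"]) auto
  qed
qed (intro finite_imageI finite_lists_length_le finite)

text \<open>
  The library has \<open>0 powr 0 = 0\<close>; the moment of exponent \<open>0\<close> uses the convention \<open>0\<^sup>0 = 1\<close>.
\<close>

definition real_pow :: "real \<Rightarrow> real \<Rightarrow> real" where
  "real_pow x k = (if k = 0 then 1 else x powr k)"

definition r_free_moment ::
    "'a::finite_field fls measure \<Rightarrow> nat \<Rightarrow> nat \<Rightarrow> nat \<Rightarrow> real \<Rightarrow> nat \<Rightarrow> real" where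
  "r_free_moment \<mu> p h r k N =
     (LINT \<alpha>:torus|\<mu>. real_pow (cmod (r_free_sum p h r N \<alpha>)) k)"

definition moment_order :: "real \<Rightarrow> nat \<Rightarrow> real \<Rightarrow> nat \<Rightarrow> real" where
  "moment_order q r k N =
     (if k < 1 + 1 / real r then q powr (real N * k / (real r + 1))
      else if k = 1 + 1 / real r then real N * q powr (real N / real r)
      else q powr (real N * (k - 1)))"

end

theory Submission
  imports Defs
begin

text \<open>
  Everything follows from the size of the level sets of the exponential sum.  Write \<open>q\<close> for the size
  of the field and \<open>S\<close> for the part of the sum over the \<open>r\<close>-free monic polynomials of degree exactly
  \<open>n\<close>.  Up to constants, the set where \<open>\<bar>S\<bar>\<close> is at least \<open>q ^ (n - r * j)\<close> has measure
  \<open>q ^ ((r + 1) * j - n)\<close>, for \<open>0 \<le> j \<le> n / (r + 1)\<close> from above and for \<open>0 \<le> j \<le> n / (r + 1) - 21\<close>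
  from below.  Summing the \<open>k\<close>-th powers over these levels gives a geometric series with ratio
  \<open>q powr (r + 1 - r * k)\<close>.  Its last term (near \<open>j = n / (r + 1)\<close>) dominates for \<open>k < 1 + 1 / r\<close>, its
  first term (\<open>j = 0\<close>) dominates for \<open>k > 1 + 1 / r\<close>, and all terms are equal for \<open>k = 1 + 1 / r\<close>, which
  yields the factor \<open>N\<close>.

  By Moebius inversion \<open>S\<close> is the sum over monic \<open>d\<close> of the Moebius function of \<open>d\<close> times the sum over
  the multiples of \<open>d ^ r\<close>.  The latter vanishes except on the arcs for \<open>d\<close>, the \<open>\<alpha>\<close> for which
  \<open>d ^ r * \<alpha>\<close> is at distance less than \<open>q ^ - (n - r * degree d)\<close> from a polynomial; there its
  absolute value is
  \<open>q ^ (n - r * degree d)\<close>, and its mean value over the torus is \<open>1\<close>.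

  For the upper bound (\<open>card_large_expsum_le\<close>) the \<open>d\<close> of degree less than \<open>j\<close> have mean value at most
  \<open>q ^ j\<close>, and the others have mean square at most a constant times \<open>q ^ (n - (r - 1) * j)\<close>, which
  follows from Parseval's identity and a count of common multiples.  The inequalities of Markov and
  Chebyshev, applied to the two parts at the level \<open>q ^ (n - r * j)\<close>, gives the same bound twice.

  For the lower bound (\<open>card_large_expsum_ge\<close>) consider squarefree \<open>b\<close> of degree \<open>j\<close> and the arcs
  around fractions with denominator \<open>b ^ r\<close> that do not belong to a proper divisor of \<open>b\<close>.  The
  multiples \<open>d\<close> of \<open>b\<close> contribute with the same phase, and \<open>d = b\<close> dominates
  (\<open>cmod_main_part_ge\<close>).  For \<open>d\<close> not divisible by \<open>b\<close> and of degree at most \<open>n / (r + 1)\<close>, the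
  primitive arcs for \<open>b\<close> and the arcs for \<open>d\<close> are independent or disjoint
  (\<open>card_primitive_arcs_Int_le\<close>), so these \<open>d\<close> contribute little on average; the remaining \<open>d\<close> are
  controlled by the mean square.

  The sums depend on finitely many coefficients of \<open>\<alpha>\<close> only, so that all this takes place in a finite
  vector space; the Haar measure enters through the measure of cylinder sets
  (\<open>torus_integral_eq_average\<close>).
\<close>

section \<open>Coprimality of polynomials over a field\<close>

lemma monic_mult:
  fixes f g :: "'a::idom poly"
  shows "lead_coeff f = 1 \<Longrightarrow> lead_coeff g = 1 \<Longrightarrow> lead_coeff (f * g) = 1"
  by (simp add: lead_coeff_mult)

lemma monic_power:
  fixes f :: "'a::idom poly"
  shows "lead_coeff f = 1 \<Longrightarrow> lead_coeff (f ^ n) = 1"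
  by (simp add: lead_coeff_power)

lemma monic_nonzero: "lead_coeff (f :: 'a::zero_neq_one poly) = 1 \<Longrightarrow> f \<noteq> 0"
  by auto

lemma monic_cofactor:
  fixes f g h :: "'a::idom poly"
  assumes "f = g * h" "lead_coeff f = 1" "lead_coeff g = 1"
  shows "lead_coeff h = 1"
  using assms by (simp add: lead_coeff_mult)

lemma degree_monic_mult:
  fixes f g :: "'a::idom poly"
  assumes "lead_coeff f = 1" "lead_coeff g = 1"
  shows "degree (f * g) = degree f + degree g"
  using assms by (intro degree_mult_eq) auto

lemma exists_monic_associate:
  fixes f :: "'a::field poly"
  assumes "f \<noteq> 0"
  obtains g u where "is_unit u" "f = g * u" "lead_coeff g = 1"
proof
  show "is_unit [:lead_coeff f:]"
    using assms by (simp add: is_unit_const_poly_iff dvd_field_iff)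
  show "f = smult (inverse (lead_coeff f)) f * [:lead_coeff f:]"
    using assms by simp
  show "lead_coeff (smult (inverse (lead_coeff f)) f) = 1"
    using assms by simp
qed

lemma monic_is_unit_iff:
  fixes f :: "'a::field poly"
  assumes "lead_coeff f = 1"
  shows "is_unit f \<longleftrightarrow> f = 1"
proof
  assume "is_unit f"
  then obtain c where c: "f = [:c:]" using is_unit_poly_iff by blast
  with assms show "f = 1" by (auto simp: one_pCons)
qed auto

text \<open>
  Coprimality in the strong form of a Bezout identity.
\<close>

definition comaximal :: "'b::comm_ring_1 \<Rightarrow> 'b \<Rightarrow> bool" where
  "comaximal a b \<longleftrightarrow> (\<exists>x y. x * a + y * b = 1)"

lemma comaximal_commute: "comaximal a b \<longleftrightarrow> comaximal b a"
  unfolding comaximal_def by (metis add.commute)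

lemma comaximal_mult_left:
  assumes "comaximal a c" "comaximal b c"
  shows "comaximal (a * b) c"
proof -
  obtain x y x' y' where "x * a + y * c = 1" "x' * b + y' * c = 1"
    using assms by (auto simp: comaximal_def)
  then have "(x * a + y * c) * (x' * b + y' * c) = 1" by simp
  then have "(x * x') * (a * b) + (y * (x' * b + y' * c) + x * a * y') * c = 1"
    by (simp add: algebra_simps)
  then show ?thesis unfolding comaximal_def by blast
qed

lemma comaximal_one_left [simp]: "comaximal 1 c"
  unfolding comaximal_def by (rule exI[of _ 1], rule exI[of _ 0]) simp

lemma comaximal_power_left: "comaximal a c \<Longrightarrow> comaximal (a ^ n) c"
  by (induction n) (auto intro: comaximal_mult_left)

lemma comaximal_power: "comaximal a c \<Longrightarrow> comaximal (a ^ m) (c ^ n)"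
  using comaximal_power_left comaximal_commute by metis

lemma comaximal_mult_dvd:
  assumes "comaximal a b" "a dvd f" "b dvd f"
  shows "a * b dvd f"
proof -
  obtain x y where xy: "x * a + y * b = 1" using assms by (auto simp: comaximal_def)
  have "f = x * (a * f) + y * (f * b)" using xy by (metis distrib_left mult.commute mult.left_commute mult.right_neutral)
  moreover have "a * b dvd a * f" "a * b dvd f * b"
    using assms by (auto intro: mult_dvd_mono)
  ultimately show ?thesis by (metis dvd_add dvd_mult)
qed

lemma comaximal_dvd_mult:
  assumes "comaximal a b" "a dvd b * c"
  shows "a dvd c"
proof -
  obtain x y where xy: "x * a + y * b = 1" using assms by (auto simp: comaximal_def)
  have "c = (x * a + y * b) * c" using xy by simp
  also have "\<dots> = a * (x * c) + y * (b * c)" by (simp add: algebra_simps)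
  finally show ?thesis using assms(2) by (metis dvd_add dvd_mult dvd_triv_left)
qed

lemma exists_common_divisor:
  fixes a b :: "'a::field poly"
  assumes "a \<noteq> 0"
  obtains g x y where "lead_coeff g = 1" "g dvd a" "g dvd b" "g = x * a + y * b"
proof -
  define I where "I = {p. \<exists>x y. p = x * a + y * b}"
  have "a \<in> I" unfolding I_def by (intro CollectI exI[of _ 1] exI[of _ 0]) simp
  moreover have "b \<in> I" unfolding I_def by (intro CollectI exI[of _ 0] exI[of _ 1]) simp
  ultimately obtain p where p: "p \<in> I" "p \<noteq> 0"
      and min: "\<And>p'. p' \<in> I \<Longrightarrow> p' \<noteq> 0 \<Longrightarrow> degree p \<le> degree p'"
    using ex_has_least_nat[of "\<lambda>p. p \<in> I \<and> p \<noteq> 0" a degree] assms by blast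
  have diff: "u - w * v \<in> I" if "u \<in> I" "v \<in> I" for u v w
  proof -
    obtain x y x' y' where "u = x * a + y * b" "v = x' * a + y' * b"
      using \<open>u \<in> I\<close> \<open>v \<in> I\<close> by (auto simp: I_def)
    then have "u - w * v = (x - w * x') * a + (y - w * y') * b"
      by (simp add: algebra_simps)
    then show ?thesis by (auto simp: I_def)
  qed
  have dvd: "p dvd u" if "u \<in> I" for u
  proof -
    have "u mod p = u - (u div p) * p"
      by (simp add: minus_div_mult_eq_mod)
    then have "u mod p \<in> I" using diff that p(1) by metis
    moreover have "u mod p = 0 \<or> degree (u mod p) < degree p"
      using degree_mod_less p(2) by blast
    ultimately show ?thesis using min by (metis mod_0_imp_dvd not_less)
  qed
  obtain g u where g: "is_unit u" "p = g * u" "lead_coeff g = 1"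
    using exists_monic_associate p(2) by metis
  obtain v where v: "1 = u * v" using g(1) by (auto elim: dvdE)
  obtain x y where "p = x * a + y * b" using p(1) by (auto simp: I_def)
  moreover have "g = p * v" by (simp add: g(2) v[symmetric] mult.assoc)
  ultimately have eq: "g = (x * v) * a + (y * v) * b" by (simp add: algebra_simps)
  have "g dvd a" "g dvd b"
    using dvd[OF \<open>a \<in> I\<close>] dvd[OF \<open>b \<in> I\<close>] unfolding g(2) by (blast dest: dvd_mult_left)+
  then show ?thesis using that[OF g(3) _ _ eq] by simp
qed

lemma exists_comaximal_decomposition:
  fixes a b :: "'a::field poly"
  assumes "lead_coeff a = 1" "lead_coeff b = 1"
  obtains g u v where "lead_coeff g = 1" "lead_coeff u = 1" "lead_coeff v = 1"
    "a = g * u" "b = g * v" "comaximal u v"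
proof -
  have "a \<noteq> 0" using assms(1) by auto
  then obtain g x y where g: "lead_coeff g = 1" "g dvd a" "g dvd b" "g = x * a + y * b"
    using exists_common_divisor by metis
  obtain u where u: "a = g * u" using g(2) by (rule dvdE)
  obtain v where v: "b = g * v" using g(3) by (rule dvdE)
  have "g * (x * u + y * v) = x * (g * u) + y * (g * v)" by (simp add: algebra_simps)
  also have "\<dots> = g" using g(4) u v by simp
  finally have "g * (x * u + y * v) = g * 1" by simp
  moreover have "g \<noteq> 0" using g(1) by auto
  ultimately have "x * u + y * v = 1" by (metis mult_left_cancel)
  then have "comaximal u v" by (auto simp: comaximal_def)
  moreover have "lead_coeff u = 1" "lead_coeff v = 1"
    using monic_cofactor[OF u assms(1) g(1)] monic_cofactor[OF v assms(2) g(1)] by auto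
  ultimately show ?thesis using that[OF g(1) _ _ u v] by simp
qed

lemma irreducible_comaximal:
  fixes \<pi> d :: "'a::field poly"
  assumes "irreducible \<pi>" "\<not> \<pi> dvd d"
  shows "comaximal \<pi> d"
proof -
  have nz: "\<pi> \<noteq> 0" using assms(1) by auto
  then obtain g x y where g: "lead_coeff g = 1" "g dvd \<pi>" "g dvd d" "g = x * \<pi> + y * d"
    using exists_common_divisor by metis
  have "is_unit g"
  proof (rule ccontr)
    assume "\<not> is_unit g"
    then have "\<pi> dvd g"
      using assms(1) g(2) by (meson irreducibleD')
    then show False using assms(2) g(3) dvd_trans by blast
  qed
  then have "g = 1" using monic_is_unit_iff g(1) by blast
  then show ?thesis using g(4) by (auto simp: comaximal_def)
qed

lemma exists_monic_irreducible_factor: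
  fixes f :: "'a::field poly"
  assumes "f \<noteq> 0" "\<not> is_unit f"
  obtains \<pi> where "irreducible \<pi>" "lead_coeff \<pi> = 1" "\<pi> dvd f"
proof -
  define Q where "Q p \<longleftrightarrow> p dvd f \<and> lead_coeff p = 1 \<and> p \<noteq> 1" for p
  have assoc: "\<exists>p. Q p \<and> degree p = degree a" if a: "a dvd f" "a \<noteq> 0" "\<not> is_unit a" for a
  proof -
    obtain g u where g: "is_unit u" "a = g * u" "lead_coeff g = 1"
      using exists_monic_associate a(2) by metis
    have "g \<noteq> 1" using g(1,2) a(3) by auto
    moreover have "g dvd f" using a(1) unfolding g(2) by (rule dvd_mult_left)
    moreover have "degree a = degree g"
      using g a(2) by (auto simp: degree_mult_eq is_unit_iff_degree)
    ultimately show ?thesis using g(3) by (auto simp: Q_def)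
  qed
  obtain p0 where "Q p0" using assoc[of f] assms by auto
  then obtain p where p: "Q p" and min: "\<And>p'. Q p' \<Longrightarrow> degree p \<le> degree p'"
    using ex_has_least_nat[of Q p0 degree] by metis
  have "irreducible p"
  proof (rule irreducibleI)
    show "p \<noteq> 0" using p by (auto simp: Q_def)
    show "\<not> is_unit p" using p monic_is_unit_iff by (auto simp: Q_def)
  next
    fix a b assume ab: "p = a * b"
    show "is_unit a \<or> is_unit b"
    proof (rule ccontr)
      assume neg: "\<not> (is_unit a \<or> is_unit b)"
      have nz: "a \<noteq> 0" "b \<noteq> 0" using ab p by (auto simp: Q_def)
      have "p dvd f" using p by (simp add: Q_def)
      then have "a dvd f" unfolding ab by (rule dvd_mult_left)
      then have "degree p \<le> degree a" using assoc[of a] min neg nz by metis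
      then have "degree b = 0" using ab nz by (simp add: degree_mult_eq)
      then show False using neg nz by (metis is_unit_iff_degree)
    qed
  qed
  then show ?thesis using that p by (simp add: Q_def)
qed

section \<open>Polynomials of bounded degree and monic polynomials\<close>

text \<open>
  The polynomials of degree less than \<open>m\<close>, including \<open>0\<close>; for \<open>m = 0\<close> only \<open>0\<close>.
\<close>

definition polys_lt :: "nat \<Rightarrow> 'a::zero poly set" where
  "polys_lt m = {f. \<forall>i\<ge>m. coeff f i = 0}"

text \<open>The monic polynomials of degree exactly \<open>n\<close>.\<close>

definition monics :: "nat \<Rightarrow> 'a::zero_neq_one poly set" where
  "monics n = {f. lead_coeff f = 1 \<and> degree f = n}"

lemma polys_lt_0 [simp]: "polys_lt 0 = {0}"
  by (auto simp: polys_lt_def poly_eq_iff)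

lemma zero_in_polys_lt [simp]: "0 \<in> polys_lt m"
  by (simp add: polys_lt_def)

lemma polys_lt_iff: "f \<in> polys_lt m \<longleftrightarrow> f = 0 \<or> degree f < m"
proof
  assume f: "f \<in> polys_lt m"
  show "f = 0 \<or> degree f < m"
  proof (cases "degree f < m")
    case False
    then have "lead_coeff f = 0" using f by (simp add: polys_lt_def)
    then show ?thesis by simp
  qed simp
qed (auto simp: polys_lt_def coeff_eq_0)

lemma polys_lt_add: "f \<in> polys_lt m \<Longrightarrow> g \<in> polys_lt m \<Longrightarrow> f + g \<in> polys_lt m"
  for f :: "'a::comm_ring_1 poly"
  by (simp add: polys_lt_def)

lemma polys_lt_diff: "f \<in> polys_lt m \<Longrightarrow> g \<in> polys_lt m \<Longrightarrow> f - g \<in> polys_lt m"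
  for f :: "'a::comm_ring_1 poly"
  by (simp add: polys_lt_def)

lemma monom_in_polys_lt: "i < m \<Longrightarrow> monom c i \<in> polys_lt m"
  by (auto simp: polys_lt_def)

lemma mult_in_polys_lt:
  fixes f g :: "'a::idom poly"
  assumes "g \<in> polys_lt m" "degree f + m \<le> n"
  shows "f * g \<in> polys_lt n"
proof (cases "f = 0 \<or> g = 0")
  case False
  then have "degree (f * g) < n" using assms by (auto simp: polys_lt_iff degree_mult_eq)
  then show ?thesis by (simp add: polys_lt_iff)
qed auto

lemma polys_lt_mult_cancel:
  fixes f v :: "'a::idom poly"
  assumes "f \<noteq> 0" "f * v \<in> polys_lt n"
  shows "v \<in> polys_lt (n - degree f)"
proof (cases "v = 0")
  case False
  then have "degree (f * v) = degree f + degree v" using assms(1) by (simp add: degree_mult_eq)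
  then show ?thesis using assms False by (auto simp: polys_lt_iff)
qed simp

lemma polys_lt_Suc: "polys_lt (Suc m) = (\<lambda>(c, f). pCons c f) ` (UNIV \<times> polys_lt m)"
proof (intro equalityI subsetI)
  fix f :: "'a poly" assume f: "f \<in> polys_lt (Suc m)"
  obtain c g where cg: "f = pCons c g" by (cases f)
  have "g \<in> polys_lt m"
    unfolding polys_lt_def
  proof (intro CollectI allI impI)
    fix i assume "m \<le> i"
    then have "coeff f (Suc i) = 0" using f by (simp add: polys_lt_def)
    then show "coeff g i = 0" by (simp add: cg)
  qed
  then show "f \<in> (\<lambda>(c, f). pCons c f) ` (UNIV \<times> polys_lt m)" using cg by force
qed (auto simp: polys_lt_def coeff_pCons split: nat.split)

lemma finite_polys_lt [simp]: "finite (polys_lt m :: 'a::{zero,finite} poly set)"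
  by (induction m) (auto simp: polys_lt_Suc)

lemma card_polys_lt: "card (polys_lt m :: 'a::{zero,finite} poly set) = CARD('a) ^ m"
proof (induction m)
  case (Suc m)
  have "inj_on (\<lambda>(c, f :: 'a poly). pCons c f) (UNIV \<times> polys_lt m)"
    by (auto simp: inj_on_def)
  then show ?case using Suc by (simp add: polys_lt_Suc card_image card_cartesian_product)
qed simp

lemma monics_eq: "monics n = (\<lambda>g. monom 1 n + g) ` (polys_lt n :: 'a::comm_ring_1 poly set)"
proof (intro equalityI subsetI)
  fix f :: "'a poly" assume f: "f \<in> monics n"
  have "f - monom 1 n \<in> polys_lt n"
    using f by (auto simp: monics_def polys_lt_def coeff_eq_0 le_less)
  then show "f \<in> (\<lambda>g. monom 1 n + g) ` polys_lt n"
    by (intro image_eqI[of _ _ "f - monom 1 n"]) auto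
next
  fix f :: "'a poly" assume "f \<in> (\<lambda>g. monom 1 n + g) ` polys_lt n"
  then obtain g where g: "f = monom 1 n + g" "g \<in> polys_lt n" by auto
  have "coeff f n = 1" using g by (simp add: polys_lt_def)
  moreover have "degree f \<le> n" using g by (intro degree_le) (auto simp: polys_lt_def)
  ultimately have "degree f = n" by (metis le_antisym le_degree zero_neq_one)
  then show "f \<in> monics n" using \<open>coeff f n = 1\<close> by (simp add: monics_def)
qed

lemma finite_monics [simp]: "finite (monics n :: 'a::{comm_ring_1,finite} poly set)"
  by (simp add: monics_eq)

lemma card_monics: "card (monics n :: 'a::{comm_ring_1,finite} poly set) = CARD('a) ^ n"
  by (simp add: monics_eq card_image inj_on_def card_polys_lt)

lemma monics_mult: "f \<in> monics m \<Longrightarrow> g \<in> monics n \<Longrightarrow> f * g \<in> monics (m + n)"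
  for f g :: "'a::idom poly"
  unfolding monics_def using degree_monic_mult[of f g] monic_mult[of f g] by auto

lemma monics_0 [simp]: "monics 0 = {1 :: 'a::comm_ring_1 poly}"
  by (auto simp: monics_eq)

lemma monics_multiples:
  fixes d :: "'a::idom poly"
  assumes d: "lead_coeff d = 1" and n: "degree d \<le> n"
  shows "{f \<in> monics n. d dvd f} = (\<lambda>g. d * g) ` monics (n - degree d)"
proof (intro equalityI subsetI)
  fix f assume f: "f \<in> {f \<in> monics n. d dvd f}"
  then obtain g where g: "f = d * g" by (auto elim: dvdE)
  have "lead_coeff g = 1" using monic_cofactor[OF g] f d by (auto simp: monics_def)
  moreover have "degree g = n - degree d"
    using f g degree_monic_mult[OF d calculation] by (auto simp: monics_def)
  ultimately show "f \<in> (\<lambda>g. d * g) ` monics (n - degree d)" using g by (auto simp: monics_def)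
next
  fix f assume "f \<in> (\<lambda>g. d * g) ` monics (n - degree d)"
  then obtain g where g: "f = d * g" "g \<in> monics (n - degree d)" by auto
  have "d \<in> monics (degree d)" using d by (simp add: monics_def)
  from monics_mult[OF this g(2)] show "f \<in> {f \<in> monics n. d dvd f}" using g(1) n by simp
qed

lemma monics_multiples_empty:
  fixes d :: "'a::idom poly"
  assumes n: "n < degree d"
  shows "{f \<in> monics n. d dvd f} = {}"
  using n dvd_imp_degree_le by (force simp: monics_def)

lemma card_monics_multiples:
  fixes d :: "'a::finite_field poly"
  assumes d: "lead_coeff d = 1"
  shows "card {f \<in> monics n. d dvd f} = (if degree d \<le> n then CARD('a) ^ (n - degree d) else 0)"
proof (cases "degree d \<le> n")
  case True
  have "inj_on (\<lambda>g. d * g) (monics (n - degree d))"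
    using d by (auto simp: inj_on_def)
  then show ?thesis using monics_multiples[OF d True] True by (simp add: card_image card_monics)
next
  case False
  then show ?thesis by (simp add: monics_multiples_empty)
qed

text \<open>
  There is equality if \<open>r * degree d \<le> n\<close>, and otherwise the left-hand side is \<open>0\<close>.
\<close>

lemma card_monics_power_multiples_le:
  fixes d :: "'a::finite_field poly"
  assumes d: "lead_coeff d = 1"
  shows "real (card {f \<in> monics n. d ^ r dvd f}) \<le> real CARD('a) ^ n / real CARD('a) ^ (r * degree d)"
proof -
  have "degree (d ^ r) = r * degree d" using d by (simp add: degree_power_eq monic_nonzero mult.commute)
  then have card: "card {f \<in> monics n. d ^ r dvd f}
      = (if r * degree d \<le> n then CARD('a) ^ (n - r * degree d) else 0)"
    using card_monics_multiples[OF monic_power[OF d], of n r] by simp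
  have "real CARD('a) ^ (n - r * degree d) = real CARD('a) ^ n / real CARD('a) ^ (r * degree d)"
    if "r * degree d \<le> n"
    using that by (intro power_diff) auto
  then show ?thesis unfolding card by (cases "r * degree d \<le> n") (simp_all only: if_True if_False of_nat_power, simp_all)
qed

section \<open>The Moebius function and the indicator function of the \<open>r\<close>-free polynomials\<close>

text \<open>
  The Moebius function of \<open>F[t]\<close>, invariant under units; the prime factors are represented by the
  monic irreducible ones.
\<close>

definition poly_moebius :: "'a::field poly \<Rightarrow> real" where
  "poly_moebius d = (if squarefree d
     then (- 1) ^ card {\<pi>. irreducible \<pi> \<and> lead_coeff \<pi> = 1 \<and> \<pi> dvd d} else 0)"

lemma abs_poly_moebius_le: "\<bar>poly_moebius d\<bar> \<le> 1"
  by (simp add: poly_moebius_def power_abs)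

lemma abs_poly_moebius_squarefree: "squarefree d \<Longrightarrow> \<bar>poly_moebius d\<bar> = 1"
  by (simp add: poly_moebius_def power_abs)

lemma poly_moebius_not_squarefree: "\<not> squarefree d \<Longrightarrow> poly_moebius d = 0"
  by (simp add: poly_moebius_def)

lemma finite_monic_divisors:
  fixes f :: "'a::finite_field poly"
  assumes "f \<noteq> 0"
  shows "finite {d. lead_coeff d = 1 \<and> d dvd f}"
  by (rule finite_subset[OF _ finite_monic_degree_le[of "degree f"]])
     (use assms in \<open>auto dest: dvd_imp_degree_le\<close>)

lemma monic_irreducible_dvd_eq:
  fixes \<pi> \<rho> :: "'a::field poly"
  assumes "irreducible \<pi>" "irreducible \<rho>" "lead_coeff \<pi> = 1" "lead_coeff \<rho> = 1" "\<pi> dvd \<rho>"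
  shows "\<pi> = \<rho>"
proof -
  obtain u where u: "\<rho> = \<pi> * u" using assms(5) by (rule dvdE)
  have "is_unit u" using irreducibleD[OF assms(2) u] assms(1) by (auto simp: irreducible_def)
  moreover have "lead_coeff u = 1" using monic_cofactor[OF u assms(4,3)] .
  ultimately show ?thesis using u monic_is_unit_iff[of u] by simp
qed

lemma squarefree_irreducible_mult:
  fixes \<pi> d :: "'a::field poly"
  assumes \<pi>: "irreducible \<pi>" and d: "squarefree d" and nd: "\<not> \<pi> dvd d"
  shows "squarefree (\<pi> * d)"
proof (rule squarefreeI)
  fix x assume x: "x\<^sup>2 dvd \<pi> * d"
  have "\<not> \<pi> dvd x"
  proof
    assume "\<pi> dvd x"
    then have "\<pi> * \<pi> dvd \<pi> * d" using x by (metis dvd_trans mult_dvd_mono power2_eq_square)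
    then show False using nd \<pi> by (simp add: irreducible_def)
  qed
  then have "comaximal (x\<^sup>2) \<pi>"
    using irreducible_comaximal[OF \<pi>] comaximal_power_left comaximal_commute by metis
  then have "x\<^sup>2 dvd d" using x by (rule comaximal_dvd_mult)
  then show "is_unit x" using d by (simp add: squarefree_def)
qed

lemma squarefree_dvd: "squarefree f \<Longrightarrow> d dvd f \<Longrightarrow> squarefree d"
  unfolding squarefree_def by (meson dvd_trans)

lemma poly_moebius_irreducible_mult:
  fixes \<pi> d :: "'a::finite_field poly"
  assumes \<pi>: "irreducible \<pi>" "lead_coeff \<pi> = 1" and d: "d \<noteq> 0" and nd: "\<not> \<pi> dvd d"
  shows "poly_moebius (\<pi> * d) = - poly_moebius d"
proof (cases "squarefree d")
  case True
  let ?P = "\<lambda>d. {\<rho>. irreducible \<rho> \<and> lead_coeff \<rho> = 1 \<and> \<rho> dvd d}"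
  have "?P (\<pi> * d) = insert \<pi> (?P d)"
    using \<pi> monic_irreducible_dvd_eq[of _ \<pi>] field_poly_irreducible_imp_prime
    by (auto dest: prime_elem_dvd_multD)
  moreover have "\<pi> \<notin> ?P d" using nd by simp
  moreover have "finite (?P d)"
    by (rule finite_subset[OF _ finite_monic_divisors[OF d]]) auto
  ultimately have "card (?P (\<pi> * d)) = Suc (card (?P d))" by (simp del: insert_Collect)
  then show ?thesis using True squarefree_irreducible_mult[OF \<pi>(1) True nd]
    by (simp add: poly_moebius_def)
next
  case False
  then have "\<not> squarefree (\<pi> * d)" using squarefree_dvd by (metis dvd_triv_right)
  then show ?thesis using False by (simp add: poly_moebius_def)
qed

text \<open>
  If \<open>\<pi> ^ r\<close> divides \<open>f\<close>, then multiplication by \<open>\<pi>\<close> pairs the admissible \<open>d\<close> prime to \<open>\<pi>\<close> with the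
  admissible multiples of \<open>\<pi>\<close> on which \<open>poly_moebius\<close> does not vanish, and it changes the sign of
  \<open>poly_moebius\<close>.
\<close>

lemma sum_poly_moebius_eq_r_free:
  fixes f :: "'a::finite_field poly"
  assumes f: "f \<noteq> 0" and r: "r \<ge> 1"
  shows "(\<Sum>d | lead_coeff d = 1 \<and> d ^ r dvd f. poly_moebius d) = (if r_free r f then 1 else 0)"
proof -
  let ?D = "{d. lead_coeff d = 1 \<and> d ^ r dvd f}"
  have fin: "finite ?D"
    using r by (intro finite_subset[OF _ finite_monic_divisors[OF f]])
      (auto intro: dvd_trans dvd_power)
  show ?thesis
  proof (cases "r_free r f")
    case True
    have "poly_moebius d = (if d = 1 then 1 else 0)" if d: "d \<in> ?D" for d
    proof (cases "d = 1")
      case True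
      have "{\<pi>::'a poly. irreducible \<pi> \<and> lead_coeff \<pi> = 1 \<and> \<pi> dvd 1} = {}"
        by (auto simp: irreducible_def)
      moreover have "squarefree (1 :: 'a poly)"
        by (auto simp: squarefree_def power2_eq_square dest: dvd_mult_left)
      ultimately have "poly_moebius (1 :: 'a poly) = 1"
        unfolding poly_moebius_def by (simp only: card.empty power_0 if_True)
      then show ?thesis using True by simp
    next
      case False
      then have "\<not> is_unit d" using d monic_is_unit_iff by auto
      moreover have "d \<noteq> 0" using d by auto
      ultimately obtain \<pi> where \<pi>: "irreducible \<pi>" "\<pi> dvd d"
        using exists_monic_irreducible_factor by metis
      then have "\<pi> ^ r dvd f" using d by (auto intro: dvd_trans dvd_power_same)
      then show ?thesis using True \<pi>(1) by (auto simp: r_free_def)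
    qed
    then have "(\<Sum>d\<in>?D. poly_moebius d) = (\<Sum>d\<in>?D. if d = 1 then 1 else 0)" by (intro sum.cong) auto
    also have "\<dots> = 1" using fin by (simp add: sum.delta)
    finally show ?thesis using True by simp
  next
    case False
    then obtain \<rho> where \<rho>: "irreducible \<rho>" "\<rho> ^ r dvd f" using f by (auto simp: r_free_def)
    have "\<not> is_unit \<rho>" "\<rho> \<noteq> 0" using \<rho>(1) by (auto simp: irreducible_def)
    then obtain \<pi> where \<pi>: "irreducible \<pi>" "lead_coeff \<pi> = 1" "\<pi> dvd \<rho>"
      using exists_monic_irreducible_factor by metis
    have \<pi>f: "\<pi> ^ r dvd f" using \<pi>(3) \<rho>(2) by (meson dvd_trans dvd_power_same)
    let ?A = "{d\<in>?D. \<not> \<pi> dvd d}"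
    let ?B = "{d\<in>?D. \<pi> dvd d}"
    have finA: "finite ?A" by (rule finite_subset[OF _ fin]) blast
    have finB: "finite ?B" by (rule finite_subset[OF _ fin]) blast
    have inj: "inj_on ((*) \<pi>) ?A" using \<pi>(1) by (auto simp: inj_on_def irreducible_def)
    have sub: "(*) \<pi> ` ?A \<subseteq> ?B"
    proof (intro image_subsetI)
      fix d assume d: "d \<in> ?A"
      have "comaximal (\<pi> ^ r) (d ^ r)"
        using irreducible_comaximal[OF \<pi>(1)] d comaximal_power by blast
      then have "\<pi> ^ r * d ^ r dvd f" using \<pi>f d comaximal_mult_dvd by auto
      then show "\<pi> * d \<in> ?B" using d \<pi>(2) monic_mult[of \<pi> d] by (simp add: power_mult_distrib)
    qed
    have zero: "poly_moebius d = 0" if d: "d \<in> ?B - (*) \<pi> ` ?A" for d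
    proof -
      have "\<pi> dvd d" using d by auto
      then obtain e where e: "d = \<pi> * e" by (rule dvdE)
      have e1: "lead_coeff e = 1" using monic_cofactor[OF e] d \<pi>(2) by auto
      have "e ^ r dvd f" using d unfolding e by (auto simp: power_mult_distrib dest: dvd_mult_right)
      then have "\<pi> dvd e" using d e e1 by auto
      then have "\<pi>\<^sup>2 dvd d" unfolding e by (simp add: power2_eq_square)
      moreover have "\<not> is_unit \<pi>" using \<pi>(1) by (auto simp: irreducible_def)
      ultimately show ?thesis by (intro poly_moebius_not_squarefree) (auto simp: squarefree_def)
    qed
    have "(\<Sum>d\<in>?B. poly_moebius d) = (\<Sum>d\<in>(*) \<pi> ` ?A. poly_moebius d)"
      using finB sub zero by (intro sum.mono_neutral_right) blast+
    also have "\<dots> = (\<Sum>d\<in>?A. poly_moebius (\<pi> * d))" by (subst sum.reindex[OF inj]) simp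
    also have "\<dots> = (\<Sum>d\<in>?A. - poly_moebius d)"
      using \<pi> by (intro sum.cong) (auto intro!: poly_moebius_irreducible_mult monic_nonzero)
    finally have "(\<Sum>d\<in>?A. poly_moebius d) + (\<Sum>d\<in>?B. poly_moebius d) = 0" by (simp add: sum_negf)
    moreover have "(\<Sum>d\<in>?D. poly_moebius d) = (\<Sum>d\<in>?A. poly_moebius d) + (\<Sum>d\<in>?B. poly_moebius d)"
      using finA finB by (subst sum.union_disjoint[symmetric]) (blast | rule sum.cong)+
    ultimately show ?thesis using False by simp
  qed
qed

section \<open>Character sums over polynomials\<close>

lemma sum_character_subgroup:
  fixes \<eta> :: "'b::ab_group_add \<Rightarrow> complex"
  assumes fin: "finite H"
    and add: "\<And>x y. x \<in> H \<Longrightarrow> y \<in> H \<Longrightarrow> x + y \<in> H"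
    and diff: "\<And>x y. x \<in> H \<Longrightarrow> y \<in> H \<Longrightarrow> x - y \<in> H"
    and mult: "\<And>x y. x \<in> H \<Longrightarrow> y \<in> H \<Longrightarrow> \<eta> (x + y) = \<eta> x * \<eta> y"
  shows "(\<Sum>x\<in>H. \<eta> x) = (if \<forall>x\<in>H. \<eta> x = 1 then of_nat (card H) else 0)"
proof (cases "\<forall>x\<in>H. \<eta> x = 1")
  case False
  then obtain a where a: "a \<in> H" "\<eta> a \<noteq> 1" by auto
  have "(\<Sum>x\<in>H. \<eta> x) = (\<Sum>x\<in>H. \<eta> (x + a))"
    by (rule sum.reindex_bij_witness[of _ "\<lambda>x. x + a" "\<lambda>x. x - a"])
       (use a add diff in auto)
  also have "\<dots> = \<eta> a * (\<Sum>x\<in>H. \<eta> x)"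
    using mult a by (simp add: sum_distrib_left mult.commute)
  finally have "(1 - \<eta> a) * (\<Sum>x\<in>H. \<eta> x) = 0" by (simp add: algebra_simps)
  then have "(\<Sum>x\<in>H. \<eta> x) = 0" using a by auto
  then show ?thesis using False by auto
qed auto

lemma sum_monics_degree:
  fixes F :: "nat \<Rightarrow> real"
  assumes "finite B"
  shows "(\<Sum>u | lead_coeff (u :: 'a::{comm_ring_1,finite} poly) = 1 \<and> degree u \<in> B. F (degree u))
    = (\<Sum>b\<in>B. real CARD('a) ^ b * F b)"
proof -
  have eq: "{u :: 'a poly. lead_coeff u = 1 \<and> degree u \<in> B} = (\<Union>b\<in>B. monics b)"
    by (auto simp: monics_def)
  have "(\<Sum>u\<in>(\<Union>b\<in>B. monics b). F (degree (u :: 'a poly))) = (\<Sum>b\<in>B. \<Sum>u\<in>monics b. F (degree (u :: 'a poly)))"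
    using assms by (intro sum.UNION_disjoint ballI finite_monics) (auto simp: monics_def)
  also have "\<dots> = (\<Sum>b\<in>B. \<Sum>u\<in>(monics b :: 'a poly set). F b)"
    by (intro sum.cong refl) (simp add: monics_def)
  finally show ?thesis unfolding eq by (simp add: card_monics)
qed

lemma geometric_sum_le:
  fixes x :: real
  assumes "0 \<le> x" "x \<le> 1 / 2"
  shows "(\<Sum>b\<in>{l..<m}. x ^ b) \<le> 2 * x ^ l"
proof -
  have "(\<Sum>b\<in>{l..<m}. x ^ b) * (1 - x) \<le> x ^ l"
  proof (cases "l \<le> m")
    case True
    then have "(\<Sum>b\<in>{l..<m}. x ^ b) * (1 - x) = x ^ l - x ^ m"
    proof (induction m rule: dec_induct)
      case (step n)
      have "(\<Sum>b\<in>{l..<Suc n}. x ^ b) * (1 - x) = (\<Sum>b\<in>{l..<n}. x ^ b) * (1 - x) + x ^ n * (1 - x)"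
        using step(1) by (simp add: distrib_right)
      also have "\<dots> = x ^ l - x ^ Suc n" by (simp only: step.IH) (simp add: algebra_simps)
      finally show ?case .
    qed simp
    then show ?thesis using assms by simp
  qed (use assms in auto)
  moreover have "(\<Sum>b\<in>{l..<m}. x ^ b) * (1 / 2) \<le> (\<Sum>b\<in>{l..<m}. x ^ b) * (1 - x)"
    using assms by (intro mult_left_mono sum_nonneg) auto
  ultimately show ?thesis by linarith
qed

lemma card_finite_field_ge_2: "CARD('a::finite_field) \<ge> 2"
proof -
  have "card {0, 1 :: 'a} \<le> CARD('a)" by (intro card_mono) auto
  then show ?thesis by simp
qed

text \<open>
  The exponential sums depend on \<open>\<alpha>\<close> through finitely many coefficients only.  The point \<open>\<alpha>\<close> is
  represented by a polynomial \<open>c\<close> of degree less than \<open>K\<close>, whose coefficient at \<open>i\<close> is the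
  coefficient of \<open>\<alpha>\<close> at \<open>t\<close> to the power \<open>-1-i\<close>, and \<open>chi K c f\<close> is the value of \<open>e (f \<alpha>)\<close> for
  \<open>f\<close> of degree less than \<open>K\<close>.  Any nontrivial additive character \<open>\<psi>\<close> of the field may be used.
\<close>

locale r_free_sums =
  fixes \<psi> :: "'a::finite_field \<Rightarrow> complex" and q :: real and r :: nat
  assumes psi_add: "\<psi> (a + b) = \<psi> a * \<psi> b"
    and cmod_psi: "cmod (\<psi> a) = 1"
    and psi_nontrivial: "\<exists>a. \<psi> a \<noteq> 1"
    and q_eq: "q = real CARD('a)"
    and r_ge_2: "r \<ge> 2"
begin

lemma q_ge_2: "q \<ge> 2"
  unfolding q_eq using card_finite_field_ge_2[where 'a = 'a] by linarith

lemma q_pos: "q > 0" and q_nonzero: "q \<noteq> 0" and q_gt_1: "q > 1" and q_ge_1: "q \<ge> 1" and q_ge_0: "q \<ge> 0"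
  using q_ge_2 by linarith+

lemma real_card_polys_lt: "real (card (polys_lt m :: 'a poly set)) = q ^ m"
  and real_card_monics: "real (card (monics m :: 'a poly set)) = q ^ m"
  by (simp_all add: card_polys_lt card_monics q_eq)

lemma complex_card_polys_lt: "of_nat (card (polys_lt m :: 'a poly set)) = complex_of_real (q ^ m)"
  by (simp add: card_polys_lt q_eq)

lemma psi_0 [simp]: "\<psi> 0 = 1"
proof -
  have "\<psi> 0 * \<psi> 0 = \<psi> 0" using psi_add[of 0 0] by simp
  moreover have "\<psi> 0 \<noteq> 0" using cmod_psi[of 0] by auto
  ultimately show ?thesis by simp
qed

definition chi :: "nat \<Rightarrow> 'a poly \<Rightarrow> 'a poly \<Rightarrow> complex" where
  "chi K c f = \<psi> (\<Sum>i<K. coeff f i * coeff c i)"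

lemma chi_add_right: "chi K c (f + g) = chi K c f * chi K c g"
  by (simp add: chi_def psi_add[symmetric] sum.distrib[symmetric] distrib_right)

lemma chi_add_left: "chi K (c + d) f = chi K c f * chi K d f"
  by (simp add: chi_def psi_add[symmetric] sum.distrib[symmetric] distrib_left)

lemma cmod_chi [simp]: "cmod (chi K c f) = 1"
  by (simp add: chi_def cmod_psi)

lemma chi_0_right [simp]: "chi K c 0 = 1" and chi_0_left [simp]: "chi K 0 f = 1"
  by (simp_all add: chi_def)

lemma chi_nonzero [simp]: "chi K c f \<noteq> 0"
  using cmod_chi[of K c f] by (metis norm_zero zero_neq_one)

lemma cnj_chi: "cnj (chi K c f) = chi K c (- f)"
proof -
  have "chi K c f * chi K c (- f) = 1" using chi_add_right[of K c f "- f"] by simp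
  moreover have "chi K c f * cnj (chi K c f) = 1" by (simp add: complex_norm_square[symmetric])
  ultimately show ?thesis by (metis chi_nonzero mult_left_cancel)
qed

lemma sum_chi:
  assumes f: "f \<in> polys_lt K"
  shows "(\<Sum>c\<in>polys_lt K. chi K c f) = (if f = 0 then of_real (q ^ K) else 0)"
proof (cases "f = 0")
  case False
  then have deg: "degree f < K" using f by (simp add: polys_lt_iff)
  obtain a where a: "\<psi> a \<noteq> 1" using psi_nontrivial by auto
  let ?c = "monom (a / lead_coeff f) (degree f)"
  have "(\<Sum>i<K. coeff f i * coeff ?c i) = (\<Sum>i<K. if i = degree f then a else 0)"
    using False by (intro sum.cong) auto
  also have "\<dots> = a" using deg by simp
  finally have "chi K ?c f \<noteq> 1" using a by (simp add: chi_def)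
  moreover have "?c \<in> polys_lt K" using deg by (simp add: monom_in_polys_lt)
  ultimately have "\<not> (\<forall>c\<in>polys_lt K. chi K c f = 1)" by blast
  then show ?thesis
    using sum_character_subgroup[of "polys_lt K" "\<lambda>c. chi K c f"] False
    by (auto simp: polys_lt_add polys_lt_diff chi_add_left)
qed (simp add: complex_card_polys_lt)

text \<open>Parseval's identity for the characters \<open>chi K c\<close>.\<close>

lemma parseval:
  fixes a :: "'a poly \<Rightarrow> real"
  assumes F: "finite F" "F \<subseteq> polys_lt K"
  shows "(\<Sum>c\<in>polys_lt K. (cmod (\<Sum>f\<in>F. of_real (a f) * chi K c f))\<^sup>2) = q ^ K * (\<Sum>f\<in>F. (a f)\<^sup>2)"
proof -
  have "complex_of_real (\<Sum>c\<in>polys_lt K. (cmod (\<Sum>f\<in>F. of_real (a f) * chi K c f))\<^sup>2)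
      = (\<Sum>c\<in>polys_lt K. (\<Sum>f\<in>F. of_real (a f) * chi K c f) * (\<Sum>g\<in>F. of_real (a g) * chi K c (- g)))"
    by (simp only: of_real_sum complex_norm_square cnj_sum complex_cnj_mult complex_cnj_complex_of_real cnj_chi)
  also have "\<dots> = (\<Sum>c\<in>polys_lt K. \<Sum>f\<in>F. \<Sum>g\<in>F. of_real (a f * a g) * chi K c (f - g))"
    unfolding sum_product diff_conv_add_uminus
    by (intro sum.cong refl) (simp only: chi_add_right of_real_mult mult_ac)
  also have "\<dots> = (\<Sum>f\<in>F. \<Sum>g\<in>F. \<Sum>c\<in>polys_lt K. of_real (a f * a g) * chi K c (f - g))"
    by (subst sum.swap) (intro sum.cong refl sum.swap)
  also have "\<dots> = (\<Sum>f\<in>F. \<Sum>g\<in>F. if g = f then of_real (a f * a g * q ^ K) else 0)"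
    using F by (intro sum.cong refl)
      (auto simp: sum_distrib_left[symmetric] sum_chi polys_lt_diff subset_iff)
  also have "\<dots> = complex_of_real (q ^ K * (\<Sum>f\<in>F. (a f)\<^sup>2))"
    using F(1) by (simp add: sum_distrib_left power2_eq_square mult_ac)
  finally show ?thesis by (simp only: of_real_eq_iff)
qed

section \<open>Decomposition of the exponential sum\<close>

text \<open>
  \<open>expsum K n\<close> is the part of the exponential sum over the \<open>r\<close>-free polynomials that comes from
  degree exactly \<open>n\<close>; \<open>mult_sum K n d\<close> is the sum over the monic multiples of \<open>d ^ r\<close> of degree \<open>n\<close>.
\<close>

definition expsum :: "nat \<Rightarrow> nat \<Rightarrow> 'a poly \<Rightarrow> complex" where
  "expsum K n c = (\<Sum>f\<in>monics n. (if r_free r f then 1 else 0) * chi K c f)"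

definition mult_sum :: "nat \<Rightarrow> nat \<Rightarrow> 'a poly \<Rightarrow> 'a poly \<Rightarrow> complex" where
  "mult_sum K n d c = (\<Sum>f | f \<in> monics n \<and> d ^ r dvd f. chi K c f)"

text \<open>
  The monic \<open>d\<close> for which \<open>d ^ r\<close> divides some polynomial of degree \<open>n\<close>.
\<close>

definition rdivs :: "nat \<Rightarrow> 'a poly set" where
  "rdivs n = {d. lead_coeff d = 1 \<and> r * degree d \<le> n}"

lemma rdivs_bound: "d \<in> rdivs n \<Longrightarrow> lead_coeff d = 1 \<and> degree d \<le> n"
proof -
  assume d: "d \<in> rdivs n"
  have "degree d \<le> r * degree d" using r_ge_2 by (cases r) auto
  moreover have "r * degree d \<le> n" using d by (simp add: rdivs_def)
  ultimately have "degree d \<le> n" by (rule le_trans)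
  then show ?thesis using d by (simp add: rdivs_def)
qed

lemma finite_rdivs [simp]: "finite (rdivs n)"
  by (rule finite_subset[OF _ finite_monic_degree_le[of n]]) (use rdivs_bound in auto)

lemma degree_monic_power: "lead_coeff d = 1 \<Longrightarrow> degree (d ^ r) = r * degree d" for d :: "'a poly"
  by (simp add: degree_power_eq monic_nonzero mult.commute)

lemma power_dvd_in_rdivs:
  assumes "lead_coeff d = 1" "d ^ r dvd f" "f \<in> monics n"
  shows "d \<in> rdivs n"
proof -
  have "f \<noteq> 0" "degree f = n" using assms(3) by (auto simp: monics_def)
  then have "degree (d ^ r) \<le> n" using assms(2) dvd_imp_degree_le by blast
  then show ?thesis using assms(1) degree_monic_power by (simp add: rdivs_def)
qed

text \<open>
  The part of the Moebius decomposition with \<open>d\<close> restricted by \<open>P\<close>.  It is also an exponential sum over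
  \<open>f\<close> with real coefficients.
\<close>

definition partial_sum :: "('a poly \<Rightarrow> bool) \<Rightarrow> nat \<Rightarrow> nat \<Rightarrow> 'a poly \<Rightarrow> complex" where
  "partial_sum P K n c = (\<Sum>d | d \<in> rdivs n \<and> P d. of_real (poly_moebius d) * mult_sum K n d c)"

lemma partial_sum_eq:
  "partial_sum P K n c =
    (\<Sum>f\<in>monics n. of_real (\<Sum>d | d \<in> rdivs n \<and> P d \<and> d ^ r dvd f. poly_moebius d) * chi K c f)"
proof -
  have "partial_sum P K n c = (\<Sum>d | d \<in> rdivs n \<and> P d. \<Sum>f\<in>monics n.
      if d ^ r dvd f then of_real (poly_moebius d) * chi K c f else 0)"
    unfolding partial_sum_def mult_sum_def
    by (intro sum.cong refl) (simp add: sum_distrib_left sum.inter_filter if_distrib cong: if_cong)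
  also have "\<dots> = (\<Sum>f\<in>monics n. \<Sum>d | d \<in> rdivs n \<and> P d.
      if d ^ r dvd f then of_real (poly_moebius d) * chi K c f else 0)"
    by (rule sum.swap)
  also have "\<dots> = (\<Sum>f\<in>monics n. \<Sum>d | d \<in> rdivs n \<and> P d \<and> d ^ r dvd f.
      of_real (poly_moebius d) * chi K c f)"
    by (rule sum.cong[OF refl], subst sum.inter_filter[symmetric]) (auto intro!: sum.cong)
  finally show ?thesis by (simp add: sum_distrib_right)
qed

lemma expsum_eq_partial_sum: "expsum K n c = partial_sum (\<lambda>d. True) K n c"
proof -
  have "(\<Sum>d | d \<in> rdivs n \<and> True \<and> d ^ r dvd f. poly_moebius d) = (if r_free r f then 1 else 0)"
    if f: "f \<in> monics n" for f
  proof -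
    have "{d. d \<in> rdivs n \<and> True \<and> d ^ r dvd f} = {d. lead_coeff d = 1 \<and> d ^ r dvd f}"
      using power_dvd_in_rdivs f rdivs_bound by auto
    moreover have "f \<noteq> 0" "r \<ge> 1" using f r_ge_2 by (auto simp: monics_def)
    ultimately show ?thesis using sum_poly_moebius_eq_r_free[of f r] by simp
  qed
  then show ?thesis unfolding partial_sum_eq expsum_def by (intro sum.cong refl) auto
qed

lemma partial_sum_split:
  "partial_sum P K n c = partial_sum (\<lambda>d. P d \<and> Q d) K n c + partial_sum (\<lambda>d. P d \<and> \<not> Q d) K n c"
  unfolding partial_sum_def
  by (subst sum.union_disjoint[symmetric]) (auto intro!: sum.cong)

text \<open>
  The points at which the sum over the multiples of \<open>d ^ r\<close> does not vanish, for \<open>d \<in> rdivs n\<close> and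
  \<open>n \<le> K\<close>.  They correspond to the
  \<open>\<alpha>\<close> for which \<open>d ^ r \<alpha>\<close> is at distance less than \<open>q\<close> to the power \<open>- (n - r * degree d)\<close> from a
  polynomial, that is, to the union of the arcs around the fractions with denominator \<open>d ^ r\<close>.
\<close>

definition arcs :: "nat \<Rightarrow> nat \<Rightarrow> 'a poly \<Rightarrow> 'a poly set" where
  "arcs K n d = {c \<in> polys_lt K. \<forall>g\<in>polys_lt (n - r * degree d). chi K c (d ^ r * g) = 1}"

lemma finite_arcs [simp]: "finite (arcs K n d)"
  by (rule finite_subset[OF _ finite_polys_lt[of K]]) (auto simp: arcs_def)

lemma sum_chi_multiples:
  assumes "c \<in> polys_lt K"
  shows "(\<Sum>g\<in>polys_lt (n - r * degree d). chi K c (d ^ r * g))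
    = (if c \<in> arcs K n d then of_real (q ^ (n - r * degree d)) else 0)"
  by (subst sum_character_subgroup)
     (use assms in \<open>auto simp: polys_lt_add polys_lt_diff distrib_left chi_add_right arcs_def complex_card_polys_lt\<close>)

lemma mult_sum_eq:
  assumes d: "d \<in> rdivs n" and c: "c \<in> polys_lt K"
  shows "mult_sum K n d c = (if c \<in> arcs K n d
    then of_real (q ^ (n - r * degree d)) * chi K c (d ^ r * monom 1 (n - r * degree d)) else 0)"
proof -
  let ?m = "n - r * degree d"
  have d1: "lead_coeff d = 1" "r * degree d \<le> n" using d by (auto simp: rdivs_def)
  have nz: "d ^ r \<noteq> 0" using d1 by (auto simp: monic_nonzero)
  have "{f. f \<in> monics n \<and> d ^ r dvd f} = (\<lambda>g. d ^ r * g) ` monics ?m"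
    using monics_multiples[OF monic_power[OF d1(1)], of r n] d1 by (simp add: degree_monic_power)
  then have "mult_sum K n d c = (\<Sum>f\<in>(\<lambda>g. d ^ r * g) ` monics ?m. chi K c f)"
    by (simp add: mult_sum_def)
  also have "\<dots> = (\<Sum>g\<in>monics ?m. chi K c (d ^ r * g))"
    using nz by (subst sum.reindex) (auto simp: inj_on_def)
  also have "\<dots> = (\<Sum>g\<in>polys_lt ?m. chi K c (d ^ r * (monom 1 ?m + g)))"
    unfolding monics_eq by (subst sum.reindex) (auto simp: inj_on_def)
  also have "\<dots> = (\<Sum>g\<in>polys_lt ?m. chi K c (d ^ r * g)) * chi K c (d ^ r * monom 1 ?m)"
    by (simp add: distrib_left chi_add_right sum_distrib_left mult.commute)
  finally show ?thesis using sum_chi_multiples[OF c] by simp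
qed

text \<open>
  Double counting of the sums over \<open>g\<close> and \<open>c\<close>: the arcs for \<open>d\<close> have total measure \<open>q\<close> to the power
  \<open>- (n - r * degree d)\<close>.
\<close>

lemma card_arcs:
  assumes d: "d \<in> rdivs n" and n: "n \<le> K"
  shows "real (card (arcs K n d)) * q ^ (n - r * degree d) = q ^ K"
proof -
  let ?m = "n - r * degree d"
  have d1: "lead_coeff d = 1" "r * degree d \<le> n" using d by (auto simp: rdivs_def)
  have nz: "d ^ r \<noteq> 0" using d1 by (auto simp: monic_nonzero)
  have mem: "d ^ r * g \<in> polys_lt K" if "g \<in> polys_lt ?m" for g
    using d1 n by (intro mult_in_polys_lt[OF that]) (simp add: degree_monic_power)
  have "complex_of_real (real (card (arcs K n d)) * q ^ ?m)
      = (\<Sum>c\<in>polys_lt K. if c \<in> arcs K n d then of_real (q ^ ?m) else 0)"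
    by (subst sum.inter_restrict[symmetric]) (auto simp: arcs_def Int_def intro!: arg_cong[of _ _ card])
  also have "\<dots> = (\<Sum>c\<in>polys_lt K. \<Sum>g\<in>polys_lt ?m. chi K c (d ^ r * g))"
    by (intro sum.cong refl) (simp only: sum_chi_multiples)
  also have "\<dots> = (\<Sum>g\<in>polys_lt ?m. \<Sum>c\<in>polys_lt K. chi K c (d ^ r * g))"
    by (rule sum.swap)
  also have "\<dots> = (\<Sum>g\<in>polys_lt ?m. if g = (0 :: 'a poly) then of_real (q ^ K) else 0)"
    by (intro sum.cong refl) (simp only: sum_chi[OF mem] mult_eq_0_iff nz simp_thms)
  also have "\<dots> = complex_of_real (q ^ K)" by simp
  finally show ?thesis by (simp only: of_real_eq_iff)
qed

lemma sum_cmod_mult_sum: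
  assumes d: "d \<in> rdivs n" and n: "n \<le> K"
  shows "(\<Sum>c\<in>polys_lt K. cmod (mult_sum K n d c)) = q ^ K"
proof -
  let ?m = "n - r * degree d"
  have "(\<Sum>c\<in>polys_lt K. cmod (mult_sum K n d c)) = (\<Sum>c\<in>polys_lt K. if c \<in> arcs K n d then q ^ ?m else 0)"
    using d by (intro sum.cong refl) (simp add: mult_sum_eq norm_mult norm_power q_ge_0)
  also have "\<dots> = real (card (arcs K n d)) * q ^ ?m"
    by (subst sum.inter_restrict[symmetric]) (auto simp: arcs_def Int_def intro!: arg_cong[of _ _ card])
  finally show ?thesis using card_arcs[OF assms] by simp
qed

lemma card_monic_degree_less_le:
  "real (card {d :: 'a poly. lead_coeff d = 1 \<and> degree d < j}) \<le> q ^ j"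
proof -
  have "real (card {d :: 'a poly. lead_coeff d = 1 \<and> degree d < j}) = (\<Sum>b<j. q ^ b)"
    using sum_monics_degree[of "{..<j}" "\<lambda>_. 1", where 'a = 'a] by (simp add: q_eq)
  also have "\<dots> \<le> q ^ j"
  proof (induction j)
    case (Suc j)
    have "2 * q ^ j \<le> q * q ^ j" using q_ge_2 by (intro mult_right_mono) auto
    then show ?case using Suc by simp
  qed simp
  finally show ?thesis .
qed

text \<open>The mean value of the part with \<open>degree d < j\<close>.\<close>

lemma sum_cmod_partial_sum_le:
  assumes n: "n \<le> K"
  shows "(\<Sum>c\<in>polys_lt K. cmod (partial_sum (\<lambda>d. degree d < j) K n c)) \<le> q ^ K * q ^ j"
proof -
  let ?D = "{d. d \<in> rdivs n \<and> degree d < j}"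
  have "(\<Sum>c\<in>polys_lt K. cmod (partial_sum (\<lambda>d. degree d < j) K n c))
      \<le> (\<Sum>c\<in>polys_lt K. \<Sum>d\<in>?D. cmod (mult_sum K n d c))"
    unfolding partial_sum_def
    by (intro sum_mono sum_norm_le)
       (auto simp: norm_mult intro!: mult_left_le_one_le abs_poly_moebius_le)
  also have "\<dots> = (\<Sum>d\<in>?D. \<Sum>c\<in>polys_lt K. cmod (mult_sum K n d c))" by (rule sum.swap)
  also have "\<dots> = q ^ K * real (card ?D)" using n by (simp add: sum_cmod_mult_sum)
  also have "\<dots> \<le> q ^ K * real (card {d :: 'a poly. lead_coeff d = 1 \<and> degree d < j})"
    using q_ge_0
    by (intro mult_left_mono of_nat_mono card_mono finite_subset[OF _ finite_monic_degree_le[of j]])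
       (auto simp: rdivs_def)
  also have "\<dots> \<le> q ^ K * q ^ j"
    using q_ge_0 card_monic_degree_less_le by (intro mult_left_mono) auto
  finally show ?thesis .
qed

section \<open>The mean square of the contribution of large divisors\<close>

lemma inverse_q_power_r: "1 / q ^ (r - 1) \<le> 1 / 2"
proof -
  have "q ^ 1 \<le> q ^ (r - 1)" using r_ge_2 q_ge_1 by (intro power_increasing) auto
  then have "2 \<le> q ^ (r - 1)" using q_ge_2 by simp
  then show ?thesis by (simp add: divide_simps)
qed

lemma sum_inverse_power_degree_le:
  "(\<Sum>u | lead_coeff (u :: 'a poly) = 1 \<and> degree u \<in> {l..<m}. 1 / q ^ (r * degree u))
    \<le> 2 * (1 / q ^ (r - 1)) ^ l"
proof -
  have "(\<Sum>u | lead_coeff (u :: 'a poly) = 1 \<and> degree u \<in> {l..<m}. 1 / q ^ (r * degree u))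
      = (\<Sum>b\<in>{l..<m}. q ^ b * (1 / q ^ (r * b)))"
    unfolding q_eq by (rule sum_monics_degree) simp
  also have "\<dots> = (\<Sum>b\<in>{l..<m}. (1 / q ^ (r - 1)) ^ b)"
  proof (intro sum.cong refl)
    fix b
    have "r * b = b + (r - 1) * b" using r_ge_2 by (cases r) auto
    then show "q ^ b * (1 / q ^ (r * b)) = (1 / q ^ (r - 1)) ^ b"
      using q_pos by (simp add: power_add power_mult power_divide)
  qed
  also have "\<dots> \<le> 2 * (1 / q ^ (r - 1)) ^ l"
    using q_pos inverse_q_power_r by (intro geometric_sum_le) auto
  finally show ?thesis .
qed

lemma finite_monic_degree_in:
  "finite B \<Longrightarrow> finite {u :: 'a poly. lead_coeff u = 1 \<and> degree u \<in> B}"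
  by (rule finite_subset[OF _ finite_monic_degree_le[of "Max B"]]) auto

text \<open>
  In the mean square two divisors of degree at least \<open>j\<close> with a greatest common divisor of degree \<open>a\<close>
  have cofactors of degree at least \<open>j - a\<close>; this bounds the resulting sum over \<open>a\<close>.
\<close>

lemma gcd_lcm_weight_le:
  fixes x :: real
  assumes "0 \<le> x" "x \<le> 1 / 2"
  shows "(\<Sum>a<m. x ^ a * (x ^ (j - a))\<^sup>2) \<le> 3 * x ^ j"
proof -
  have small: "(\<Sum>a<j. x ^ (j - a)) \<le> 1"
  proof (induction j)
    case (Suc j)
    have "(\<Sum>a<Suc j. x ^ (Suc j - a)) = x * (\<Sum>a<j. x ^ (j - a)) + x"
      by (simp add: sum_distrib_left Suc_diff_le)
    also have "\<dots> \<le> 1 / 2 * 1 + 1 / 2"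
      using Suc assms by (intro add_mono mult_mono sum_nonneg) auto
    finally show ?case by simp
  qed simp
  have "(\<Sum>a<m. x ^ a * (x ^ (j - a))\<^sup>2) \<le> (\<Sum>a\<in>{..<j} \<union> {j..<m}. x ^ a * (x ^ (j - a))\<^sup>2)"
    using assms by (intro sum_mono2) auto
  also have "\<dots> = (\<Sum>a<j. x ^ a * (x ^ (j - a))\<^sup>2) + (\<Sum>a\<in>{j..<m}. x ^ a * (x ^ (j - a))\<^sup>2)"
    by (rule sum.union_disjoint) auto
  also have "(\<Sum>a<j. x ^ a * (x ^ (j - a))\<^sup>2) = (\<Sum>a<j. x ^ j * x ^ (j - a))"
    by (intro sum.cong refl) (simp add: power2_eq_square power_add[symmetric])
  also have "\<dots> = x ^ j * (\<Sum>a<j. x ^ (j - a))" by (simp add: sum_distrib_left)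
  also have "\<dots> \<le> x ^ j * 1" using small assms by (intro mult_left_mono) auto
  also have "(\<Sum>a\<in>{j..<m}. x ^ a * (x ^ (j - a))\<^sup>2) = (\<Sum>a\<in>{j..<m}. x ^ a)"
    by (intro sum.cong refl) auto
  also have "\<dots> \<le> 2 * x ^ j" using assms by (rule geometric_sum_le)
  finally show ?thesis by simp
qed

text \<open>
  A common multiple of \<open>d ^ r\<close> and \<open>e ^ r\<close>, where \<open>d = g * u\<close> and \<open>e = g * v\<close> with \<open>u\<close>, \<open>v\<close> coprime,
  is a multiple of \<open>(g * u * v) ^ r\<close>.
\<close>

lemma card_common_multiples_le:
  assumes "lead_coeff d = 1" "lead_coeff e = 1"
  obtains g u v :: "'a poly" where "lead_coeff g = 1" "lead_coeff u = 1" "lead_coeff v = 1"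
    "d = g * u" "e = g * v"
    "real (card {f \<in> monics n. d ^ r dvd f \<and> e ^ r dvd f})
      \<le> q ^ n * (1 / q ^ (r * degree g)) * (1 / q ^ (r * degree u)) * (1 / q ^ (r * degree v))"
proof -
  obtain g u v where g: "lead_coeff g = 1" "lead_coeff u = 1" "lead_coeff v = 1"
      "d = g * u" "e = g * v" "comaximal u v"
    using exists_comaximal_decomposition[OF assms] by blast
  have uv: "lead_coeff (u * v) = 1" using monic_mult g by blast
  have guv: "lead_coeff (g * (u * v)) = 1" using monic_mult g(1) uv by blast
  have deg: "degree (g * (u * v)) = degree g + (degree u + degree v)"
    using degree_monic_mult[OF g(1) uv] degree_monic_mult[OF g(2,3)] by simp
  have sub: "{f \<in> monics n. d ^ r dvd f \<and> e ^ r dvd f} \<subseteq> {f \<in> monics n. (g * (u * v)) ^ r dvd f}"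
  proof
    fix f assume f: "f \<in> {f \<in> monics n. d ^ r dvd f \<and> e ^ r dvd f}"
    have "g ^ r dvd f" using f g(4) by (auto simp: power_mult_distrib dest: dvd_mult_left)
    then obtain h where h: "f = g ^ r * h" by (rule dvdE)
    have nz: "g ^ r \<noteq> 0" using g(1) by (auto simp: monic_nonzero)
    have "u ^ r dvd h" "v ^ r dvd h"
      using f nz unfolding g(4,5) h by (auto simp: power_mult_distrib)
    moreover have "comaximal (u ^ r) (v ^ r)" using g(6) by (rule comaximal_power)
    ultimately have "u ^ r * v ^ r dvd h" by (intro comaximal_mult_dvd)
    then show "f \<in> {f \<in> monics n. (g * (u * v)) ^ r dvd f}"
      using f h by (auto simp: power_mult_distrib)
  qed
  have "real (card {f \<in> monics n. d ^ r dvd f \<and> e ^ r dvd f})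
      \<le> real (card {f \<in> monics n. (g * (u * v)) ^ r dvd f})"
    using card_mono[OF _ sub] by simp
  also have "\<dots> \<le> q ^ n / q ^ (r * degree (g * (u * v)))"
    unfolding q_eq by (rule card_monics_power_multiples_le[OF guv])
  also have "\<dots> = q ^ n * (1 / q ^ (r * degree g)) * (1 / q ^ (r * degree u)) * (1 / q ^ (r * degree v))"
    unfolding deg by (simp add: distrib_left power_add)
  finally show ?thesis using that[OF g(1-5)] by blast
qed

text \<open>
  The mean square of the coefficients.  Expanding the square counts common multiples of \<open>d ^ r\<close> and
  \<open>e ^ r\<close>; the pairs \<open>(d, e)\<close> are parametrised by triples \<open>(g, u, v)\<close>, where coprimality of \<open>u\<close> and
  \<open>v\<close> may be dropped for an upper bound.
\<close>

lemma sum_square_large_divisors_le: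
  "(\<Sum>f\<in>monics n. (\<Sum>d | d \<in> rdivs n \<and> j \<le> degree d \<and> d ^ r dvd f. poly_moebius d)\<^sup>2)
    \<le> 12 * q ^ n / q ^ ((r - 1) * j)"
proof -
  define x where "x = 1 / q ^ (r - 1)"
  define y where "y u = 1 / q ^ (r * degree u)" for u :: "'a poly"
  define M where "M l = {u :: 'a poly. lead_coeff u = 1 \<and> degree u \<in> {l..<Suc n}}" for l
  define T where "T = (SIGMA g:M 0. M (j - degree g) \<times> M (j - degree g))"
  define D where "D = {d \<in> rdivs n. j \<le> degree d}"
  define w where "w = (\<lambda>(g, u, v). q ^ n * y g * y u * y v)"
  have x: "0 \<le> x" "x \<le> 1 / 2" using inverse_q_power_r q_pos by (auto simp: x_def)
  have finM: "finite (M l)" for l unfolding M_def by (rule finite_monic_degree_in) simp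
  have finD: "finite D" by (simp add: D_def)
  have y0: "y u \<ge> 0" for u using q_pos by (simp add: y_def)
  have w0: "w t \<ge> 0" for t using q_pos y0 by (cases t) (simp add: w_def)
  have tail: "(\<Sum>u\<in>M l. y u) \<le> 2 * x ^ l" for l
    unfolding M_def y_def x_def by (rule sum_inverse_power_degree_le)
  have "(\<Sum>f\<in>monics n. (\<Sum>d | d \<in> rdivs n \<and> j \<le> degree d \<and> d ^ r dvd f. poly_moebius d)\<^sup>2)
      \<le> (\<Sum>f\<in>monics n. (\<Sum>d\<in>D. of_bool (d ^ r dvd f))\<^sup>2)"
  proof (intro sum_mono)
    fix f :: "'a poly"
    have "\<bar>\<Sum>d | d \<in> rdivs n \<and> j \<le> degree d \<and> d ^ r dvd f. poly_moebius d\<bar>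
        \<le> (\<Sum>d | d \<in> rdivs n \<and> j \<le> degree d \<and> d ^ r dvd f. 1)"
      by (rule order.trans[OF sum_abs sum_mono]) (rule abs_poly_moebius_le)
    also have "\<dots> = (\<Sum>d | d \<in> D \<and> d ^ r dvd f. 1)"
      by (intro sum.cong) (auto simp: D_def)
    also have "\<dots> = (\<Sum>d\<in>D. of_bool (d ^ r dvd f))"
      using finD by (simp add: of_bool_def sum.inter_filter[symmetric])
    finally have "\<bar>\<Sum>d | d \<in> rdivs n \<and> j \<le> degree d \<and> d ^ r dvd f. poly_moebius d\<bar>
        \<le> (\<Sum>d\<in>D. of_bool (d ^ r dvd f))" .
    from power_mono[OF this abs_ge_zero, of 2]
    show "(\<Sum>d | d \<in> rdivs n \<and> j \<le> degree d \<and> d ^ r dvd f. poly_moebius d)\<^sup>2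
        \<le> (\<Sum>d\<in>D. of_bool (d ^ r dvd f))\<^sup>2"
      by (simp only: power2_abs)
  qed
  also have "\<dots> = (\<Sum>f\<in>monics n. \<Sum>(d, e)\<in>D \<times> D. of_bool (d ^ r dvd f \<and> e ^ r dvd f))"
    by (intro sum.cong refl)
       (simp add: power2_eq_square sum_product sum.cartesian_product of_bool_conj)
  also have "\<dots> = (\<Sum>(d, e)\<in>D \<times> D. \<Sum>f\<in>monics n. of_bool (d ^ r dvd f \<and> e ^ r dvd f))"
    by (subst sum.swap) (simp add: case_prod_unfold)
  also have "\<dots> = (\<Sum>(d, e)\<in>D \<times> D. real (card {f \<in> monics n. d ^ r dvd f \<and> e ^ r dvd f}))"
    by (intro sum.cong refl) (auto simp: of_bool_def sum.inter_filter[symmetric])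
  also have "\<dots> \<le> (\<Sum>t\<in>T. w t)"
  proof (rule sum_le_included[where i = "\<lambda>(g, u, v). (g * u, g * v)"])
    show "finite (D \<times> D)" using finD by simp
    show "finite T" unfolding T_def using finM by blast
    show "\<forall>t\<in>T. 0 \<le> w t" using w0 by simp
    show "\<forall>p\<in>D \<times> D. \<exists>t\<in>T. (\<lambda>(g, u, v). (g * u, g * v)) t = p \<and>
        (case p of (d, e) \<Rightarrow> real (card {f \<in> monics n. d ^ r dvd f \<and> e ^ r dvd f})) \<le> w t"
    proof
      fix p assume p: "p \<in> D \<times> D"
      obtain d e where de: "p = (d, e)" "d \<in> D" "e \<in> D" using p by auto
      have lead: "lead_coeff d = 1" "lead_coeff e = 1" using de rdivs_bound by (auto simp: D_def)
      obtain g u v where g: "lead_coeff g = 1" "lead_coeff u = 1" "lead_coeff v = 1"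
          "d = g * u" "e = g * v"
          "real (card {f \<in> monics n. d ^ r dvd f \<and> e ^ r dvd f})
            \<le> q ^ n * (1 / q ^ (r * degree g)) * (1 / q ^ (r * degree u)) * (1 / q ^ (r * degree v))"
        by (rule card_common_multiples_le[OF lead, of n])
      have "degree g + degree u = degree d" "degree g + degree v = degree e"
        unfolding g(4,5) using degree_monic_mult[OF g(1,2)] degree_monic_mult[OF g(1,3)] by simp_all
      moreover have "j \<le> degree d" "degree d \<le> n" "j \<le> degree e" "degree e \<le> n"
        using de rdivs_bound by (auto simp: D_def)
      ultimately have "(g, u, v) \<in> T" using g(1-3) by (auto simp: T_def M_def)
      then show "\<exists>t\<in>T. (\<lambda>(g, u, v). (g * u, g * v)) t = p \<and>
          (case p of (d, e) \<Rightarrow> real (card {f \<in> monics n. d ^ r dvd f \<and> e ^ r dvd f})) \<le> w t"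
        using g(4-6) de(1) by (intro bexI[of _ "(g, u, v)"]) (simp_all add: w_def y_def)
    qed
  qed
  also have "(\<Sum>t\<in>T. w t) = (\<Sum>g\<in>M 0. q ^ n * y g * (\<Sum>u\<in>M (j - degree g). y u)\<^sup>2)"
  proof -
    have "(\<Sum>t\<in>T. w t) = (\<Sum>g\<in>M 0. \<Sum>p\<in>M (j - degree g) \<times> M (j - degree g). w (g, p))"
      unfolding T_def by (subst sum.Sigma) (auto simp: finM)
    also have "\<dots> = (\<Sum>g\<in>M 0. \<Sum>u\<in>M (j - degree g). \<Sum>v\<in>M (j - degree g). q ^ n * y g * (y u * y v))"
      by (intro sum.cong refl) (simp add: sum.cartesian_product w_def case_prod_unfold mult.assoc)
    also have "\<dots> = (\<Sum>g\<in>M 0. q ^ n * y g * (\<Sum>u\<in>M (j - degree g). y u)\<^sup>2)"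
      unfolding power2_eq_square sum_product by (simp only: sum_distrib_left)
    finally show ?thesis .
  qed
  also have "\<dots> \<le> (\<Sum>g\<in>M 0. q ^ n * y g * (2 * x ^ (j - degree g))\<^sup>2)"
    using q_pos y0 tail by (intro sum_mono mult_left_mono power_mono sum_nonneg) auto
  also have "\<dots> = (\<Sum>g\<in>M 0. q ^ n * (1 / q ^ (r * degree g)) * (2 * x ^ (j - degree g))\<^sup>2)"
    by (simp add: y_def)
  also have "\<dots> = (\<Sum>a\<in>{0..<Suc n}. q ^ a * (q ^ n * (1 / q ^ (r * a)) * (2 * x ^ (j - a))\<^sup>2))"
    unfolding M_def q_eq by (rule sum_monics_degree) simp
  also have "\<dots> = 4 * q ^ n * (\<Sum>a<Suc n. x ^ a * (x ^ (j - a))\<^sup>2)"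
    unfolding sum_distrib_left
  proof (intro sum.cong)
    fix a
    have "r * a = a + (r - 1) * a" using r_ge_2 by (cases r) auto
    then have eq: "q ^ a * (1 / q ^ (r * a)) = x ^ a"
      using q_pos by (simp add: power_add power_mult power_divide x_def)
    have "q ^ a * (q ^ n * (1 / q ^ (r * a)) * (2 * x ^ (j - a))\<^sup>2)
        = (q ^ a * (1 / q ^ (r * a))) * (q ^ n * (2 * x ^ (j - a))\<^sup>2)"
      by (simp only: mult_ac)
    then show "q ^ a * (q ^ n * (1 / q ^ (r * a)) * (2 * x ^ (j - a))\<^sup>2)
        = 4 * q ^ n * (x ^ a * (x ^ (j - a))\<^sup>2)"
      unfolding eq by (simp add: power2_eq_square)
  qed auto
  also have "\<dots> \<le> 4 * q ^ n * (3 * x ^ j)"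
    by (intro mult_left_mono gcd_lcm_weight_le[OF x]) (use q_pos in auto)
  also have "\<dots> = 12 * q ^ n / q ^ ((r - 1) * j)"
    by (simp add: x_def power_divide power_mult)
  finally show ?thesis .
qed

lemma sum_square_partial_sum_le:
  assumes n: "n < K"
  shows "(\<Sum>c\<in>polys_lt K. (cmod (partial_sum (\<lambda>d. j \<le> degree d) K n c))\<^sup>2)
    \<le> q ^ K * (12 * q ^ n / q ^ ((r - 1) * j))"
proof -
  have sub: "monics n \<subseteq> (polys_lt K :: 'a poly set)" using n by (auto simp: monics_def polys_lt_iff)
  show ?thesis
    unfolding partial_sum_eq parseval[OF finite_monics sub]
    using q_pos sum_square_large_divisors_le by (intro mult_left_mono) auto
qed

section \<open>The upper bound for the measure of the level sets\<close>

text \<open>Markov's inequality for finite sums.\<close>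

lemma card_ge_le:
  fixes F :: "'b \<Rightarrow> real"
  assumes "finite A" "\<And>c. c \<in> A \<Longrightarrow> 0 \<le> F c" "L > 0" "sum F A \<le> S"
  shows "real (card {c \<in> A. L \<le> F c}) \<le> S / L"
proof -
  have "real (card {c \<in> A. L \<le> F c}) * L = (\<Sum>c\<in>{c \<in> A. L \<le> F c}. L)" by simp
  also have "\<dots> \<le> (\<Sum>c\<in>{c \<in> A. L \<le> F c}. F c)" by (intro sum_mono) auto
  also have "\<dots> \<le> sum F A" using assms by (intro sum_mono2) auto
  finally show ?thesis using assms by (simp add: divide_simps)
qed

text \<open>
  The divisors of degree less than \<open>j\<close> are treated by the mean value and the others by the mean
  square; at the level \<open>q ^ n / q ^ (r * j)\<close> both contribute to the same order.
\<close>

lemma card_large_expsum_le: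
  assumes n: "n < K"
  shows "real (card {c \<in> polys_lt K. 2 * (q ^ n / q ^ (r * j)) \<le> cmod (expsum K n c)})
    \<le> 13 * q ^ K * (q ^ ((r + 1) * j) / q ^ n)"
proof -
  define L where "L = q ^ n / q ^ (r * j)"
  have L: "L > 0" using q_pos by (simp add: L_def)
  let ?low = "\<lambda>c. cmod (partial_sum (\<lambda>d. degree d < j) K n c)"
  let ?high = "\<lambda>c. cmod (partial_sum (\<lambda>d. j \<le> degree d) K n c)"
  have split: "cmod (expsum K n c) \<le> ?low c + ?high c" for c
    using norm_triangle_ineq partial_sum_split[of "\<lambda>d. True" K n c "\<lambda>d. degree d < j"]
    by (simp add: expsum_eq_partial_sum not_less)
  have sub: "{c \<in> polys_lt K. 2 * L \<le> cmod (expsum K n c)}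
      \<subseteq> {c \<in> polys_lt K. L \<le> ?low c} \<union> {c \<in> polys_lt K. L\<^sup>2 \<le> (?high c)\<^sup>2}"
  proof
    fix c assume c: "c \<in> {c \<in> polys_lt K. 2 * L \<le> cmod (expsum K n c)}"
    then have "L \<le> ?low c \<or> L \<le> ?high c" using split[of c] by auto
    then show "c \<in> {c \<in> polys_lt K. L \<le> ?low c} \<union> {c \<in> polys_lt K. L\<^sup>2 \<le> (?high c)\<^sup>2}"
      using c L by (auto intro: power_mono)
  qed
  have "real (card {c \<in> polys_lt K. 2 * L \<le> cmod (expsum K n c)})
      \<le> real (card ({c \<in> polys_lt K. L \<le> ?low c} \<union> {c \<in> polys_lt K. L\<^sup>2 \<le> (?high c)\<^sup>2}))"
    using card_mono[OF _ sub] by simp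
  also have "\<dots> \<le> real (card {c \<in> polys_lt K. L \<le> ?low c}) + real (card {c \<in> polys_lt K. L\<^sup>2 \<le> (?high c)\<^sup>2})"
    by (simp only: of_nat_add[symmetric] of_nat_le_iff card_Un_le)
  also have "\<dots> \<le> q ^ K * q ^ j / L + q ^ K * (12 * q ^ n / q ^ ((r - 1) * j)) / L\<^sup>2"
    using L n sum_cmod_partial_sum_le sum_square_partial_sum_le
    by (intro add_mono card_ge_le) auto
  also have "q ^ K * q ^ j / L = q ^ K * (q ^ ((r + 1) * j) / q ^ n)"
    using q_pos by (simp add: L_def power_add distrib_right)
  also have "q ^ K * (12 * q ^ n / q ^ ((r - 1) * j)) / L\<^sup>2 = 12 * q ^ K * (q ^ ((r + 1) * j) / q ^ n)"
  proof -
    have "r * j + r * j = (r + 1) * j + (r - 1) * j" using r_ge_2 by (cases r) (auto simp: algebra_simps)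
    then have "q ^ (r * j) * q ^ (r * j) = q ^ ((r + 1) * j) * q ^ ((r - 1) * j)"
      by (metis power_add)
    then show ?thesis using q_pos by (simp add: L_def power2_eq_square divide_simps)
  qed
  finally show ?thesis by (simp add: L_def algebra_simps)
qed

end

section \<open>Squarefree polynomials\<close>

lemma squarefree_one_poly [simp]: "squarefree (1 :: 'a::field poly)"
  by (auto simp: squarefree_def power2_eq_square dest: dvd_mult_left)

lemma squarefree_irreducible: "irreducible \<pi> \<Longrightarrow> squarefree (\<pi> :: 'a::field poly)"
  using squarefree_irreducible_mult[of \<pi> 1] by (auto simp: irreducible_def)

lemma irreducible_degree_pos: "irreducible \<pi> \<Longrightarrow> degree \<pi> \<ge> 1" for \<pi> :: "'a::field poly"
  using is_unit_iff_degree[of \<pi>] by (cases "degree \<pi>") (auto simp: irreducible_def)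

lemma squarefree_dvdI:
  fixes b d :: "'a::field poly"
  assumes "lead_coeff b = 1" "squarefree b"
    and "\<And>\<pi>. irreducible \<pi> \<Longrightarrow> lead_coeff \<pi> = 1 \<Longrightarrow> \<pi> dvd b \<Longrightarrow> \<pi> dvd d"
  shows "b dvd d"
  using assms
proof (induction "degree b" arbitrary: b rule: less_induct)
  case less
  show ?case
  proof (cases "is_unit b")
    case False
    have "b \<noteq> 0" using less.prems(1) by auto
    then obtain \<pi> where \<pi>: "irreducible \<pi>" "lead_coeff \<pi> = 1" "\<pi> dvd b"
      using exists_monic_irreducible_factor False by metis
    obtain b' where b': "b = \<pi> * b'" using \<pi>(3) by (rule dvdE)
    have b'1: "lead_coeff b' = 1" using monic_cofactor[OF b' less.prems(1) \<pi>(2)] .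
    have "degree b' < degree b"
      using degree_monic_mult[OF \<pi>(2) b'1] irreducible_degree_pos[OF \<pi>(1)] b' by simp
    moreover have "squarefree b'"
      using less.prems(2) unfolding b' by (rule squarefree_dvd) simp
    moreover have "\<rho> dvd d" if "irreducible \<rho>" "lead_coeff \<rho> = 1" "\<rho> dvd b'" for \<rho>
      using less.prems(3)[OF that(1,2)] that(3) by (simp add: b')
    ultimately have "b' dvd d" using less.hyps b'1 by blast
    moreover have "\<not> \<pi> dvd b'"
    proof
      assume "\<pi> dvd b'"
      then have "\<pi>\<^sup>2 dvd b" unfolding b' by (simp add: power2_eq_square)
      then show False using less.prems(2) \<pi>(1) by (auto simp: squarefree_def irreducible_def)
    qed
    moreover have "\<pi> dvd d" using less.prems(3) \<pi> by blast
    ultimately show ?thesis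
      unfolding b' using irreducible_comaximal[OF \<pi>(1)] comaximal_mult_dvd by blast
  qed auto
qed

text \<open>
  Squarefree polynomials of degree \<open>i \<ge> 2\<close> are not divisible by the square of the variable; this
  already makes their weighted number smaller than \<open>1\<close> for every \<open>q\<close>.
\<close>

lemma sum_squarefree_inverse_square_le:
  "(\<Sum>u | lead_coeff (u :: 'a::finite_field poly) = 1 \<and> squarefree u \<and> degree u \<in> {1..<m}.
      1 / real CARD('a) ^ (2 * degree u)) \<le> 7 / 8"
proof -
  let ?q = "real CARD('a)"
  let ?S = "\<lambda>i. {u \<in> monics i. squarefree (u :: 'a poly)}"
  define x where "x = 1 / ?q"
  have q: "?q \<ge> 2" using card_finite_field_ge_2[where 'a = 'a] by linarith
  have x: "0 \<le> x" "x \<le> 1 / 2" using q by (auto simp: x_def divide_simps)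
  define t where "t = ([:0, 1:] :: 'a poly)"
  have t: "lead_coeff t = 1" "degree t = 1" by (simp_all add: t_def)
  have t2: "lead_coeff (t\<^sup>2) = 1" "degree (t\<^sup>2) = 2"
    using monic_power[OF t(1), of 2] t by (simp_all add: degree_power_eq monic_nonzero[OF t(1)])
  have card: "real (card (?S i)) \<le> (if i \<ge> 2 then (1 - x\<^sup>2) * ?q ^ i else ?q ^ i)" for i
  proof (cases "i \<ge> 2")
    case True
    have "?S i \<subseteq> monics i - {f \<in> monics i. t\<^sup>2 dvd f}"
      using t by (auto simp: squarefree_def is_unit_iff_degree monic_nonzero)
    then have "card (?S i) \<le> card (monics i - {f \<in> monics i. t\<^sup>2 dvd f})"
      by (intro card_mono) auto
    also have "\<dots> = CARD('a) ^ i - CARD('a) ^ (i - 2)"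
      using card_monics_multiples[OF t2(1), of i] t2(2) True by (subst card_Diff_subset) (auto simp: card_monics)
    finally have "real (card (?S i)) \<le> real (CARD('a) ^ i - CARD('a) ^ (i - 2))" by linarith
    also have "\<dots> = ?q ^ i - ?q ^ (i - 2)"
      using q by (subst of_nat_diff) (auto intro!: power_increasing)
    also have "?q ^ (i - 2) = x\<^sup>2 * ?q ^ i"
      using q True power_diff[of ?q 2 i] by (simp add: x_def power_divide del: of_nat_power)
    finally show ?thesis using True by (simp add: algebra_simps)
  next
    case False
    have "card (?S i) \<le> card (monics i :: 'a poly set)" by (intro card_mono) auto
    then show ?thesis using False
      by (simp add: card_monics)
  qed
  have eq: "{u :: 'a poly. lead_coeff u = 1 \<and> squarefree u \<and> degree u \<in> {1..<m}} = (\<Union>i\<in>{1..<m}. ?S i)"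
    by (auto simp: monics_def)
  have "(\<Sum>u | lead_coeff (u :: 'a poly) = 1 \<and> squarefree u \<and> degree u \<in> {1..<m}. 1 / ?q ^ (2 * degree u))
      = (\<Sum>i\<in>{1..<m}. \<Sum>u\<in>?S i. 1 / ?q ^ (2 * degree u))"
    unfolding eq by (intro sum.UNION_disjoint ballI) (auto simp: monics_def intro: finite_subset[OF _ finite_monics])
  also have "\<dots> = (\<Sum>i\<in>{1..<m}. real (card (?S i)) / ?q ^ (2 * i))"
    by (intro sum.cong refl) (simp add: monics_def)
  also have "\<dots> \<le> (\<Sum>i\<in>{1..<m}. if i \<ge> 2 then (1 - x\<^sup>2) * x ^ i else x)"
  proof (intro sum_mono)
    fix i assume i: "i \<in> {1..<m}"
    have "real (card (?S i)) / ?q ^ (2 * i)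
        \<le> (if i \<ge> 2 then (1 - x\<^sup>2) * ?q ^ i else ?q ^ i) / ?q ^ (2 * i)"
      using q card by (intro divide_right_mono) auto
    also have "\<dots> = (if i \<ge> 2 then (1 - x\<^sup>2) * x ^ i else x ^ i)"
      using q by (simp add: x_def power_divide mult_2 power_add)
    also have "\<dots> = (if i \<ge> 2 then (1 - x\<^sup>2) * x ^ i else x)"
      using i by (auto simp: not_le less_Suc_eq numeral_2_eq_2)
    finally show "real (card (?S i)) / ?q ^ (2 * i) \<le> (if i \<ge> 2 then (1 - x\<^sup>2) * x ^ i else x)" .
  qed
  also have "\<dots> \<le> (\<Sum>i\<in>insert 1 {2..<m}. if i \<ge> 2 then (1 - x\<^sup>2) * x ^ i else x)"
    using x by (intro sum_mono2) (auto intro!: mult_nonneg_nonneg simp: power_le_one abs_square_le_1)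
  also have "\<dots> = x + (1 - x\<^sup>2) * (\<Sum>i\<in>{2..<m}. x ^ i)"
    by (simp add: sum_distrib_left)
  also have "\<dots> \<le> x + (1 - x\<^sup>2) * (2 * x\<^sup>2)"
    using x by (intro add_left_mono mult_left_mono geometric_sum_le) (auto simp: abs_square_le_1)
  also have "\<dots> \<le> 7 / 8"
  proof -
    have p: "x ^ 2 \<le> 1 / 2 * (1 / 2)" "x ^ 3 \<le> 1 / 2 * (1 / 2)"
      using x power_mono[of x "1 / 2" 2] power_mono[of x "1 / 2" 3] by (auto simp: power_divide)
    have "0 \<le> (1 / 2 - x) * (7 / 4 + 3 / 2 * x - x ^ 2 - 2 * x ^ 3)"
      using x p by (intro mult_nonneg_nonneg) linarith+
    also have "\<dots> = 7 / 8 - (x + (1 - x\<^sup>2) * (2 * x\<^sup>2))"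
      by (simp add: field_simps power2_eq_square power3_eq_cube)
    finally show ?thesis by simp
  qed
  finally show ?thesis .
qed

context r_free_sums
begin

section \<open>Arcs with squarefree denominator\<close>

lemma card_squarefree_monics_ge:
  "real (card {b \<in> monics j. squarefree (b :: 'a poly)}) \<ge> q ^ j / 8"
proof -
  define P where "P = {\<pi> :: 'a poly. lead_coeff \<pi> = 1 \<and> irreducible \<pi> \<and> degree \<pi> \<in> {1..<Suc j}}"
  have finP: "finite P"
    by (rule finite_subset[OF _ finite_monic_degree_in[of "{1..<Suc j}"]]) (auto simp: P_def)
  have sub: "monics j - {b \<in> monics j. squarefree (b :: 'a poly)} \<subseteq> (\<Union>\<pi>\<in>P. {b \<in> monics j. \<pi>\<^sup>2 dvd b})"
  proof
    fix b :: "'a poly" assume b: "b \<in> monics j - {b \<in> monics j. squarefree b}"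
    have nz: "b \<noteq> 0" using b by (auto simp: monics_def)
    obtain y where y: "y\<^sup>2 dvd b" "\<not> is_unit y" using b by (auto simp: squarefree_def)
    have "y \<noteq> 0" using y nz by auto
    then obtain \<pi> where \<pi>: "irreducible \<pi>" "lead_coeff \<pi> = 1" "\<pi> dvd y"
      using exists_monic_irreducible_factor y(2) by metis
    have dvd: "\<pi>\<^sup>2 dvd b" using \<pi>(3) y(1) by (meson dvd_trans dvd_power_same)
    then have "\<pi> dvd b" by (simp add: power2_eq_square dvd_mult_left)
    then have "degree \<pi> \<le> j" using nz b dvd_imp_degree_le by (auto simp: monics_def)
    then show "b \<in> (\<Union>\<pi>\<in>P. {b \<in> monics j. \<pi>\<^sup>2 dvd b})"
      using \<pi> dvd b irreducible_degree_pos[OF \<pi>(1)] by (auto simp: P_def)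
  qed
  have "real (card (monics j - {b \<in> monics j. squarefree (b :: 'a poly)}))
      \<le> real (card (\<Union>\<pi>\<in>P. {b \<in> monics j. \<pi>\<^sup>2 dvd b}))"
    using sub finP by (intro of_nat_mono card_mono) auto
  also have "\<dots> \<le> (\<Sum>\<pi>\<in>P. real (card {b \<in> monics j. \<pi>\<^sup>2 dvd b}))"
    by (simp only: of_nat_sum[symmetric] of_nat_le_iff card_UN_le[OF finP])
  also have "\<dots> \<le> (\<Sum>\<pi>\<in>P. q ^ j / q ^ (2 * degree \<pi>))"
    unfolding q_eq by (intro sum_mono card_monics_power_multiples_le) (auto simp: P_def)
  also have "\<dots> \<le> (\<Sum>\<pi> | lead_coeff (\<pi> :: 'a poly) = 1 \<and> squarefree \<pi> \<and> degree \<pi> \<in> {1..<Suc j}.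
      q ^ j / q ^ (2 * degree \<pi>))"
    using q_pos
    by (intro sum_mono2 finite_subset[OF _ finite_monic_degree_in[of "{1..<Suc j}"]])
       (auto simp: P_def squarefree_irreducible)
  also have "\<dots> = q ^ j * (\<Sum>\<pi> | lead_coeff (\<pi> :: 'a poly) = 1 \<and> squarefree \<pi> \<and> degree \<pi> \<in> {1..<Suc j}.
      1 / q ^ (2 * degree \<pi>))"
    by (simp add: sum_distrib_left)
  also have "\<dots> \<le> q ^ j * (7 / 8)"
    unfolding q_eq by (intro mult_left_mono sum_squarefree_inverse_square_le) auto
  finally have "real (card (monics j - {b \<in> monics j. squarefree (b :: 'a poly)})) \<le> q ^ j * (7 / 8)" .
  moreover have "card (monics j - {b \<in> monics j. squarefree (b :: 'a poly)})
      = card (monics j :: 'a poly set) - card {b \<in> monics j. squarefree (b :: 'a poly)}"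
    by (intro card_Diff_subset) (auto intro: finite_subset[OF _ finite_monics])
  ultimately show ?thesis using real_card_monics[of j] by linarith
qed

text \<open>
  The arcs around fractions with denominator \<open>b ^ r\<close> that cannot be written with denominator
  \<open>b' ^ r\<close> for a proper divisor \<open>b'\<close> of \<open>b\<close>.
\<close>

definition primitive_arcs :: "nat \<Rightarrow> nat \<Rightarrow> 'a poly \<Rightarrow> 'a poly set" where
  "primitive_arcs K n b = arcs K n b -
    (\<Union>\<pi>\<in>{\<pi>. irreducible \<pi> \<and> lead_coeff \<pi> = 1 \<and> \<pi> dvd b}. arcs K n (b div \<pi>))"

lemma inverse_power_r_le: "1 / q ^ (r * i) \<le> 1 / q ^ (2 * i)"
  using q_pos q_ge_1 r_ge_2 by (intro divide_left_mono power_increasing mult_right_mono) auto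

lemma card_primitive_arcs_ge:
  assumes b: "b \<in> rdivs n" and n: "n \<le> K"
  shows "real (card (primitive_arcs K n b)) \<ge> q ^ K / q ^ (n - r * degree b) / 8"
proof -
  define P where "P = {\<pi>. irreducible \<pi> \<and> lead_coeff \<pi> = 1 \<and> \<pi> dvd b}"
  define A where "A = q ^ K / q ^ (n - r * degree b)"
  have A: "A > 0" using q_pos by (simp add: A_def)
  have b1: "lead_coeff b = 1" "b \<noteq> 0" "r * degree b \<le> n" using b by (auto simp: rdivs_def)
  have finP: "finite P" by (rule finite_subset[OF _ finite_monic_divisors[OF b1(2)]]) (auto simp: P_def)
  have Pdeg: "degree \<pi> \<in> {1..<Suc (degree b)}" if "\<pi> \<in> P" for \<pi>
    using that irreducible_degree_pos dvd_imp_degree_le[of \<pi> b] b1 by (auto simp: P_def)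
  have cardA: "real (card (arcs K n b)) = A"
    using card_arcs[OF b n] q_pos by (simp add: A_def field_simps)
  have card1: "real (card (arcs K n (b div \<pi>))) = A * (1 / q ^ (r * degree \<pi>))" if \<pi>: "\<pi> \<in> P" for \<pi>
  proof -
    have bp: "b = \<pi> * (b div \<pi>)" and \<pi>1: "lead_coeff \<pi> = 1" using \<pi> by (auto simp: P_def)
    have l: "lead_coeff (b div \<pi>) = 1" using monic_cofactor[OF bp b1(1) \<pi>1] .
    have d: "degree b = degree \<pi> + degree (b div \<pi>)" using degree_monic_mult[OF \<pi>1 l] bp by simp
    have rd: "r * degree b = r * degree \<pi> + r * degree (b div \<pi>)" unfolding d by (simp add: distrib_left)
    have mem: "b div \<pi> \<in> rdivs n" using l b1(3) rd by (simp add: rdivs_def)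
    have "n - r * degree (b div \<pi>) = (n - r * degree b) + r * degree \<pi>" using rd b1(3) by simp
    then have "q ^ (n - r * degree (b div \<pi>)) = q ^ (n - r * degree b) * q ^ (r * degree \<pi>)"
      by (simp add: power_add)
    then show ?thesis using card_arcs[OF mem n] q_pos by (simp add: A_def field_simps)
  qed
  have "real (card (\<Union>\<pi>\<in>P. arcs K n (b div \<pi>))) \<le> (\<Sum>\<pi>\<in>P. real (card (arcs K n (b div \<pi>))))"
    by (simp only: of_nat_sum[symmetric] of_nat_le_iff card_UN_le[OF finP])
  also have "\<dots> = (\<Sum>\<pi>\<in>P. A * (1 / q ^ (r * degree \<pi>)))" by (intro sum.cong refl card1)
  also have "\<dots> \<le> (\<Sum>\<pi>\<in>P. A * (1 / q ^ (2 * degree \<pi>)))"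
    using A inverse_power_r_le by (intro sum_mono mult_left_mono) auto
  also have "\<dots> \<le> (\<Sum>\<pi> | lead_coeff (\<pi> :: 'a poly) = 1 \<and> squarefree \<pi> \<and> degree \<pi> \<in> {1..<Suc (degree b)}.
      A * (1 / q ^ (2 * degree \<pi>)))"
  proof (intro sum_mono2 subsetI)
    show "finite {\<pi> :: 'a poly. lead_coeff \<pi> = 1 \<and> squarefree \<pi> \<and> degree \<pi> \<in> {1..<Suc (degree b)}}"
      by (rule finite_subset[OF _ finite_monic_degree_in[of "{1..<Suc (degree b)}"]]) auto
    show "\<pi> \<in> {\<pi> :: 'a poly. lead_coeff \<pi> = 1 \<and> squarefree \<pi> \<and> degree \<pi> \<in> {1..<Suc (degree b)}}"
      if "\<pi> \<in> P" for \<pi>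
      using Pdeg[OF that] that squarefree_irreducible by (auto simp: P_def)
  qed (use A q_pos in auto)
  also have "\<dots> = A * (\<Sum>\<pi> | lead_coeff (\<pi> :: 'a poly) = 1 \<and> squarefree \<pi> \<and> degree \<pi> \<in> {1..<Suc (degree b)}.
      1 / q ^ (2 * degree \<pi>))"
    by (simp only: sum_distrib_left)
  also have "\<dots> \<le> A * (7 / 8)"
    unfolding q_eq using A by (intro mult_left_mono sum_squarefree_inverse_square_le) auto
  finally have "real (card (\<Union>\<pi>\<in>P. arcs K n (b div \<pi>))) \<le> A * (7 / 8)" .
  moreover have "card (arcs K n b) - card (\<Union>\<pi>\<in>P. arcs K n (b div \<pi>)) \<le> card (primitive_arcs K n b)"
    unfolding primitive_arcs_def P_def[symmetric] using finP by (intro diff_card_le_card_Diff) auto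
  ultimately have "A - A * (7 / 8) \<le> real (card (primitive_arcs K n b))"
    using cardA by linarith
  then show ?thesis by (simp add: A_def)
qed

text \<open>
  The arcs for \<open>b\<close> and for \<open>d\<close> are independent unless \<open>b ^ r\<close> and \<open>d ^ r\<close> have a common multiple of
  degree less than \<open>n\<close> other than \<open>0\<close>.  If they have one, Bezout's identity for \<open>\<pi> ^ r\<close> and \<open>d ^ r\<close>, where \<open>\<pi>\<close> divides
  \<open>b\<close> but not \<open>d\<close>, shows that the points common to both sets of arcs are not primitive for \<open>b\<close>.
\<close>

lemma card_primitive_arcs_Int_le:
  assumes b: "b \<in> rdivs n" "squarefree b" and d: "d \<in> rdivs n" and nd: "\<not> b dvd d" and n: "n \<le> K"
  shows "real (card (primitive_arcs K n b \<inter> arcs K n d)) * q ^ (n - r * degree d)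
    \<le> q ^ K / q ^ (n - r * degree b)"
proof -
  let ?m = "n - r * degree b" and ?m' = "n - r * degree d"
  have b1: "lead_coeff b = 1" "r * degree b \<le> n" using b by (auto simp: rdivs_def)
  have d1: "lead_coeff d = 1" "r * degree d \<le> n" using d by (auto simp: rdivs_def)
  have nzb: "b ^ r \<noteq> 0" and nzd: "d ^ r \<noteq> 0" using b1 d1 by (auto simp: monic_nonzero)
  show ?thesis
  proof (cases "\<exists>g1\<in>polys_lt ?m. \<exists>g2. g1 \<noteq> 0 \<and> b ^ r * g1 = d ^ r * g2")
    case True
    then obtain g1 g2 where g: "g1 \<in> polys_lt ?m" "g1 \<noteq> 0" "b ^ r * g1 = d ^ r * g2" by blast
    obtain \<pi> where \<pi>: "irreducible \<pi>" "lead_coeff \<pi> = 1" "\<pi> dvd b" "\<not> \<pi> dvd d"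
      using squarefree_dvdI[OF b1(1) b(2)] nd by blast
    obtain b' where b': "b = \<pi> * b'" using \<pi>(3) by (rule dvdE)
    have b'1: "lead_coeff b' = 1" using monic_cofactor[OF b' b1(1) \<pi>(2)] .
    have "r * degree b' \<le> r * degree b"
      using degree_monic_mult[OF \<pi>(2) b'1] b' by simp
    then have b'n: "r * degree b' \<le> n" using b1(2) by (rule le_trans)
    have "comaximal (\<pi> ^ r) (d ^ r)"
      using irreducible_comaximal[OF \<pi>(1,4)] by (rule comaximal_power)
    then obtain x y where xy: "x * \<pi> ^ r + y * d ^ r = 1" by (auto simp: comaximal_def)
    have "c \<in> arcs K n b'" if c: "c \<in> arcs K n b" "c \<in> arcs K n d" for c
      unfolding arcs_def
    proof (intro CollectI conjI ballI)
      show "c \<in> polys_lt K" using c by (simp add: arcs_def)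
      fix h :: "'a poly" assume h: "h \<in> polys_lt (n - r * degree b')"
      let ?u = "(x * h) mod g1" and ?v = "(x * h) div g1 * g2 + y * (b' ^ r * h)"
      have "b' ^ r * h = (x * \<pi> ^ r + y * d ^ r) * (b' ^ r * h)" by (simp add: xy)
      also have "\<dots> = b ^ r * (x * h) + d ^ r * (y * (b' ^ r * h))"
        by (simp add: b' power_mult_distrib algebra_simps)
      also have "x * h = (x * h) div g1 * g1 + ?u" by simp
      also have "b ^ r * \<dots> = (x * h) div g1 * (b ^ r * g1) + b ^ r * ?u"
        by (simp only: distrib_left mult_ac)
      finally have e0: "b' ^ r * h = (x * h) div g1 * (b ^ r * g1) + b ^ r * ?u + d ^ r * (y * (b' ^ r * h))" .
      have "b ^ r * ?u + d ^ r * ?v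
          = (x * h) div g1 * (b ^ r * g1) + b ^ r * ?u + d ^ r * (y * (b' ^ r * h))"
        unfolding g(3) by (simp add: algebra_simps)
      with e0 have eq: "b' ^ r * h = b ^ r * ?u + d ^ r * ?v" by (rule trans[OF _ sym])
      have u: "?u \<in> polys_lt ?m"
        using g(1,2) degree_mod_less[OF g(2), of "x * h"] by (auto simp: polys_lt_iff)
      have "b' ^ r * h \<in> polys_lt n"
        using b'n by (intro mult_in_polys_lt[OF h]) (simp add: degree_monic_power[OF b'1])
      moreover have "b ^ r * ?u \<in> polys_lt n"
        using b1 by (intro mult_in_polys_lt[OF u]) (simp add: degree_monic_power)
      ultimately have "b' ^ r * h - b ^ r * ?u \<in> polys_lt n" by (rule polys_lt_diff)
      moreover have "b' ^ r * h - b ^ r * ?u = d ^ r * ?v"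
        using arg_cong[OF eq, of "\<lambda>z. z - b ^ r * ?u"] by (simp only: add_diff_cancel_left')
      ultimately have "d ^ r * ?v \<in> polys_lt n" by (simp only:)
      then have v: "?v \<in> polys_lt ?m'"
        using polys_lt_mult_cancel[OF nzd] by (simp only: degree_monic_power[OF d1(1)])
      have "chi K c (b ^ r * ?u) = 1" "chi K c (d ^ r * ?v) = 1"
        using c u v by (auto simp: arcs_def)
      then show "chi K c (b' ^ r * h) = 1"
        by (subst eq) (simp only: chi_add_right mult_1)
    qed
    moreover have "b' = b div \<pi>" using b' \<pi>(2) monic_nonzero[of \<pi>] by simp
    ultimately have "primitive_arcs K n b \<inter> arcs K n d = {}"
      unfolding primitive_arcs_def using \<pi> by blast
    then show ?thesis using q_pos by simp
  next
    case False
    have mem: "b ^ r * g1 + d ^ r * g2 \<in> polys_lt K" if "g1 \<in> polys_lt ?m" "g2 \<in> polys_lt ?m'" for g1 g2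
      using b1 d1 n that
      by (intro polys_lt_add mult_in_polys_lt[of g1 ?m] mult_in_polys_lt[of g2 ?m'])
         (simp_all add: degree_monic_power)
    have zero: "b ^ r * g1 + d ^ r * g2 = 0 \<longleftrightarrow> g1 = 0 \<and> g2 = 0"
      if g: "g1 \<in> polys_lt ?m" "g2 \<in> polys_lt ?m'" for g1 g2
    proof
      assume "b ^ r * g1 + d ^ r * g2 = 0"
      then have eq: "b ^ r * g1 = d ^ r * (- g2)" by (simp add: eq_neg_iff_add_eq_0)
      then have "g1 = 0" using False g(1) by blast
      then show "g1 = 0 \<and> g2 = 0" using eq nzd by auto
    qed auto
    have "complex_of_real (real (card (arcs K n b \<inter> arcs K n d)) * (q ^ ?m * q ^ ?m'))
        = (\<Sum>c\<in>polys_lt K. if c \<in> arcs K n b \<inter> arcs K n d then of_real (q ^ ?m * q ^ ?m') else 0)"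
      by (subst sum.inter_restrict[symmetric])
         (auto simp: arcs_def Int_def intro!: arg_cong[of _ _ card])
    also have "\<dots> = (\<Sum>c\<in>polys_lt K. (\<Sum>g1\<in>polys_lt ?m. chi K c (b ^ r * g1)) * (\<Sum>g2\<in>polys_lt ?m'. chi K c (d ^ r * g2)))"
      by (intro sum.cong refl) (simp add: sum_chi_multiples)
    also have "\<dots> = (\<Sum>c\<in>polys_lt K. \<Sum>g1\<in>polys_lt ?m. \<Sum>g2\<in>polys_lt ?m'. chi K c (b ^ r * g1 + d ^ r * g2))"
      by (simp only: sum_product chi_add_right)
    also have "\<dots> = (\<Sum>g1\<in>polys_lt ?m. \<Sum>g2\<in>polys_lt ?m'. \<Sum>c\<in>polys_lt K. chi K c (b ^ r * g1 + d ^ r * g2))"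
      by (subst sum.swap) (intro sum.cong refl sum.swap)
    also have "\<dots> = (\<Sum>g1\<in>polys_lt ?m. \<Sum>g2\<in>polys_lt ?m'.
        if g2 = (0 :: 'a poly) then (if g1 = (0 :: 'a poly) then of_real (q ^ K) else 0) else 0)"
      by (intro sum.cong refl) (simp add: sum_chi[OF mem] zero)
    also have "\<dots> = complex_of_real (q ^ K)" by simp
    finally have "real (card (arcs K n b \<inter> arcs K n d)) * (q ^ ?m * q ^ ?m') = q ^ K"
      by (simp only: of_real_eq_iff)
    then have "real (card (arcs K n b \<inter> arcs K n d)) * q ^ ?m' = q ^ K / q ^ ?m"
      using q_pos by (simp add: field_simps)
    moreover have "real (card (primitive_arcs K n b \<inter> arcs K n d)) \<le> real (card (arcs K n b \<inter> arcs K n d))"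
      by (intro of_nat_mono card_mono) (auto simp: primitive_arcs_def)
    moreover have "q ^ ?m' \<ge> 0" using q_pos by simp
    ultimately show ?thesis by (metis mult_right_mono)
  qed
qed

section \<open>The lower bound for the measure of the level sets\<close>

text \<open>
  On the arcs for \<open>b\<close> all divisors \<open>d = b * g\<close> contribute with the same phase, and by
  \<open>sum_squarefree_inverse_square_le\<close> the term \<open>g = 1\<close> dominates.
\<close>

lemma mult_sum_on_arcs:
  assumes b: "b \<in> rdivs n" and d: "d \<in> rdivs n" and bd: "b dvd d" and c: "c \<in> arcs K n b"
  shows "mult_sum K n d c
    = of_real (q ^ (n - r * degree d)) * chi K c (b ^ r * monom 1 (n - r * degree b))"
proof -
  let ?m = "n - r * degree b" and ?m' = "n - r * degree d"
  have b1: "lead_coeff b = 1" "r * degree b \<le> n" using b by (auto simp: rdivs_def)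
  have d1: "lead_coeff d = 1" "r * degree d \<le> n" using d by (auto simp: rdivs_def)
  obtain g where g: "d = b * g" using bd by (rule dvdE)
  have g1: "lead_coeff g = 1" using monic_cofactor[OF g d1(1) b1(1)] .
  have "degree d = degree b + degree g" using degree_monic_mult[OF b1(1) g1] g by simp
  then have "r * degree d = r * degree b + r * degree g" by (simp add: distrib_left)
  then have m: "degree (g ^ r) + ?m' = ?m" using d1(2) by (simp add: degree_monic_power[OF g1])
  have dr: "d ^ r * h = b ^ r * (g ^ r * h)" for h by (simp add: g power_mult_distrib)
  have arcs: "chi K c (b ^ r * h) = 1" if "h \<in> polys_lt ?m" for h
    using c that by (simp add: arcs_def)
  have "c \<in> arcs K n d"
    unfolding arcs_def dr using c m by (auto intro!: arcs mult_in_polys_lt simp: arcs_def[of K n b])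
  moreover have "chi K c (d ^ r * monom 1 ?m') = chi K c (b ^ r * monom 1 ?m)"
  proof -
    have "g ^ r \<in> monics (degree (g ^ r))" using monic_power[OF g1, of r] by (simp add: monics_def)
    moreover have "monom (1 :: 'a) ?m' \<in> monics ?m'"
      unfolding monics_eq by (rule image_eqI[of _ _ 0]) simp_all
    ultimately have "g ^ r * monom 1 ?m' \<in> monics ?m" using monics_mult m by metis
    then obtain w where w: "g ^ r * monom 1 ?m' = monom 1 ?m + w" "w \<in> polys_lt ?m"
      unfolding monics_eq by auto
    show ?thesis unfolding dr w(1) distrib_left chi_add_right using arcs[OF w(2)] by simp
  qed
  moreover have "c \<in> polys_lt K" using c by (simp add: arcs_def)
  ultimately show ?thesis using mult_sum_eq[OF d] by simp
qed

lemma cmod_main_part_ge: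
  assumes b: "b \<in> rdivs n" "squarefree b" "degree b < J" and c: "c \<in> arcs K n b"
  shows "cmod (partial_sum (\<lambda>d. degree d < J \<and> b dvd d) K n c) \<ge> q ^ (n - r * degree b) / 8"
proof -
  let ?m = "n - r * degree b"
  define E where "E = {d. d \<in> rdivs n \<and> degree d < J \<and> b dvd d}"
  define G where "G = {g :: 'a poly. lead_coeff g = 1 \<and> squarefree g \<and> degree g \<in> {1..<Suc n}}"
  let ?w = "\<lambda>d. poly_moebius d * q ^ (n - r * degree d)"
  have b1: "lead_coeff b = 1" using b by (auto simp: rdivs_def)
  have finE: "finite E" by (simp add: E_def)
  have finG: "finite G"
    unfolding G_def by (rule finite_subset[OF _ finite_monic_degree_in[of "{1..<Suc n}"]]) auto
  have bE: "b \<in> E" using b by (simp add: E_def)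
  have "partial_sum (\<lambda>d. degree d < J \<and> b dvd d) K n c
      = (\<Sum>d\<in>E. of_real (?w d) * chi K c (b ^ r * monom 1 ?m))"
    unfolding partial_sum_def E_def
    by (intro sum.cong refl) (simp add: mult_sum_on_arcs[OF b(1) _ _ c] mult.assoc)
  also have "\<dots> = of_real (\<Sum>d\<in>E. ?w d) * chi K c (b ^ r * monom 1 ?m)"
    by (simp add: sum_distrib_right)
  finally have cm: "cmod (partial_sum (\<lambda>d. degree d < J \<and> b dvd d) K n c) = \<bar>\<Sum>d\<in>E. ?w d\<bar>"
    by (simp only: norm_mult norm_of_real cmod_chi mult_1_right)
  have "\<bar>\<Sum>d\<in>E - {b}. ?w d\<bar> \<le> (\<Sum>d\<in>E - {b}. \<bar>?w d\<bar>)" by (rule sum_abs)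
  also have "\<dots> = (\<Sum>d\<in>{d \<in> E - {b}. squarefree d}. \<bar>?w d\<bar>)"
  proof (intro sum.mono_neutral_right ballI)
    fix d assume "d \<in> E - {b} - {d \<in> E - {b}. squarefree d}"
    then have "poly_moebius d = 0" by (intro poly_moebius_not_squarefree) blast
    then show "\<bar>?w d\<bar> = 0" by simp
  qed (use finE in auto)
  also have "\<dots> \<le> (\<Sum>g\<in>G. q ^ ?m * (1 / q ^ (2 * degree g)))"
  proof (rule sum_le_included[where i = "\<lambda>g. b * g"])
    show "\<forall>d\<in>{d \<in> E - {b}. squarefree d}. \<exists>g\<in>G. b * g = d \<and> \<bar>?w d\<bar> \<le> q ^ ?m * (1 / q ^ (2 * degree g))"
    proof
      fix d assume d: "d \<in> {d \<in> E - {b}. squarefree d}"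
      have d1: "lead_coeff d = 1" "r * degree d \<le> n" "b dvd d" using d by (auto simp: E_def rdivs_def)
      obtain g where g: "d = b * g" using d1(3) by (rule dvdE)
      have g1: "lead_coeff g = 1" using monic_cofactor[OF g d1(1) b1] .
      have deg: "degree d = degree b + degree g" using degree_monic_mult[OF b1 g1] g by simp
      have "degree g \<noteq> 0"
      proof
        assume "degree g = 0"
        then have "g \<in> monics 0" using g1 by (simp add: monics_def)
        then show False using d g by simp
      qed
      moreover have "degree d \<le> n" using d rdivs_bound by (auto simp: E_def)
      moreover have "squarefree g" using d squarefree_dvd[of d g] g by simp
      ultimately have "g \<in> G" using g1 deg by (simp add: G_def)
      moreover have "\<bar>?w d\<bar> \<le> q ^ ?m * (1 / q ^ (2 * degree g))"
      proof -
        have "r * degree d = r * degree b + r * degree g" unfolding deg by (simp add: distrib_left)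
        then have "?m = (n - r * degree d) + r * degree g" using d1(2) by simp
        then have "q ^ ?m = q ^ (n - r * degree d) * q ^ (r * degree g)" by (simp add: power_add)
        then have "q ^ (n - r * degree d) = q ^ ?m * (1 / q ^ (r * degree g))" using q_pos by simp
        also have "\<dots> \<le> q ^ ?m * (1 / q ^ (2 * degree g))"
          using q_pos inverse_power_r_le by (intro mult_left_mono) auto
        finally have "q ^ (n - r * degree d) \<le> q ^ ?m * (1 / q ^ (2 * degree g))" .
        moreover have "\<bar>?w d\<bar> \<le> 1 * q ^ (n - r * degree d)"
          using q_pos abs_poly_moebius_le[of d] unfolding abs_mult
          by (intro mult_mono) auto
        ultimately show ?thesis by linarith
      qed
      ultimately show "\<exists>g\<in>G. b * g = d \<and> \<bar>?w d\<bar> \<le> q ^ ?m * (1 / q ^ (2 * degree g))"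
        using g by blast
    qed
  qed (use finE finG q_pos in auto)
  also have "\<dots> = q ^ ?m * (\<Sum>g\<in>G. 1 / q ^ (2 * degree g))" by (simp only: sum_distrib_left)
  also have "\<dots> \<le> q ^ ?m * (7 / 8)"
    unfolding G_def q_eq by (intro mult_left_mono sum_squarefree_inverse_square_le) auto
  finally have rest: "\<bar>\<Sum>d\<in>E - {b}. ?w d\<bar> \<le> q ^ ?m * (7 / 8)" .
  have "(\<Sum>d\<in>E. ?w d) = ?w b + (\<Sum>d\<in>E - {b}. ?w d)" using finE bE by (rule sum.remove)
  moreover have "\<bar>?w b\<bar> = q ^ ?m"
    using abs_poly_moebius_squarefree[OF b(2)] q_pos by (simp add: abs_mult)
  ultimately have "\<bar>\<Sum>d\<in>E. ?w d\<bar> \<ge> q ^ ?m - q ^ ?m * (7 / 8)" using rest by linarith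
  then show ?thesis unfolding cm by simp
qed

text \<open>
  An upper bound for the contribution of the divisors of degree less than \<open>J\<close> that are not multiples
  of \<open>b\<close>.
\<close>

definition minor_part :: "nat \<Rightarrow> nat \<Rightarrow> nat \<Rightarrow> 'a poly \<Rightarrow> 'a poly \<Rightarrow> real" where
  "minor_part J K n b c = (\<Sum>d | d \<in> rdivs n \<and> degree d < J \<and> \<not> b dvd d.
     if c \<in> arcs K n d then q ^ (n - r * degree d) else 0)"

lemma cmod_partial_sum_le_minor_part:
  assumes "c \<in> polys_lt K"
  shows "cmod (partial_sum (\<lambda>d. degree d < J \<and> \<not> b dvd d) K n c) \<le> minor_part J K n b c"
  unfolding partial_sum_def minor_part_def
proof (intro sum_norm_le)
  fix d assume d: "d \<in> {d. d \<in> rdivs n \<and> degree d < J \<and> \<not> b dvd d}"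
  have "cmod (of_real (poly_moebius d) * mult_sum K n d c) \<le> 1 * cmod (mult_sum K n d c)"
    using abs_poly_moebius_le[of d] unfolding norm_mult by (intro mult_right_mono) auto
  also have "\<dots> = (if c \<in> arcs K n d then q ^ (n - r * degree d) else 0)"
    using d assms q_pos by (simp add: mult_sum_eq norm_mult norm_power)
  finally show "cmod (of_real (poly_moebius d) * mult_sum K n d c)
      \<le> (if c \<in> arcs K n d then q ^ (n - r * degree d) else 0)" .
qed

lemma minor_part_nonneg: "minor_part J K n b c \<ge> 0"
  using q_pos unfolding minor_part_def by (intro sum_nonneg) auto

lemma finite_primitive_arcs [simp]: "finite (primitive_arcs K n b)"
  by (simp add: primitive_arcs_def)

lemma sum_minor_part_le:
  assumes b: "b \<in> rdivs n" "squarefree b" and n: "n \<le> K"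
  shows "(\<Sum>c\<in>primitive_arcs K n b. minor_part J K n b c) \<le> q ^ J * (q ^ K / q ^ (n - r * degree b))"
proof -
  let ?D = "{d. d \<in> rdivs n \<and> degree d < J \<and> \<not> b dvd d}"
  have "(\<Sum>c\<in>primitive_arcs K n b. minor_part J K n b c)
      = (\<Sum>d\<in>?D. \<Sum>c\<in>primitive_arcs K n b. if c \<in> arcs K n d then q ^ (n - r * degree d) else 0)"
    unfolding minor_part_def by (rule sum.swap)
  also have "\<dots> = (\<Sum>d\<in>?D. real (card (primitive_arcs K n b \<inter> arcs K n d)) * q ^ (n - r * degree d))"
    by (intro sum.cong refl) (subst sum.inter_restrict[symmetric], simp_all)
  also have "\<dots> \<le> (\<Sum>d\<in>?D. q ^ K / q ^ (n - r * degree b))"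
    using b n by (intro sum_mono card_primitive_arcs_Int_le) auto
  also have "\<dots> = real (card ?D) * (q ^ K / q ^ (n - r * degree b))" by simp
  also have "\<dots> \<le> q ^ J * (q ^ K / q ^ (n - r * degree b))"
  proof (intro mult_right_mono)
    have "card ?D \<le> card {d :: 'a poly. lead_coeff d = 1 \<and> degree d < J}"
      by (intro card_mono finite_subset[OF _ finite_monic_degree_le[of J]]) (auto simp: rdivs_def)
    then show "real (card ?D) \<le> q ^ J" using card_monic_degree_less_le[of J] by linarith
  qed (use q_pos in simp)
  finally show ?thesis .
qed

text \<open>
  Pairs \<open>(b, c)\<close> with \<open>c\<close> on a primitive arc for \<open>b\<close> and with small minor part have distinct \<open>c\<close>: a
  second \<open>b'\<close> of the same degree with \<open>c\<close> on its arcs contributes to the minor part.  For most of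
  these \<open>c\<close> the divisors of degree at least \<open>J\<close> contribute little.  The constant \<open>21\<close> makes both
  exceptional sets small for all \<open>q\<close> and \<open>r\<close>.
\<close>

lemma card_large_expsum_ge:
  assumes j: "j + 21 \<le> n div (r + 1)" and n: "n < K"
  shows "real (card {c \<in> polys_lt K. q ^ (n - r * j) / 16 \<le> cmod (expsum K n c)})
    \<ge> q ^ K * q ^ j / q ^ (n - r * j) / 128"
proof -
  define m where "m = n - r * j"
  \<comment> \<open>\<open>degree d < J\<close> means \<open>degree d \<le> n / (r + 1)\<close>, the degree at which the two error bounds balance\<close>
  define J where "J = n div (r + 1) + 1"
  define A where "A = q ^ K * q ^ j / q ^ m"
  have A: "A > 0" using q_pos by (simp add: A_def)
  have J0: "(J - 1) * r + (J - 1) \<le> n"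
    using div_times_less_eq_dividend[of n "r + 1"] by (simp add: J_def algebra_simps)
  have jJ: "j + 22 \<le> J" using j by (simp add: J_def)
  have "(j + 21) * r \<le> (J - 1) * r" using jJ by (intro mult_right_mono) auto
  then have rj: "r * j + 21 * r + J \<le> n + 1" using J0 jJ by (simp add: algebra_simps)
  have rjn: "r * j \<le> n" using rj jJ by simp
  have mJ: "J + 13 \<le> m" using rj r_ge_2 by (simp add: m_def)
  define B where "B = {b \<in> monics j. squarefree (b :: 'a poly)}"
  have B: "b \<in> rdivs n" "squarefree b" "degree b = j" "lead_coeff b = 1" if "b \<in> B" for b
    using that rjn by (auto simp: B_def monics_def rdivs_def)
  have finB: "finite B" unfolding B_def by (rule finite_subset[OF _ finite_monics[of j]]) auto
  have cardB: "q ^ j / 8 \<le> real (card B)" "real (card B) \<le> q ^ j"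
  proof -
    show "q ^ j / 8 \<le> real (card B)" unfolding B_def by (rule card_squarefree_monics_ge)
    have "card B \<le> card (monics j :: 'a poly set)" unfolding B_def by (intro card_mono) auto
    then show "real (card B) \<le> q ^ j" using real_card_monics[of j] by linarith
  qed
  define P where "P = (SIGMA b:B. primitive_arcs K n b)"
  define G where "G = {p \<in> P. minor_part J K n (fst p) (snd p) < q ^ m / 32}"
  define Bad where "Bad = {p \<in> P. q ^ m / 32 \<le> minor_part J K n (fst p) (snd p)}"
  define High where "High = {c \<in> polys_lt K. (q ^ m / 32)\<^sup>2 \<le> (cmod (partial_sum (\<lambda>d. J \<le> degree d) K n c))\<^sup>2}"
  have finP: "finite P" unfolding P_def using finB by simp
  have cardP: "A / 64 \<le> real (card P)"
  proof -
    have "A / 64 = q ^ j / 8 * (q ^ K / q ^ m / 8)" by (simp add: A_def mult_ac)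
    also have "\<dots> \<le> real (card B) * (q ^ K / q ^ m / 8)"
      using cardB q_pos by (intro mult_right_mono) auto
    also have "\<dots> = (\<Sum>b\<in>B. q ^ K / q ^ m / 8)" by simp
    also have "\<dots> \<le> (\<Sum>b\<in>B. real (card (primitive_arcs K n b)))"
    proof (intro sum_mono)
      fix b assume b: "b \<in> B"
      show "q ^ K / q ^ m / 8 \<le> real (card (primitive_arcs K n b))"
        using card_primitive_arcs_ge[OF B(1)[OF b], of K] n B(3)[OF b] by (simp add: m_def)
    qed
    also have "\<dots> = real (card P)" unfolding P_def using finB by (subst card_SigmaI) auto
    finally show ?thesis .
  qed
  have cardBad: "real (card Bad) \<le> A / 256"
  proof -
    have "(\<Sum>p\<in>P. minor_part J K n (fst p) (snd p)) = (\<Sum>b\<in>B. \<Sum>c\<in>primitive_arcs K n b. minor_part J K n b c)"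
      unfolding P_def using finB by (subst sum.Sigma) (auto simp: case_prod_unfold)
    also have "\<dots> \<le> (\<Sum>b\<in>B. q ^ J * (q ^ K / q ^ m))"
    proof (intro sum_mono)
      fix b assume b: "b \<in> B"
      show "(\<Sum>c\<in>primitive_arcs K n b. minor_part J K n b c) \<le> q ^ J * (q ^ K / q ^ m)"
        using sum_minor_part_le[OF B(1,2)[OF b], of K J] n B(3)[OF b] by (simp add: m_def)
    qed
    also have "\<dots> = real (card B) * (q ^ J * (q ^ K / q ^ m))" by simp
    also have "\<dots> \<le> q ^ j * (q ^ J * (q ^ K / q ^ m))"
      using cardB q_pos by (intro mult_right_mono) auto
    finally have "(\<Sum>p\<in>P. minor_part J K n (fst p) (snd p)) \<le> A * q ^ J" by (simp add: A_def mult_ac)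
    then have "real (card Bad) \<le> A * q ^ J / (q ^ m / 32)"
      unfolding Bad_def using finP minor_part_nonneg q_pos by (intro card_ge_le) auto
    also have "\<dots> \<le> A / 256"
    proof -
      \<comment> \<open>\<open>8192 = 32 * 256\<close> is the 13th power of \<open>2\<close>\<close>
      have "8192 * q ^ J \<le> q ^ 13 * q ^ J"
        using power_mono[of 2 q 13] q_ge_2 by (intro mult_right_mono) auto
      also have "\<dots> = q ^ (J + 13)" by (simp add: power_add)
      also have "\<dots> \<le> q ^ m" using mJ q_ge_1 by (intro power_increasing)
      finally have "A * (8192 * q ^ J) \<le> A * q ^ m" using A by (intro mult_left_mono) auto
      then show ?thesis using q_pos by (simp add: field_simps)
    qed
    finally show ?thesis .
  qed
  have cardHigh: "real (card High) \<le> A / 256"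
  proof -
    have "real (card High) \<le> q ^ K * (12 * q ^ n / q ^ ((r - 1) * J)) / (q ^ m / 32)\<^sup>2"
      unfolding High_def using q_pos sum_square_partial_sum_le[OF n] by (intro card_ge_le) auto
    also have "\<dots> \<le> A / 256"
    proof -
      have e: "n + 22 \<le> (r - 1) * J + m + j"
      proof -
        have "(r - 1) * (j + 22) \<le> (r - 1) * J" using jJ by (intro mult_left_mono) auto
        moreover have "(r - 1) * (j + 22) + j = r * j + 22 * (r - 1)"
          using r_ge_2 by (cases r) (auto simp: algebra_simps)
        moreover have "22 * (r - 1) \<ge> 22" using r_ge_2 by simp
        ultimately have "r * j + 22 \<le> (r - 1) * J + j" by linarith
        then show ?thesis using rjn by (simp add: m_def)
      qed
      \<comment> \<open>\<open>3145728 = 12 * 32 * 32 * 256\<close> is at most the 22nd power of \<open>2\<close>\<close>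
      have "3145728 * q ^ n \<le> q ^ 22 * q ^ n"
        using power_mono[of 2 q 22] q_ge_2 by (intro mult_right_mono) auto
      also have "\<dots> = q ^ (n + 22)" by (simp add: power_add)
      also have "\<dots> \<le> q ^ ((r - 1) * J + m + j)" using e q_ge_1 by (intro power_increasing)
      also have "\<dots> = q ^ ((r - 1) * J) * q ^ m * q ^ j" by (simp add: power_add)
      finally have "3145728 * q ^ n \<le> q ^ ((r - 1) * J) * q ^ m * q ^ j" .
      then have "3145728 * q ^ n / (q ^ ((r - 1) * J) * q ^ m) \<le> q ^ j"
        using q_pos by (simp add: field_simps)
      then have "q ^ K / q ^ m / 256 * (3145728 * q ^ n / (q ^ ((r - 1) * J) * q ^ m))
          \<le> q ^ K / q ^ m / 256 * q ^ j"
        using q_pos by (intro mult_left_mono) auto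
      then show ?thesis by (simp add: A_def power2_eq_square mult_ac)
    qed
    finally show ?thesis .
  qed
  have inj: "inj_on snd G"
  proof (rule inj_onI)
    fix p p' assume p: "p \<in> G" "p' \<in> G" "snd p = snd p'"
    obtain b b' c where bc: "p = (b, c)" "p' = (b', c)" using p(3) by (cases p; cases p') auto
    have b: "b \<in> B" "b' \<in> B" "c \<in> arcs K n b'" "minor_part J K n b c < q ^ m / 32"
      using p bc by (auto simp: G_def P_def primitive_arcs_def)
    have "b = b'"
    proof (rule ccontr)
      assume ne: "b \<noteq> b'"
      have "\<not> b dvd b'"
      proof
        assume "b dvd b'"
        then obtain g where g: "b' = b * g" by (rule dvdE)
        have g1: "lead_coeff g = 1" using monic_cofactor[OF g B(4)[OF b(2)] B(4)[OF b(1)]] .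
        have "degree g = 0" using degree_monic_mult[OF B(4)[OF b(1)] g1] g B(3)[OF b(1)] B(3)[OF b(2)] by simp
        then have "g \<in> monics 0" using g1 by (simp add: monics_def)
        then show False using ne g by simp
      qed
      then have b'D: "b' \<in> {d. d \<in> rdivs n \<and> degree d < J \<and> \<not> b dvd d}"
        using B[OF b(2)] jJ by simp
      have "(if c \<in> arcs K n b' then q ^ (n - r * degree b') else 0) \<le> minor_part J K n b c"
        unfolding minor_part_def by (rule member_le_sum[OF b'D]) (use q_pos in auto)
      then have "q ^ m \<le> minor_part J K n b c" using b(3) B(3)[OF b(2)] by (simp add: m_def)
      moreover have "q ^ m > 0" using q_pos by simp
      ultimately show False using b(4) by linarith
    qed
    then show "p = p'" using bc by simp
  qed
  have cardG: "real (card (snd ` G)) \<ge> A / 64 - A / 256"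
  proof -
    have "P = G \<union> Bad" by (auto simp: G_def Bad_def)
    then have "card P \<le> card G + card Bad" using card_Un_le by metis
    then show ?thesis using cardP cardBad card_image[OF inj] by linarith
  qed
  have sub: "snd ` G - High \<subseteq> {c \<in> polys_lt K. q ^ m / 16 \<le> cmod (expsum K n c)}"
  proof
    fix c assume c: "c \<in> snd ` G - High"
    then obtain b where bc: "(b, c) \<in> G" by force
    have b: "b \<in> B" "c \<in> arcs K n b" "minor_part J K n b c < q ^ m / 32"
      using bc by (auto simp: G_def P_def primitive_arcs_def)
    have cK: "c \<in> polys_lt K" using b(2) by (simp add: arcs_def)
    let ?main = "partial_sum (\<lambda>d. degree d < J \<and> b dvd d) K n c"
    let ?minor = "partial_sum (\<lambda>d. degree d < J \<and> \<not> b dvd d) K n c"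
    let ?high = "partial_sum (\<lambda>d. J \<le> degree d) K n c"
    have "expsum K n c = ?main + ?minor + ?high"
      using partial_sum_split[of "\<lambda>d. True" K n c "\<lambda>d. degree d < J"]
        partial_sum_split[of "\<lambda>d. degree d < J" K n c "\<lambda>d. b dvd d"]
      by (simp add: expsum_eq_partial_sum not_less)
    then have "?main = expsum K n c - ?minor - ?high" by simp
    then have "cmod ?main \<le> cmod (expsum K n c) + cmod ?minor + cmod ?high"
      using norm_triangle_ineq4[of "expsum K n c - ?minor" ?high] norm_triangle_ineq4[of "expsum K n c" ?minor]
      by simp
    moreover have "q ^ m / 8 \<le> cmod ?main"
      using cmod_main_part_ge[OF B(1,2)[OF b(1)] _ b(2), of J] B(3)[OF b(1)] jJ by (simp add: m_def)
    moreover have "cmod ?minor < q ^ m / 32"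
      using cmod_partial_sum_le_minor_part[OF cK, of J b n] b(3) by linarith
    moreover have "cmod ?high < q ^ m / 32"
    proof (rule ccontr)
      assume "\<not> cmod ?high < q ^ m / 32"
      then have "(q ^ m / 32)\<^sup>2 \<le> (cmod ?high)\<^sup>2" using q_pos by (intro power_mono) auto
      then show False using c cK by (simp add: High_def)
    qed
    ultimately show "c \<in> {c \<in> polys_lt K. q ^ m / 16 \<le> cmod (expsum K n c)}" using cK by simp
  qed
  have "A / 128 \<le> real (card (snd ` G)) - real (card High)" using cardG cardHigh A by linarith
  also have "\<dots> \<le> real (card (snd ` G - High))"
  proof -
    have "card (snd ` G) - card High \<le> card (snd ` G - High)"
      by (rule diff_card_le_card_Diff) (auto simp: High_def)
    then show ?thesis by linarith
  qed
  also have "\<dots> \<le> real (card {c \<in> polys_lt K. q ^ m / 16 \<le> cmod (expsum K n c)})"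
    using sub by (intro of_nat_mono card_mono) auto
  finally show ?thesis by (simp add: A_def m_def)
qed

end

section \<open>From level sets to moments: real inequalities\<close>

lemma sum_geometric_le:
  fixes y :: real
  assumes "0 \<le> y" "y < 1"
  shows "(\<Sum>j<m. y ^ j) \<le> 1 / (1 - y)"
proof -
  have "(\<Sum>j<m. y ^ j) = (1 - y ^ m) / (1 - y)" using assms by (simp add: sum_gp_strict)
  also have "\<dots> \<le> 1 / (1 - y)" using assms by (intro divide_right_mono) auto
  finally show ?thesis .
qed

lemma sum_geometric_reverse_le:
  fixes y :: real
  assumes "0 \<le> y" "y < 1"
  shows "(\<Sum>j\<le>m. y ^ (m - j)) \<le> 1 / (1 - y)"
proof -
  have "(\<Sum>j\<le>m. y ^ (m - j)) = (\<Sum>j<Suc m. y ^ j)"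
    by (rule sum.reindex_bij_witness[of _ "\<lambda>j. m - j" "\<lambda>j. m - j"]) auto
  also have "\<dots> \<le> 1 / (1 - y)" using assms by (rule sum_geometric_le)
  finally show ?thesis .
qed

text \<open>
  A substitute for Minkowski's inequality, valid for all exponents \<open>k > 0\<close>: with geometric weights
  the sum is comparable to its largest term.
\<close>

lemma powr_sum_le_weighted_sum:
  fixes y k :: real and s :: "nat \<Rightarrow> real"
  assumes y: "0 < y" "y < 1" and k: "k > 0" and s: "\<And>n. s n \<ge> 0"
  shows "(\<Sum>n\<le>N. s n) powr k \<le> (1 / (1 - y)) powr k * (\<Sum>n\<le>N. (s n / y ^ (N - n)) powr k)"
proof -
  define M where "M = Max ((\<lambda>n. s n / y ^ (N - n)) ` {..N})"
  have le: "s n / y ^ (N - n) \<le> M" if "n \<le> N" for n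
    unfolding M_def using that by (intro Max_ge) auto
  have "M \<in> (\<lambda>n. s n / y ^ (N - n)) ` {..N}" unfolding M_def by (intro Max_in) auto
  then obtain n0 where n0: "n0 \<le> N" "M = s n0 / y ^ (N - n0)" by auto
  have M: "M \<ge> 0" using n0 s y by simp
  have "(\<Sum>n\<le>N. s n) \<le> (\<Sum>n\<le>N. M * y ^ (N - n))"
    using le y by (intro sum_mono) (simp add: divide_le_eq)
  also have "\<dots> = M * (\<Sum>n\<le>N. y ^ (N - n))" by (simp add: sum_distrib_left)
  also have "\<dots> \<le> M * (1 / (1 - y))"
    using M y by (intro mult_left_mono sum_geometric_reverse_le) auto
  finally have "(\<Sum>n\<le>N. s n) powr k \<le> (M * (1 / (1 - y))) powr k"
    using k s by (intro powr_mono2) (auto intro: sum_nonneg)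
  also have "\<dots> = (1 / (1 - y)) powr k * M powr k"
    using M y by (subst powr_mult) auto
  also have "\<dots> \<le> (1 / (1 - y)) powr k * (\<Sum>n\<le>N. (s n / y ^ (N - n)) powr k)"
    unfolding n0(2) using n0(1)
    by (intro mult_left_mono member_le_sum[of n0 "{..N}" "\<lambda>n. (s n / y ^ (N - n)) powr k"]) auto
  finally show ?thesis .
qed

lemma exists_layer:
  fixes l :: "nat \<Rightarrow> real"
  assumes "s \<le> l 0"
  shows "s \<le> l J \<or> (\<exists>j<J. l (Suc j) \<le> s \<and> s \<le> l j)"
  using assms
proof (induction J)
  case (Suc J)
  then show ?case by (metis less_Suc_eq linear)
qed simp

lemma powr_le_layers:
  fixes l :: "nat \<Rightarrow> real"
  assumes "0 \<le> s" "s \<le> l 0" "k > 0"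
  shows "s powr k \<le> l J powr k + (\<Sum>j<J. if l (Suc j) \<le> s then l j powr k else 0)"
proof -
  have nonneg: "0 \<le> (\<Sum>j<J. if l (Suc j) \<le> s then l j powr k else 0)"
    by (intro sum_nonneg) auto
  consider "s \<le> l J" | j where "j < J" "l (Suc j) \<le> s" "s \<le> l j"
    using exists_layer[of s l J, OF assms(2)] by blast
  then show ?thesis
  proof cases
    case 1
    then have "s powr k \<le> l J powr k" using assms by (intro powr_mono2) auto
    then show ?thesis using nonneg by linarith
  next
    case 2
    have "s powr k \<le> l j powr k" using assms 2 by (intro powr_mono2) auto
    also have "\<dots> = (if l (Suc j) \<le> s then l j powr k else 0)" using 2 by simp
    also have "\<dots> \<le> (\<Sum>j<J. if l (Suc j) \<le> s then l j powr k else 0)"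
      using 2(1) by (intro member_le_sum[of j "{..<J}" "\<lambda>j. if l (Suc j) \<le> s then l j powr k else 0"]) auto
    finally show ?thesis by (metis add_increasing powr_ge_zero)
  qed
qed

text \<open>The converse for a sequence of levels that decreases at least like a geometric series.\<close>

lemma sum_layers_le:
  fixes l :: "nat \<Rightarrow> real"
  assumes l: "\<And>j. l j > 0" "\<And>j. l (Suc j) \<le> l j / 2" and s: "s \<ge> 0"
  shows "(\<Sum>j<J. if l j \<le> s then l j else 0) \<le> 2 * s"
  using l
proof (induction J arbitrary: l)
  case (Suc J)
  note half = Suc.prems(2)
  show ?case
  proof (cases "l 0 \<le> s")
    case True
    have le: "l j \<le> l 0 * (1 / 2) ^ j" for j
    proof (induction j)
      case (Suc i)
      then show ?case using half[of i] by simp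
    qed simp
    have "(\<Sum>j<Suc J. if l j \<le> s then l j else 0) \<le> (\<Sum>j<Suc J. l 0 * (1 / 2) ^ j)"
      using le Suc.prems(1)[of 0] by (intro sum_mono) auto
    also have "\<dots> = l 0 * (\<Sum>j<Suc J. (1 / 2) ^ j)" by (simp only: sum_distrib_left)
    also have "\<dots> \<le> l 0 * (1 / (1 - 1 / 2))"
      using Suc.prems(1)[of 0] by (intro mult_left_mono sum_geometric_le) auto
    finally show ?thesis using True by simp
  next
    case False
    have "(\<Sum>j<Suc J. if l j \<le> s then l j else 0) = (\<Sum>j<J. if l (Suc j) \<le> s then l (Suc j) else 0)"
      using False by (subst sum.lessThan_Suc_shift) simp
    also have "\<dots> \<le> 2 * s" using Suc.prems Suc.IH[of "\<lambda>j. l (Suc j)"] by simp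
    finally show ?thesis .
  qed
qed (use s in simp)

lemma eventually_bound_imp_bound:
  fixes a b :: "nat \<Rightarrow> real"
  assumes "\<And>N. N \<ge> N0 \<Longrightarrow> a N \<le> C * b N" "\<And>N. N \<ge> 1 \<Longrightarrow> b N > 0" "C > 0"
  shows "\<exists>C>0. \<forall>N\<ge>1. a N \<le> C * b N"
proof -
  define D where "D = C + (\<Sum>N\<in>{1..<N0}. \<bar>a N\<bar> / b N)"
  have nonneg: "0 \<le> \<bar>a N\<bar> / b N" if "N \<ge> 1" for N using assms(2)[OF that] by simp
  have S: "0 \<le> (\<Sum>N\<in>{1..<N0}. \<bar>a N\<bar> / b N)" by (intro sum_nonneg nonneg) auto
  have "a N \<le> D * b N" if N: "N \<ge> 1" for N
  proof (cases "N \<ge> N0")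
    case True
    have "a N \<le> C * b N" using assms(1) True by blast
    also have "\<dots> \<le> D * b N" using S assms(2)[OF N] by (intro mult_right_mono) (auto simp: D_def)
    finally show ?thesis .
  next
    case False
    have "\<bar>a N\<bar> / b N \<le> (\<Sum>N\<in>{1..<N0}. \<bar>a N\<bar> / b N)"
      using False N by (intro member_le_sum[of N "{1..<N0}" "\<lambda>N. \<bar>a N\<bar> / b N"] nonneg) auto
    then have "\<bar>a N\<bar> / b N \<le> D" using assms(3) by (simp add: D_def)
    then have "\<bar>a N\<bar> \<le> D * b N" using assms(2)[OF N] by (simp add: divide_le_eq)
    then show ?thesis by linarith
  qed
  moreover have "D > 0" using S assms(3) by (simp add: D_def)
  ultimately show ?thesis by blast
qed

context r_free_sums
begin

lemma q_power_eq_powr: "q ^ n = q powr real n"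
  using q_pos by (simp add: powr_realpow)

section \<open>Moments over a single degree\<close>

text \<open>
  The exponent \<open>kappa k\<close> is the growth exponent of the moment, and \<open>weight k n\<close> the additional
  factor of the critical exponent \<open>k = 1 + 1 / r\<close>; it is \<open>n + 1\<close> rather than \<open>n\<close> because the parts
  of degree \<open>n = 0\<close> are included.
\<close>

definition kappa :: "real \<Rightarrow> real" where
  "kappa k = (if k < 1 + 1 / real r then k / (real r + 1) else k - 1)"

definition weight :: "real \<Rightarrow> nat \<Rightarrow> real" where
  "weight k n = (if k = 1 + 1 / real r then real n + 1 else 1)"

lemma kappa_pos: "k > 0 \<Longrightarrow> kappa k > 0"
  using r_ge_2 by (auto simp: kappa_def not_less intro: less_le_trans[of 1 "1 + 1 / real r"])

lemma weight_ge_1: "weight k n \<ge> 1"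
  by (simp add: weight_def)

lemma weight_mono: "n \<le> N \<Longrightarrow> weight k n \<le> weight k N"
  by (simp add: weight_def)

lemma weight_moment_order:
  assumes "N \<ge> 1"
  shows "weight k N * q powr (kappa k * real N) \<le> 2 * moment_order q r k N"
proof -
  have "real N + 1 \<le> 2 * real N" using assms by simp
  then have "(real N + 1) * q powr (real N / real r) \<le> 2 * real N * q powr (real N / real r)"
    by (intro mult_right_mono) auto
  then show ?thesis
    by (auto simp: weight_def kappa_def moment_order_def mult.commute)
qed

lemma exponent_le_kappa: "k \<ge> 0 \<Longrightarrow> k / (real r + 1) \<le> kappa k"
proof (cases "k < 1 + 1 / real r")
  case False
  then have "(1 + 1 / real r) * real r \<le> k * real r" by (intro mult_right_mono) auto
  then have "k \<le> (k - 1) * (real r + 1)" using r_ge_2 by (simp add: algebra_simps)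
  then have "k / (real r + 1) \<le> k - 1" by (simp add: divide_le_eq)
  then show ?thesis using False by (simp add: kappa_def)
qed (simp add: kappa_def)

text \<open>The sum over the levels; the three cases are a geometric series dominated by its last
  term, a constant one, and a geometric series dominated by its first term.\<close>

lemma sum_levels_le:
  assumes k: "k > 0"
  obtains C where "C > 0"
    "\<And>n. (\<Sum>j<n div (r + 1). q powr (real n * (k - 1) + real j * (real r + 1 - real r * k)))
      \<le> C * (weight k n * q powr (kappa k * real n))"
proof -
  let ?e = "real r + 1 - real r * k"
  let ?J = "\<lambda>n. n div (r + 1)"
  consider "k < 1 + 1 / real r" | "k = 1 + 1 / real r" | "k > 1 + 1 / real r" by linarith
  then show ?thesis
  proof cases
    case 1
    then have e: "?e > 0" using r_ge_2 by (simp add: field_simps)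
    let ?y = "q powr (- ?e)"
    have y: "0 \<le> ?y" "?y < 1" using e q_gt_1 by (auto simp: powr_less_one)
    show ?thesis
    proof (rule that)
      show "1 / (1 - ?y) > 0" using y by simp
      fix n
      have "(\<Sum>j<?J n. q powr (real n * (k - 1) + real j * ?e))
          \<le> (\<Sum>j<?J n. q powr (kappa k * real n) * ?y ^ (?J n - j))"
      proof (intro sum_mono)
        fix j assume j: "j \<in> {..<?J n}"
        have "(r + 1) * ?J n \<le> n" by (rule times_div_less_eq_dividend)
        then have "(real r + 1) * real (?J n) \<le> real n" by (metis of_nat_1 of_nat_add of_nat_le_iff of_nat_mult)
        then have "real (?J n) \<le> real n / (real r + 1)" by (simp add: field_simps)
        then have "real (?J n) * ?e \<le> real n / (real r + 1) * ?e" using e by (intro mult_right_mono) auto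
        moreover have "real n * (k - 1) + real n / (real r + 1) * ?e = kappa k * real n"
          using 1 by (simp add: kappa_def field_simps)
        ultimately have "real n * (k - 1) + real j * ?e \<le> kappa k * real n - real (?J n - j) * ?e"
          using j by (simp add: of_nat_diff algebra_simps)
        then have "q powr (real n * (k - 1) + real j * ?e) \<le> q powr (kappa k * real n - real (?J n - j) * ?e)"
          using q_ge_1 by (intro powr_mono) auto
        also have "\<dots> = q powr (kappa k * real n) * q powr (- ?e * real (?J n - j))"
          by (subst powr_add[symmetric]) (simp add: algebra_simps)
        also have "q powr (- ?e * real (?J n - j)) = ?y ^ (?J n - j)"
          using q_pos by (simp add: powr_realpow[symmetric] powr_powr)
        finally show "q powr (real n * (k - 1) + real j * ?e) \<le> q powr (kappa k * real n) * ?y ^ (?J n - j)" .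
      qed
      also have "\<dots> = q powr (kappa k * real n) * (\<Sum>j<?J n. ?y ^ (?J n - j))"
        by (simp only: sum_distrib_left)
      also have "\<dots> \<le> q powr (kappa k * real n) * (\<Sum>j\<le>?J n. ?y ^ (?J n - j))"
        using y by (intro mult_left_mono sum_mono2) auto
      also have "\<dots> \<le> q powr (kappa k * real n) * (1 / (1 - ?y))"
        using y by (intro mult_left_mono sum_geometric_reverse_le) auto
      finally show "(\<Sum>j<?J n. q powr (real n * (k - 1) + real j * ?e))
          \<le> 1 / (1 - ?y) * (weight k n * q powr (kappa k * real n))"
        using 1 by (simp add: weight_def mult.commute)
    qed
  next
    case 2
    have e: "?e = 0" using 2 r_ge_2 by (simp add: field_simps)
    show ?thesis
    proof (rule that)
      show "(1::real) > 0" by simp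
      fix n
      have "?J n \<le> n" by simp
      then have "real (?J n) \<le> real n + 1" by linarith
      then have "real (?J n) * q powr (real n * (k - 1)) \<le> (real n + 1) * q powr (real n * (k - 1))"
        by (intro mult_right_mono) auto
      then show "(\<Sum>j<?J n. q powr (real n * (k - 1) + real j * ?e)) \<le> 1 * (weight k n * q powr (kappa k * real n))"
        unfolding e using 2 by (simp add: weight_def kappa_def mult.commute)
    qed
  next
    case 3
    then have e: "?e < 0" using r_ge_2 by (simp add: field_simps)
    let ?y = "q powr ?e"
    have y: "0 \<le> ?y" "?y < 1" using e q_gt_1 by (auto simp: powr_less_one)
    show ?thesis
    proof (rule that)
      show "1 / (1 - ?y) > 0" using y by simp
      fix n
      have "(\<Sum>j<?J n. q powr (real n * (k - 1) + real j * ?e))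
          = q powr (real n * (k - 1)) * (\<Sum>j<?J n. ?y ^ j)"
        using q_pos by (simp add: sum_distrib_left powr_add powr_realpow[symmetric] powr_powr mult.commute)
      also have "\<dots> \<le> q powr (real n * (k - 1)) * (1 / (1 - ?y))"
        using y by (intro mult_left_mono sum_geometric_le) auto
      finally show "(\<Sum>j<?J n. q powr (real n * (k - 1) + real j * ?e))
          \<le> 1 / (1 - ?y) * (weight k n * q powr (kappa k * real n))"
        using 3 by (simp add: weight_def kappa_def mult.commute)
    qed
  qed
qed

lemma cmod_expsum_le: "cmod (expsum K n c) \<le> q ^ n"
proof -
  have "cmod (expsum K n c) \<le> (\<Sum>f\<in>(monics n :: 'a poly set). 1)"
    unfolding expsum_def by (intro sum_norm_le) (simp add: norm_mult)
  then show ?thesis using real_card_monics[of n] by simp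
qed

lemma level_powr:
  "a > 0 \<Longrightarrow> (a * (q ^ n / q ^ (r * j))) powr k = a powr k * q powr (k * (real n - real r * real j))"
  using q_pos by (simp add: powr_mult powr_divide q_power_eq_powr powr_powr powr_diff[symmetric] algebra_simps)

text \<open>
  The \<open>k\<close>-th powers are summed over the levels \<open>2 * q ^ n / q ^ (r * j)\<close> with \<open>j \<le> n / (r + 1)\<close>.  The
  lowest level is about \<open>q ^ (n / (r + 1))\<close>, and below it the trivial bound suffices.
\<close>

lemma single_degree_moment_le:
  assumes k: "k > 0"
  obtains C where "C > 0"
    "\<And>n K. n < K \<Longrightarrow> (\<Sum>c\<in>polys_lt K. cmod (expsum K n c) powr k)
      \<le> q ^ K * (C * (weight k n * q powr (kappa k * real n)))"
proof -
  obtain C0 where C0: "C0 > 0"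
    "\<And>n. (\<Sum>j<n div (r + 1). q powr (real n * (k - 1) + real j * (real r + 1 - real r * k)))
      \<le> C0 * (weight k n * q powr (kappa k * real n))"
    using sum_levels_le[OF k] by blast
  define C1 where "C1 = 2 powr k * q powr (k * real r)"
  define C2 where "C2 = 13 * 2 powr k * q ^ (r + 1)"
  have C1: "C1 > 0" and C2: "C2 > 0" using q_pos by (auto simp: C1_def C2_def)
  show ?thesis
  proof (rule that)
    show "C1 + C2 * C0 > 0" using C1 C2 C0(1) by (simp add: add_pos_pos)
    fix n K :: nat assume n: "n < K"
    let ?J = "n div (r + 1)"
    let ?M = "weight k n * q powr (kappa k * real n)"
    define l where "l j = 2 * (q ^ n / q ^ (r * j))" for j
    have "(\<Sum>c\<in>polys_lt K. cmod (expsum K n c) powr k)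
        \<le> (\<Sum>c\<in>polys_lt K. l ?J powr k + (\<Sum>j<?J. if l (Suc j) \<le> cmod (expsum K n c) then l j powr k else 0))"
    proof (intro sum_mono powr_le_layers)
      fix c show "cmod (expsum K n c) \<le> l 0" using cmod_expsum_le[of K n c] zero_le_power[OF q_ge_0, of n] unfolding l_def by simp
    qed (use k in auto)
    also have "\<dots> = real (card (polys_lt K :: 'a poly set)) * l ?J powr k
        + (\<Sum>c\<in>polys_lt K. \<Sum>j<?J. if l (Suc j) \<le> cmod (expsum K n c) then l j powr k else 0)"
      by (simp add: sum.distrib)
    also have "(\<Sum>c\<in>polys_lt K. \<Sum>j<?J. if l (Suc j) \<le> cmod (expsum K n c) then l j powr k else 0)
        = (\<Sum>j<?J. \<Sum>c\<in>polys_lt K. if l (Suc j) \<le> cmod (expsum K n c) then l j powr k else 0)"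
      by (rule sum.swap)
    also have "\<dots> = (\<Sum>j<?J. real (card {c \<in> polys_lt K. l (Suc j) \<le> cmod (expsum K n c)}) * l j powr k)"
      by (intro sum.cong refl) (simp add: sum.inter_filter[symmetric])
    also have "\<dots> \<le> (\<Sum>j<?J. 13 * q ^ K * (q ^ ((r + 1) * Suc j) / q ^ n) * l j powr k)"
      unfolding l_def using n by (intro sum_mono mult_right_mono card_large_expsum_le) auto
    also have "\<dots> = (\<Sum>j<?J. q ^ K * C2 * q powr (real n * (k - 1) + real j * (real r + 1 - real r * k)))"
    proof (intro sum.cong refl)
      fix j
      have e1: "q ^ ((r + 1) * Suc j) / q ^ n = q ^ (r + 1) * q powr ((real r + 1) * real j - real n)"
        using q_pos by (simp add: q_power_eq_powr powr_diff powr_add[symmetric] algebra_simps)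
      have e2: "l j powr k = 2 powr k * q powr (k * (real n - real r * real j))"
        unfolding l_def by (rule level_powr) simp
      have e3: "q powr (real n * (k - 1) + real j * (real r + 1 - real r * k))
          = q powr (k * (real n - real r * real j)) * q powr ((real r + 1) * real j - real n)"
        by (subst powr_add[symmetric]) (simp add: algebra_simps)
      show "13 * q ^ K * (q ^ ((r + 1) * Suc j) / q ^ n) * l j powr k
          = q ^ K * C2 * q powr (real n * (k - 1) + real j * (real r + 1 - real r * k))"
        unfolding e1 e2 e3 C2_def by (simp only: mult_ac)
    qed
    also have "\<dots> = q ^ K * C2 * (\<Sum>j<?J. q powr (real n * (k - 1) + real j * (real r + 1 - real r * k)))"
      by (simp only: sum_distrib_left)
    also have "\<dots> \<le> q ^ K * C2 * (C0 * ?M)"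
      using C0(2) C2 q_pos by (intro mult_left_mono) auto
    also have "real (card (polys_lt K :: 'a poly set)) * l ?J powr k \<le> q ^ K * (C1 * ?M)"
    proof -
      have "n < (?J + 1) * (r + 1)" using dividend_less_div_times[of "r + 1" n] by (simp add: algebra_simps)
      then have "n \<le> ?J * (r + 1) + r" by simp
      then have "real n \<le> real (?J * (r + 1) + r)" by (simp only: of_nat_le_iff)
      then have "real n \<le> real ?J * (real r + 1) + real r" by (simp add: algebra_simps)
      then have "real n / (real r + 1) \<le> (real ?J * (real r + 1) + real r) / (real r + 1)"
        by (intro divide_right_mono) auto
      also have "\<dots> \<le> real ?J + 1" by (simp add: field_simps)
      finally have "real r * (real n / (real r + 1)) \<le> real r * (real ?J + 1)" by (intro mult_left_mono) auto
      then have "real n - real r * real ?J \<le> real n / (real r + 1) + real r"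
        by (simp add: field_simps)
      then have "k * (real n - real r * real ?J) \<le> k * (real n / (real r + 1) + real r)"
        using k by (intro mult_left_mono) auto
      also have "\<dots> = k / (real r + 1) * real n + k * real r" by (simp add: algebra_simps)
      also have "\<dots> \<le> kappa k * real n + k * real r"
        using exponent_le_kappa[of k] k by (intro add_right_mono mult_right_mono) auto
      finally have "q powr (k * (real n - real r * real ?J)) \<le> q powr (kappa k * real n + k * real r)"
        using q_ge_1 by (intro powr_mono) auto
      then have "2 powr k * q powr (k * (real n - real r * real ?J)) \<le> C1 * (1 * q powr (kappa k * real n))"
        by (simp add: C1_def powr_add mult_ac)
      also have "\<dots> \<le> C1 * ?M" using C1 weight_ge_1 by (intro mult_left_mono mult_right_mono) auto
      finally have "l ?J powr k \<le> C1 * ?M" unfolding l_def by (subst level_powr) simp_all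
      then show ?thesis unfolding real_card_polys_lt using q_pos by (intro mult_left_mono) auto
    qed
    finally show "(\<Sum>c\<in>polys_lt K. cmod (expsum K n c) powr k) \<le> q ^ K * ((C1 + C2 * C0) * ?M)"
      by (simp add: algebra_simps)
  qed
qed

section \<open>Moments of the full exponential sum\<close>

text \<open>
  The exponential sum over all degrees up to \<open>N\<close>, and the average of the \<open>k\<close>-th power of its absolute
  value over all \<open>c\<close>.
\<close>

definition total_sum :: "nat \<Rightarrow> 'a poly \<Rightarrow> complex" where
  "total_sum N c = (\<Sum>n\<le>N. expsum (N + 1) n c)"

definition finite_moment :: "real \<Rightarrow> nat \<Rightarrow> real" where
  "finite_moment k N = (\<Sum>c\<in>polys_lt (N + 1). real_pow (cmod (total_sum N c)) k) / q ^ (N + 1)"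

text \<open>
  The degrees \<open>n \<le> N\<close> are combined with weights that grow slower than the moments themselves.
\<close>

lemma finite_moment_le:
  assumes k: "k > 0"
  shows "\<exists>C>0. \<forall>N\<ge>1. finite_moment k N \<le> C * moment_order q r k N"
proof -
  obtain C where C: "C > 0"
    "\<And>n K. n < K \<Longrightarrow> (\<Sum>c\<in>polys_lt K. cmod (expsum K n c) powr k)
      \<le> q ^ K * (C * (weight k n * q powr (kappa k * real n)))"
    using single_degree_moment_le[OF k] by blast
  define \<delta> where "\<delta> = kappa k / 2"
  have \<delta>: "\<delta> > 0" using kappa_pos[OF k] by (simp add: \<delta>_def)
  define y where "y = q powr (- (\<delta> / k))"
  have y: "0 < y" "y < 1" using \<delta> k q_gt_1 by (auto simp: y_def powr_less_one)
  define z where "z = q powr (- \<delta>)"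
  have z: "0 < z" "z < 1" using \<delta> q_gt_1 by (auto simp: z_def powr_less_one)
  define D where "D = (1 / (1 - y)) powr k"
  have D: "D > 0" using y by (simp add: D_def)
  have bound: "finite_moment k N \<le> D * C * (1 / (1 - z)) * (weight k N * q powr (kappa k * real N))" for N
  proof -
    let ?K = "N + 1"
    have yk: "(s / y ^ (N - n)) powr k = q powr (\<delta> * real (N - n)) * s powr k" if "s \<ge> 0" for s n
    proof -
      have "y ^ (N - n) = q powr (- (\<delta> / k * real (N - n)))"
        using q_pos by (simp add: y_def powr_realpow[symmetric] powr_powr)
      then have "1 / y ^ (N - n) = q powr (\<delta> / k * real (N - n))"
        by (simp only: powr_minus) (simp add: divide_inverse)
      then have "(1 / y ^ (N - n)) powr k = q powr (\<delta> * real (N - n))"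
        using k by (simp add: powr_powr)
      then show ?thesis
        using that y powr_mult[of "1 / y ^ (N - n)" s k] by simp
    qed
    have "(\<Sum>c\<in>polys_lt ?K. cmod (total_sum N c) powr k)
        \<le> (\<Sum>c\<in>polys_lt ?K. D * (\<Sum>n\<le>N. (cmod (expsum ?K n c) / y ^ (N - n)) powr k))"
    proof (intro sum_mono)
      fix c
      have "cmod (total_sum N c) \<le> (\<Sum>n\<le>N. cmod (expsum ?K n c))"
        unfolding total_sum_def by (rule norm_sum)
      then have "cmod (total_sum N c) powr k \<le> (\<Sum>n\<le>N. cmod (expsum ?K n c)) powr k"
        using k by (intro powr_mono2) auto
      also have "\<dots> \<le> D * (\<Sum>n\<le>N. (cmod (expsum ?K n c) / y ^ (N - n)) powr k)"
        unfolding D_def using y k by (intro powr_sum_le_weighted_sum) auto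
      finally show "cmod (total_sum N c) powr k \<le> D * (\<Sum>n\<le>N. (cmod (expsum ?K n c) / y ^ (N - n)) powr k)" .
    qed
    also have "\<dots> = D * (\<Sum>n\<le>N. q powr (\<delta> * real (N - n)) * (\<Sum>c\<in>polys_lt ?K. cmod (expsum ?K n c) powr k))"
      unfolding sum_distrib_left[symmetric]
      by (subst sum.swap) (simp add: yk sum_distrib_left)
    also have "\<dots> \<le> D * (\<Sum>n\<le>N. q powr (\<delta> * real (N - n)) * (q ^ ?K * (C * (weight k n * q powr (kappa k * real n)))))"
      using D by (intro mult_left_mono sum_mono C(2)) auto
    also have "\<dots> \<le> D * (\<Sum>n\<le>N. q ^ ?K * C * (weight k N * q powr (kappa k * real N)) * z ^ (N - n))"
    proof (intro mult_left_mono sum_mono)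
      fix n assume n: "n \<in> {..N}"
      have e1: "\<delta> * real (N - n) + kappa k * real n = kappa k * real N - \<delta> * real (N - n)"
        using n by (simp add: \<delta>_def of_nat_diff field_simps)
      have "q powr (\<delta> * real (N - n)) * q powr (kappa k * real n) = q powr (kappa k * real N) * q powr (- \<delta> * real (N - n))"
        unfolding powr_add[symmetric] e1 by simp
      also have "q powr (- \<delta> * real (N - n)) = z ^ (N - n)"
        using q_pos by (simp add: z_def powr_realpow[symmetric] powr_powr)
      finally have eq: "q powr (\<delta> * real (N - n)) * q powr (kappa k * real n) = q powr (kappa k * real N) * z ^ (N - n)" .
      have "q powr (\<delta> * real (N - n)) * (q ^ ?K * (C * (weight k n * q powr (kappa k * real n))))
          = q ^ ?K * C * (q powr (\<delta> * real (N - n)) * q powr (kappa k * real n)) * weight k n"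
        by (simp only: mult_ac)
      also have "\<dots> \<le> q ^ ?K * C * (q powr (\<delta> * real (N - n)) * q powr (kappa k * real n)) * weight k N"
        using n C(1) q_pos weight_mono by (intro mult_left_mono) auto
      also have "\<dots> = q ^ ?K * C * (weight k N * q powr (kappa k * real N)) * z ^ (N - n)"
        unfolding eq by (simp only: mult_ac)
      finally show "q powr (\<delta> * real (N - n)) * (q ^ ?K * (C * (weight k n * q powr (kappa k * real n))))
          \<le> q ^ ?K * C * (weight k N * q powr (kappa k * real N)) * z ^ (N - n)" .
    qed (use D in simp)
    also have "\<dots> = q ^ ?K * (D * C * (\<Sum>n\<le>N. z ^ (N - n)) * (weight k N * q powr (kappa k * real N)))"
      by (simp add: sum_distrib_left sum_distrib_right mult_ac)
    also have "\<dots> \<le> q ^ ?K * (D * C * (1 / (1 - z)) * (weight k N * q powr (kappa k * real N)))"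
      using D C(1) z q_pos weight_ge_1[of k N]
      by (intro mult_left_mono mult_right_mono sum_geometric_reverse_le) auto
    finally show ?thesis
      using k q_pos by (simp add: finite_moment_def real_pow_def divide_le_eq mult_ac)
  qed
  show ?thesis
  proof (intro exI conjI allI impI)
    show "D * C * (1 / (1 - z)) * 2 > 0" using D C(1) z by simp
    fix N :: nat assume N: "N \<ge> 1"
    have "D * C * (1 / (1 - z)) * (weight k N * q powr (kappa k * real N))
        \<le> D * C * (1 / (1 - z)) * (2 * moment_order q r k N)"
      using D C(1) z weight_moment_order[OF N] by (intro mult_left_mono) auto
    then show "finite_moment k N \<le> D * C * (1 / (1 - z)) * 2 * moment_order q r k N"
      using bound[of N] by simp
  qed
qed

section \<open>Lower bounds for the moments\<close>

lemma total_sum_shift: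
  "total_sum N (c + monom \<gamma> N)
    = (\<Sum>n<N. expsum (N + 1) n c) + \<psi> \<gamma> * expsum (N + 1) N c"
proof -
  have chi: "chi (N + 1) (monom \<gamma> N) f = \<psi> (coeff f N * \<gamma>)" for f
  proof -
    have "(\<Sum>i<N + 1. coeff f i * coeff (monom \<gamma> N) i) = (\<Sum>i<N + 1. if i = N then coeff f N * \<gamma> else 0)"
      by (intro sum.cong) auto
    then show ?thesis by (simp add: chi_def)
  qed
  have low: "expsum (N + 1) n (c + monom \<gamma> N) = expsum (N + 1) n c" if "n < N" for n
    unfolding expsum_def chi_add_left chi using that
    by (intro sum.cong refl) (auto simp: monics_def coeff_eq_0)
  have top: "expsum (N + 1) N (c + monom \<gamma> N) = \<psi> \<gamma> * expsum (N + 1) N c"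
    unfolding expsum_def chi_add_left chi sum_distrib_left
    by (intro sum.cong refl) (auto simp: monics_def)
  have "{..N} = insert N {..<N}" by auto
  then show ?thesis unfolding total_sum_def using low top by simp
qed

text \<open>
  Since \<open>\<psi>\<close> is nontrivial, shifting \<open>c\<close> in the top coefficient isolates the part of degree exactly
  \<open>N\<close> in the full sum.
\<close>

lemma card_large_total_sum_ge:
  obtains h where "h > 0"
    "\<And>N j. j + 21 \<le> N div (r + 1) \<Longrightarrow>
      q ^ (N + 1) * (q ^ ((r + 1) * j) / q ^ N) / 256
        \<le> real (card {c \<in> polys_lt (N + 1). h * (q ^ N / q ^ (r * j)) \<le> cmod (total_sum N c)})"
proof -
  obtain \<gamma> where \<gamma>: "\<psi> \<gamma> \<noteq> 1" using psi_nontrivial by auto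
  \<comment> \<open>one of two shifts of the sum has at least half the size of \<open>(1 - \<psi> \<gamma>)\<close> times the top part\<close>
  define h where "h = cmod (1 - \<psi> \<gamma>) / 32"
  show ?thesis
  proof (rule that)
    show "h > 0" using \<gamma> by (simp add: h_def)
    fix N j assume j: "j + 21 \<le> N div (r + 1)"
    let ?V = "polys_lt (N + 1) :: 'a poly set"
    define m where "m = N - r * j"
    define S where "S = {c \<in> ?V. h * q ^ m \<le> cmod (total_sum N c)}"
    have "j * (r + 1) \<le> N div (r + 1) * (r + 1)" using j by (intro mult_right_mono) auto
    also have "\<dots> \<le> N" by (rule div_times_less_eq_dividend)
    finally have jN: "r * j + j \<le> N" by (simp add: algebra_simps)
    have qm: "q ^ N / q ^ (r * j) = q ^ m"
      unfolding m_def using jN q_nonzero by (intro power_diff[symmetric]) auto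
    have qj: "q ^ ((r + 1) * j) / q ^ N = q ^ j / q ^ m"
      unfolding qm[symmetric] by (simp add: power_add distrib_right)
    have sub: "{c \<in> ?V. q ^ m / 16 \<le> cmod (expsum (N + 1) N c)} \<subseteq> S \<union> (\<lambda>c. c - monom \<gamma> N) ` S"
    proof
      fix c assume c: "c \<in> {c \<in> ?V. q ^ m / 16 \<le> cmod (expsum (N + 1) N c)}"
      let ?E = "expsum (N + 1) N c"
      have "(1 - \<psi> \<gamma>) * ?E = total_sum N c - total_sum N (c + monom \<gamma> N)"
        using total_sum_shift[of N c 0] by (simp add: total_sum_shift algebra_simps)
      then have "cmod (1 - \<psi> \<gamma>) * cmod ?E \<le> cmod (total_sum N c) + cmod (total_sum N (c + monom \<gamma> N))"
        by (metis norm_mult norm_triangle_ineq4)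
      moreover have "cmod (1 - \<psi> \<gamma>) * (q ^ m / 16) \<le> cmod (1 - \<psi> \<gamma>) * cmod ?E"
        using c by (intro mult_left_mono) auto
      ultimately have "h * q ^ m \<le> cmod (total_sum N c) \<or> h * q ^ m \<le> cmod (total_sum N (c + monom \<gamma> N))"
        unfolding h_def by (auto simp: field_simps)
      then consider "c \<in> S" | "c + monom \<gamma> N \<in> S"
        using c by (auto simp: S_def polys_lt_add monom_in_polys_lt)
      then show "c \<in> S \<union> (\<lambda>c. c - monom \<gamma> N) ` S"
      proof cases
        case 2
        then have "c \<in> (\<lambda>c. c - monom \<gamma> N) ` S" by (intro image_eqI[of _ _ "c + monom \<gamma> N"]) auto
        then show ?thesis by simp
      qed simp
    qed
    have finS: "finite S" by (rule finite_subset[OF _ finite_polys_lt[of "N + 1"]]) (auto simp: S_def)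
    have "q ^ (N + 1) * q ^ j / q ^ m / 128 \<le> real (card {c \<in> ?V. q ^ m / 16 \<le> cmod (expsum (N + 1) N c)})"
      unfolding m_def using j by (intro card_large_expsum_ge) auto
    also have "\<dots> \<le> real (card (S \<union> (\<lambda>c. c - monom \<gamma> N) ` S))"
      using sub finS by (intro of_nat_mono card_mono) auto
    also have "\<dots> \<le> real (card S + card ((\<lambda>c. c - monom \<gamma> N) ` S))"
      by (simp only: of_nat_le_iff card_Un_le)
    also have "\<dots> \<le> 2 * real (card S)"
      using card_image_le[OF finS, of "\<lambda>c. c - monom \<gamma> N"] by simp
    finally show "q ^ (N + 1) * (q ^ ((r + 1) * j) / q ^ N) / 256
        \<le> real (card {c \<in> ?V. h * (q ^ N / q ^ (r * j)) \<le> cmod (total_sum N c)})"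
      unfolding qm qj S_def by simp
  qed
qed

text \<open>
  A single level gives the bound away from the critical exponent.  At the critical exponent all
  levels contribute equally.
\<close>

lemma level_contribution:
  assumes h: "h > 0"
  shows "(q ^ ((r + 1) * j) / q ^ N) / 256 * (h * (q ^ N / q ^ (r * j))) powr k
    = h powr k / 256 * q powr (k * (real N - real r * real j) + ((real r + 1) * real j - real N))"
proof -
  have "q ^ ((r + 1) * j) / q ^ N = q powr ((real r + 1) * real j - real N)"
    using q_pos by (simp add: q_power_eq_powr powr_diff algebra_simps)
  then show ?thesis unfolding level_powr[OF h] powr_add by simp
qed

lemma finite_moment_ge_level:
  assumes k: "k > 0" and h: "h > 0"
    and card: "q ^ (N + 1) * (q ^ ((r + 1) * j) / q ^ N) / 256
      \<le> real (card {c \<in> polys_lt (N + 1). h * (q ^ N / q ^ (r * j)) \<le> cmod (total_sum N c)})"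
  shows "h powr k / 256 * q powr (k * (real N - real r * real j) + ((real r + 1) * real j - real N))
    \<le> finite_moment k N"
proof -
  let ?L = "h * (q ^ N / q ^ (r * j))"
  have L: "?L > 0" using h q_pos by simp
  have "q ^ (N + 1) * ((q ^ ((r + 1) * j) / q ^ N) / 256 * ?L powr k)
      \<le> real (card {c \<in> polys_lt (N + 1). ?L \<le> cmod (total_sum N c)}) * ?L powr k"
    unfolding mult.assoc[symmetric] times_divide_eq_right using card by (intro mult_right_mono) auto
  also have "\<dots> = (\<Sum>c\<in>{c \<in> polys_lt (N + 1). ?L \<le> cmod (total_sum N c)}. ?L powr k)" by simp
  also have "\<dots> \<le> (\<Sum>c\<in>{c \<in> polys_lt (N + 1). ?L \<le> cmod (total_sum N c)}. cmod (total_sum N c) powr k)"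
    using L k by (intro sum_mono powr_mono2) auto
  also have "\<dots> \<le> (\<Sum>c\<in>polys_lt (N + 1). cmod (total_sum N c) powr k)"
    by (intro sum_mono2) auto
  finally have "(q ^ ((r + 1) * j) / q ^ N) / 256 * ?L powr k
      \<le> (\<Sum>c\<in>polys_lt (N + 1). cmod (total_sum N c) powr k) / q ^ (N + 1)"
    using q_pos by (simp add: le_divide_eq mult_ac)
  then show ?thesis
    unfolding level_contribution[OF h] using k by (simp add: finite_moment_def real_pow_def)
qed

lemma finite_moment_ge_all_levels:
  assumes k: "real r * k \<ge> 1" "k > 0" and h: "h > 0"
    and card: "\<And>j. j < J \<Longrightarrow> q ^ (N + 1) * (q ^ ((r + 1) * j) / q ^ N) / 256
      \<le> real (card {c \<in> polys_lt (N + 1). h * (q ^ N / q ^ (r * j)) \<le> cmod (total_sum N c)})"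
  shows "(\<Sum>j<J. h powr k / 256 * q powr (k * (real N - real r * real j) + ((real r + 1) * real j - real N)))
    \<le> 2 * finite_moment k N"
proof -
  define L where "L j = h * (q ^ N / q ^ (r * j))" for j
  let ?V = "polys_lt (N + 1) :: 'a poly set"
  have L: "L j > 0" for j using h q_pos by (simp add: L_def)
  have half: "L (Suc j) powr k \<le> L j powr k / 2" for j
  proof -
    have "q powr 1 \<le> q powr (real r * k)" using k q_ge_1 by (intro powr_mono) auto
    then have "2 \<le> (q ^ r) powr k" using q_ge_2 q_pos by (simp add: q_power_eq_powr powr_powr)
    moreover have "L j = L (Suc j) * q ^ r" using q_pos by (simp add: L_def power_add)
    then have "L j powr k = L (Suc j) powr k * (q ^ r) powr k"
      using L[of "Suc j"] q_pos by (simp add: powr_mult)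
    ultimately have "L (Suc j) powr k * 2 \<le> L j powr k"
      using mult_left_mono[of 2 "(q ^ r) powr k" "L (Suc j) powr k"] by simp
    then show ?thesis by simp
  qed
  have "q ^ (N + 1) * (\<Sum>j<J. (q ^ ((r + 1) * j) / q ^ N) / 256 * L j powr k)
      = (\<Sum>j<J. q ^ (N + 1) * (q ^ ((r + 1) * j) / q ^ N) / 256 * L j powr k)"
    unfolding sum_distrib_left
    by (intro sum.cong refl) (simp only: mult.assoc times_divide_eq_right times_divide_eq_left)
  also have "\<dots> \<le> (\<Sum>j<J. real (card {c \<in> ?V. L j \<le> cmod (total_sum N c)}) * L j powr k)"
    unfolding L_def using card by (intro sum_mono mult_right_mono) auto
  also have "\<dots> = (\<Sum>j<J. \<Sum>c\<in>?V. if L j \<le> cmod (total_sum N c) then L j powr k else 0)"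
    by (intro sum.cong refl) (simp add: sum.inter_filter[symmetric])
  also have "\<dots> = (\<Sum>c\<in>?V. \<Sum>j<J. if L j \<le> cmod (total_sum N c) then L j powr k else 0)"
    by (rule sum.swap)
  also have "\<dots> \<le> (\<Sum>c\<in>?V. \<Sum>j<J. if L j powr k \<le> cmod (total_sum N c) powr k then L j powr k else 0)"
  proof (intro sum_mono)
    fix c j
    have "L j powr k \<le> cmod (total_sum N c) powr k" if "L j \<le> cmod (total_sum N c)"
      using that L[of j] k by (intro powr_mono2) auto
    then show "(if L j \<le> cmod (total_sum N c) then L j powr k else 0)
        \<le> (if L j powr k \<le> cmod (total_sum N c) powr k then L j powr k else 0)" by auto
  qed
  also have "\<dots> \<le> (\<Sum>c\<in>?V. 2 * cmod (total_sum N c) powr k)"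
    using L half by (intro sum_mono sum_layers_le) (auto simp: less_imp_neq[symmetric])
  also have "\<dots> = 2 * (\<Sum>c\<in>?V. cmod (total_sum N c) powr k)" by (simp add: sum_distrib_left)
  finally have "(\<Sum>j<J. (q ^ ((r + 1) * j) / q ^ N) / 256 * L j powr k)
      \<le> 2 * ((\<Sum>c\<in>?V. cmod (total_sum N c) powr k) / q ^ (N + 1))"
    using q_pos by (simp add: le_divide_eq mult_ac)
  then show ?thesis
    unfolding L_def level_contribution[OF h] using k by (simp add: finite_moment_def real_pow_def)
qed

lemma finite_moment_pos:
  assumes "k > 0"
  shows "finite_moment k N > 0"
proof -
  let ?V = "polys_lt (N + 1) :: 'a poly set"
  have "total_sum N 0 = of_real (\<Sum>n\<le>N. \<Sum>f\<in>(monics n :: 'a poly set). if r_free r f then 1 else 0)"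
    unfolding total_sum_def expsum_def chi_0_left mult_1_right of_real_sum
    by (intro sum.cong refl) simp
  moreover have "(1::real) \<le> (\<Sum>n\<le>N. \<Sum>f\<in>(monics n :: 'a poly set). if r_free r f then 1 else 0)"
  proof -
    have "r_free r (1 :: 'a poly)"
      using r_ge_2 unfolding r_free_def
      by (auto simp: irreducible_def is_unit_power_iff)
    then have "(1::real) = (\<Sum>f\<in>(monics 0 :: 'a poly set). if r_free r f then 1 else 0)" by simp
    also have "\<dots> \<le> (\<Sum>n\<le>N. \<Sum>f\<in>(monics n :: 'a poly set). if r_free r f then 1 else 0)"
      by (rule member_le_sum[of 0 "{..N}" "\<lambda>n. \<Sum>f\<in>(monics n :: 'a poly set). if r_free r f then 1 else 0"])
         (auto intro: sum_nonneg)
    finally show ?thesis .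
  qed
  ultimately have "total_sum N 0 \<noteq> 0" by (metis of_real_eq_0_iff not_one_le_zero)
  then have "0 < cmod (total_sum N 0) powr k" by simp
  also have "\<dots> \<le> (\<Sum>c\<in>?V. cmod (total_sum N c) powr k)"
    by (rule member_le_sum[of 0 ?V "\<lambda>c. cmod (total_sum N c) powr k"]) auto
  finally show ?thesis using assms q_pos by (simp add: finite_moment_def real_pow_def)
qed

lemma finite_moment_ge:
  assumes k: "k > 0"
  shows "\<exists>C>0. \<forall>N\<ge>1. moment_order q r k N \<le> C * finite_moment k N"
proof -
  obtain h where h: "h > 0"
    and card: "\<And>N j. j + 21 \<le> N div (r + 1) \<Longrightarrow>
      q ^ (N + 1) * (q ^ ((r + 1) * j) / q ^ N) / 256
        \<le> real (card {c \<in> polys_lt (N + 1). h * (q ^ N / q ^ (r * j)) \<le> cmod (total_sum N c)})"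
    using card_large_total_sum_ge by blast
  define c0 where "c0 = h powr k / 256"
  have c0: "c0 > 0" using h by (simp add: c0_def)
  have level: "c0 * q powr (k * (real N - real r * real j) + ((real r + 1) * real j - real N)) \<le> finite_moment k N"
    if "j + 21 \<le> N div (r + 1)" for N j
    unfolding c0_def using finite_moment_ge_level[OF k h card[OF that]] .
  \<comment> \<open>from here on at least half of the \<open>N / (r + 1)\<close> levels are available\<close>
  define N0 where "N0 = 42 * (r + 1)"
  have N0: "42 \<le> N div (r + 1)" if "N \<ge> N0" for N
  proof -
    have "42 * (r + 1) div (r + 1) = 42" by (rule nonzero_mult_div_cancel_right) simp
    then show ?thesis using div_le_mono[OF that, of "r + 1"] by (simp only: N0_def)
  qed
  have J_gt: "real N < (real (N div (r + 1)) + 1) * (real r + 1)" for N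
  proof -
    have "N < (N div (r + 1) + 1) * (r + 1)" using dividend_less_div_times[of "r + 1" N] by (simp add: algebra_simps)
    then have "real N < real ((N div (r + 1) + 1) * (r + 1))" by (simp only: of_nat_less_iff)
    then show ?thesis by (simp add: algebra_simps)
  qed
  have J_le: "real (N div (r + 1)) * (real r + 1) \<le> real N" for N
  proof -
    have "real (N div (r + 1) * (r + 1)) \<le> real N" by (simp only: of_nat_le_iff div_times_less_eq_dividend)
    then show ?thesis by (simp add: algebra_simps)
  qed
  consider "k < 1 + 1 / real r" | "k = 1 + 1 / real r" | "k > 1 + 1 / real r" by linarith
  then show ?thesis
  proof cases
    case 1
    define D where "D = q powr (22 * (real r + 1))"
    have D: "D > 0" using q_pos by (simp add: D_def)
    show ?thesis
    proof (rule eventually_bound_imp_bound)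
      show "D / c0 > 0" using D c0 by simp
      fix N assume N: "N \<ge> N0"
      define j where "j = N div (r + 1) - 21"
      have j: "real j = real (N div (r + 1)) - 21" using N0[OF N] by (simp add: j_def of_nat_diff)
      have "real r * (real j * (real r + 1)) \<le> real r * real N"
        using J_le[of N] unfolding j by (intro mult_left_mono) (auto simp: algebra_simps)
      then have "real N \<le> (real N - real r * real j) * (real r + 1)" by (simp add: algebra_simps)
      then have "real N / (real r + 1) \<le> real N - real r * real j" by (simp add: divide_le_eq)
      then have "k * (real N / (real r + 1)) \<le> k * (real N - real r * real j)"
        using k by (intro mult_left_mono) auto
      moreover have "(real r + 1) * real j - real N \<ge> - (22 * (real r + 1))"
        using J_gt[of N] unfolding j by (simp add: algebra_simps)
      ultimately have "real N * k / (real r + 1) \<le>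
          22 * (real r + 1) + (k * (real N - real r * real j) + ((real r + 1) * real j - real N))"
        by (simp add: mult.commute)
      then have "q powr (real N * k / (real r + 1)) \<le>
          q powr (22 * (real r + 1) + (k * (real N - real r * real j) + ((real r + 1) * real j - real N)))"
        using q_ge_1 by (intro powr_mono) auto
      also have "\<dots> = D * q powr (k * (real N - real r * real j) + ((real r + 1) * real j - real N))"
        by (subst powr_add) (simp only: D_def)
      also have "\<dots> \<le> D * (finite_moment k N / c0)"
        using level[of j N] N0[OF N] D c0 by (intro mult_left_mono) (auto simp: j_def le_divide_eq mult.commute)
      finally show "moment_order q r k N \<le> D / c0 * finite_moment k N"
        using 1 by (simp add: moment_order_def)
    qed (use finite_moment_pos[OF k] in auto)
  next
    case 2
    have rk: "real r * k = real r + 1" using 2 r_ge_2 by (simp add: field_simps)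
    show ?thesis
    proof (rule eventually_bound_imp_bound)
      show "4 * (real r + 1) / c0 > 0" using c0 by simp
      fix N assume N: "N \<ge> N0"
      define J where "J = N div (r + 1) - 20"
      have J: "real J = real (N div (r + 1)) - 20" using N0[OF N] by (simp add: J_def of_nat_diff)
      have "real N0 \<le> real N" using N by simp
      then have "42 * (real r + 1) \<le> real N" by (simp add: N0_def)
      then have "real N \<le> 2 * (real r + 1) * real J" using J_gt[of N] unfolding J by (simp add: algebra_simps)
      then have "real N * q powr (real N / real r) \<le> 2 * (real r + 1) * real J * q powr (real N / real r)"
        by (intro mult_right_mono) auto
      also have "\<dots> = 2 * (real r + 1) / c0 * (\<Sum>j<J. c0 * q powr (real N / real r))"
        using c0 by simp
      also have "(\<Sum>j<J. c0 * q powr (real N / real r))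
          = (\<Sum>j<J. h powr k / 256 * q powr (k * (real N - real r * real j) + ((real r + 1) * real j - real N)))"
      proof (intro sum.cong refl)
        fix j
        have "k * (real N - real r * real j) = k * real N - real r * k * real j" by (simp add: algebra_simps)
        also have "k * real N = real N + real N / real r" unfolding 2 by (simp add: algebra_simps)
        finally have "k * (real N - real r * real j) + ((real r + 1) * real j - real N) = real N / real r"
          unfolding rk by simp
        then show "c0 * q powr (real N / real r)
            = h powr k / 256 * q powr (k * (real N - real r * real j) + ((real r + 1) * real j - real N))"
          by (simp add: c0_def)
      qed
      also have "\<dots> \<le> 2 * finite_moment k N"
        using rk k h by (intro finite_moment_ge_all_levels card) (auto simp: J_def)
      finally have "real N * q powr (real N / real r) \<le> 2 * (real r + 1) / c0 * (2 * finite_moment k N)"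
        using c0 by (simp add: mult_left_mono divide_right_mono)
      moreover have "2 * (real r + 1) / c0 * (2 * finite_moment k N) = 4 * (real r + 1) / c0 * finite_moment k N"
        by simp
      moreover have "moment_order q r k N = real N * q powr (real N / real r)"
        using 2 by (simp add: moment_order_def)
      ultimately show "moment_order q r k N \<le> 4 * (real r + 1) / c0 * finite_moment k N"
        by (simp only:)
    qed (use finite_moment_pos[OF k] in auto)
  next
    case 3
    show ?thesis
    proof (rule eventually_bound_imp_bound)
      show "1 / c0 > 0" using c0 by simp
      fix N assume N: "N \<ge> N0"
      have "c0 * q powr (real N * (k - 1)) \<le> finite_moment k N"
        using level[of 0 N] N0[OF N] by (simp add: algebra_simps)
      then show "moment_order q r k N \<le> 1 / c0 * finite_moment k N"
        using 3 c0 by (simp add: moment_order_def field_simps)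
    qed (use finite_moment_pos[OF k] in auto)
  qed
qed

theorem finite_moment_order:
  assumes k: "k \<ge> 0"
  shows "\<exists>C\<^sub>1>0. \<exists>C\<^sub>2>0. \<forall>N\<ge>1. finite_moment k N \<le> C\<^sub>1 * moment_order q r k N \<and>
    moment_order q r k N \<le> C\<^sub>2 * finite_moment k N"
proof (cases "k = 0")
  case True
  have "finite_moment 0 N = 1" for N
    using q_pos real_card_polys_lt[of "N + 1"] by (simp add: finite_moment_def real_pow_def)
  moreover have "moment_order q r 0 N = 1" for N
    using q_pos r_ge_2 by (simp add: moment_order_def add_pos_nonneg)
  ultimately show ?thesis unfolding True by (intro exI[of _ "1 :: real"] conjI allI impI) simp_all
next
  case False
  then have "k > 0" using k by simp
  obtain C\<^sub>1 where C\<^sub>1: "C\<^sub>1 > 0" "\<forall>N\<ge>1. finite_moment k N \<le> C\<^sub>1 * moment_order q r k N"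
    using finite_moment_le[OF \<open>k > 0\<close>] by (elim exE conjE)
  obtain C\<^sub>2 where C\<^sub>2: "C\<^sub>2 > 0" "\<forall>N\<ge>1. moment_order q r k N \<le> C\<^sub>2 * finite_moment k N"
    using finite_moment_ge[OF \<open>k > 0\<close>] by (elim exE conjE)
  have "\<exists>C\<^sub>2>0. \<forall>N\<ge>1. finite_moment k N \<le> C\<^sub>1 * moment_order q r k N \<and>
      moment_order q r k N \<le> C\<^sub>2 * finite_moment k N"
    using C\<^sub>1(2) C\<^sub>2 by (intro exI[of _ C\<^sub>2]) simp
  then show ?thesis using C\<^sub>1(1) by (intro exI[of _ C\<^sub>1]) simp
qed

end

section \<open>The additive character of the finite field\<close>

lemma char_eq_prime:
  assumes p: "prime p" and card: "CARD('a::finite_field) = p ^ h"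
  shows "CHAR('a) = p"
proof -
  have pr: "prime CHAR('a)"
    by (rule prime_CHAR_semidom) (simp add: finite_imp_CHAR_pos)
  have "(\<Sum>x\<in>UNIV. x) = (\<Sum>x\<in>UNIV. x + (1::'a))"
    by (rule sum.reindex_bij_witness[of _ "\<lambda>x. x + 1" "\<lambda>x. x - 1"]) auto
  then have "of_nat CARD('a) = (0::'a)"
    by (simp add: sum.distrib)
  then have "CHAR('a) dvd CARD('a)"
    by (simp only: of_nat_eq_0_iff_char_dvd)
  then have "CHAR('a) dvd p"
    using pr card prime_dvd_power by metis
  then show ?thesis
    using pr p primes_dvd_imp_eq by blast
qed

text \<open>The powers of the primitive \<open>p\<close>-th root of unity \<open>exp (2 * pi * \<i> / p)\<close>.\<close>

definition unit_root :: "nat \<Rightarrow> nat \<Rightarrow> complex" where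
  "unit_root p n = exp (2 * of_real pi * \<i> * of_nat n / of_nat p)"

lemma unit_root_add: "unit_root p (m + n) = unit_root p m * unit_root p n"
  by (simp add: unit_root_def exp_add[symmetric] distrib_left add_divide_distrib)

lemma unit_root_eq_1_iff:
  assumes "p > 0"
  shows "unit_root p n = 1 \<longleftrightarrow> p dvd n"
proof -
  have e: "2 * of_real pi * \<i> * of_nat n / of_nat p = Complex 0 (2 * pi * real n / real p)"
    by (simp add: complex_eq_iff Re_divide_of_nat Im_divide_of_nat)
  have "unit_root p n = 1 \<longleftrightarrow> (\<exists>i::int. 2 * pi * real n / real p = of_int (2 * i) * pi)"
    unfolding unit_root_def e exp_eq_1 by simp
  also have "\<dots> \<longleftrightarrow> (\<exists>i::int. real n = of_int i * real p)"
    using assms by (simp add: field_simps)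
  also have "\<dots> \<longleftrightarrow> (\<exists>i::int. int n = i * int p)"
  proof -
    have "real n = of_int i * real p \<longleftrightarrow> int n = i * int p" for i
    proof -
      have "real n = of_int i * real p \<longleftrightarrow> of_int (int n) = (of_int (i * int p) :: real)" by simp
      then show ?thesis by (simp only: of_int_eq_iff)
    qed
    then show ?thesis by simp
  qed
  also have "\<dots> \<longleftrightarrow> int p dvd int n" by (auto simp: dvd_def mult.commute)
  finally show ?thesis by simp
qed

lemma unit_root_cong:
  assumes p: "prime p" and char: "CHAR('a::finite_field) = p" and eq: "of_nat m = (of_nat n :: 'a)"
  shows "unit_root p m = unit_root p n"
proof -
  have *: "unit_root p m = unit_root p n" if "m \<le> n" "of_nat m = (of_nat n :: 'a)" for m n
  proof -
    have "of_nat (n - m) = (0 :: 'a)" using that by (simp add: of_nat_diff)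
    then have "p dvd n - m" by (simp only: of_nat_eq_0_iff_char_dvd char)
    then have "unit_root p (n - m) = 1" using unit_root_eq_1_iff p prime_gt_0_nat by blast
    then show ?thesis using unit_root_add[of p m "n - m"] that(1) by simp
  qed
  show ?thesis
  proof (cases "m \<le> n")
    case True
    then show ?thesis using *[OF _ eq] by blast
  next
    case False
    then show ?thesis using *[of n m] eq by simp
  qed
qed

lemma e_q_eq_unit_root: "e_q p h c = unit_root p (residue_rep p (field_trace p h c))"
  by (simp add: e_q_def unit_root_def)

lemma e_q_add:
  fixes a b :: "'a::finite_field"
  assumes p: "prime p" and h: "h \<ge> 1" and card: "CARD('a) = p ^ h"
  shows "e_q p h (a + b) = e_q p h a * e_q p h b"
proof -
  have char: "CHAR('a) = p" by (rule char_eq_prime[OF p card])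
  have tr: "field_trace p h (a + b) = field_trace p h a + field_trace p h b"
    unfolding field_trace_def sum.distrib[symmetric]
    using p char by (intro sum.cong refl freshmans_dream') auto
  have "of_nat (residue_rep p (field_trace p h (a + b)))
      = (of_nat (residue_rep p (field_trace p h a) + residue_rep p (field_trace p h b)) :: 'a)"
    by (simp only: of_nat_add residue_rep_field_trace(2)[OF assms] tr[symmetric])
  from unit_root_cong[OF p char this] show ?thesis
    by (simp add: e_q_eq_unit_root unit_root_add)
qed

lemma cmod_e_q: "cmod (e_q p h a) = 1"
proof -
  have "2 * of_real pi * \<i> * of_nat n / of_nat p = \<i> * of_real (2 * pi * real n / real p)" for n
    by simp
  then show ?thesis unfolding e_q_def by (metis norm_exp_i_times)
qed

text \<open>The trace is a polynomial function of degree less than the size of the field.\<close>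

lemma e_q_nontrivial:
  assumes p: "prime p" and h: "h \<ge> 1" and card: "CARD('a::finite_field) = p ^ h"
  shows "\<exists>a::'a. e_q p h a \<noteq> 1"
proof -
  define T where "T = (\<Sum>i<h. monom (1::'a) (p ^ i))"
  have inj: "p ^ i = p ^ j \<longleftrightarrow> i = j" for i j using prime_gt_1_nat[OF p] by (simp add: power_inject_exp)
  have "coeff T (p ^ 0) = (\<Sum>i<h. if i = 0 then 1 else 0)"
    unfolding T_def coeff_sum by (intro sum.cong refl) (auto simp: coeff_monom inj[of _ 0, simplified])
  also have "\<dots> = 1" using h by simp
  finally have nz: "T \<noteq> 0" by auto
  have "degree T \<le> p ^ (h - 1)"
    unfolding T_def using h prime_gt_0_nat[OF p]
    by (intro degree_sum_le) (auto intro!: order.trans[OF degree_monom_le] power_increasing)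
  also have "\<dots> < CARD('a)"
    unfolding card using h prime_gt_1_nat[OF p] by (intro power_strict_increasing) auto
  finally have "card {x. poly T x = 0} < CARD('a)"
    using card_poly_roots_bound[OF nz] by linarith
  then have "{x. poly T x = 0} \<noteq> UNIV" by auto
  then obtain a where "poly T a \<noteq> 0" by auto
  then have tr: "field_trace p h a \<noteq> 0"
    by (simp add: T_def poly_sum poly_monom field_trace_def)
  let ?n = "residue_rep p (field_trace p h a)"
  have n: "?n < p" "of_nat ?n = field_trace p h a"
    using residue_rep_field_trace[OF assms] by blast+
  then have "?n \<noteq> 0" using tr by (metis of_nat_0)
  then have "\<not> p dvd ?n" using n(1) by (auto dest: dvd_imp_le)
  then have "e_q p h a \<noteq> 1"
    unfolding e_q_eq_unit_root using unit_root_eq_1_iff prime_gt_0_nat[OF p] by blast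
  then show ?thesis by blast
qed

section \<open>Reduction of the integral over the torus to a finite average\<close>

lemma torus_eq: "torus = {\<alpha> :: 'a::finite_field fls. \<forall>j\<le>0. fls_nth \<alpha> j = 0}"
proof (intro set_eqI iffI)
  fix \<alpha> :: "'a fls"
  have q: "real CARD('a) > 1" using card_finite_field_ge_2[where 'a = 'a] by linarith
  show "\<alpha> \<in> {\<alpha>. \<forall>j\<le>0. fls_nth \<alpha> j = 0}" if \<alpha>: "\<alpha> \<in> torus"
  proof (cases "\<alpha> = 0")
    case False
    then have "real CARD('a) powi (- fls_subdegree \<alpha>) < 1"
      using \<alpha> by (simp add: torus_def laurent_abs_def)
    then have "fls_subdegree \<alpha> > 0"
      using q one_le_power_int[of "real CARD('a)" "- fls_subdegree \<alpha>"] by linarith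
    then show ?thesis by auto
  qed simp
  show "\<alpha> \<in> torus" if \<alpha>: "\<alpha> \<in> {\<alpha>. \<forall>j\<le>0. fls_nth \<alpha> j = 0}"
  proof (cases "\<alpha> = 0")
    case False
    then have "fls_subdegree \<alpha> > 0" using \<alpha> by (intro fls_subdegree_greaterI) auto
    moreover have "inverse (real CARD('a)) < 1" using q by (simp add: inverse_less_1_iff)
    ultimately have "real CARD('a) powi (- fls_subdegree \<alpha>) < 1"
      by (simp add: power_int_def power_less_one_iff)
    then show ?thesis using False by (simp add: torus_def laurent_abs_def)
  qed (simp add: torus_def laurent_abs_def)
qed

text \<open>
  The elements of the torus whose first \<open>K\<close> coefficients are those of \<open>c\<close>.
\<close>

definition cylinder :: "nat \<Rightarrow> 'a::finite_field poly \<Rightarrow> 'a fls set" where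
  "cylinder K c = {\<alpha>. (\<forall>j\<le>0. fls_nth \<alpha> j = 0) \<and> (\<forall>i<K. fls_nth \<alpha> (1 + int i) = coeff c i)}"

lemma nth_eq_if_dist_less:
  fixes \<alpha> \<beta> :: "'a::group_add fls"
  assumes "dist \<beta> \<alpha> < inverse (2 ^ K)" "j \<le> int K"
  shows "fls_nth \<beta> j = fls_nth \<alpha> j"
proof (cases "\<alpha> = \<beta>")
  case False
  then have ne: "\<beta> - \<alpha> \<noteq> 0" by simp
  have "fls_subdegree (\<beta> - \<alpha>) > int K"
  proof (rule ccontr)
    assume neg: "\<not> fls_subdegree (\<beta> - \<alpha>) > int K"
    show False
    proof (cases "fls_subdegree (\<beta> - \<alpha>) \<ge> 0")
      case True
      then have "(2::real) ^ nat (fls_subdegree (\<beta> - \<alpha>)) \<le> 2 ^ K"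
        using neg by (intro power_increasing) auto
      then have "inverse (2 ^ K) \<le> inverse ((2::real) ^ nat (fls_subdegree (\<beta> - \<alpha>)))"
        by (intro le_imp_inverse_le) auto
      then show False using assms(1) True False by (simp add: dist_fls_def)
    next
      case neg': False
      have "inverse (2 ^ K) \<le> (1::real)" by (simp add: inverse_le_1_iff)
      also have "\<dots> \<le> 2 ^ nat (- fls_subdegree (\<beta> - \<alpha>))" by simp
      finally show False using assms(1) neg' False by (simp add: dist_fls_def)
    qed
  qed
  then have "j < fls_subdegree (\<beta> - \<alpha>)" using assms(2) by linarith
  then have "fls_nth (\<beta> - \<alpha>) j = 0" by (rule fls_eq0_below_subdegree)
  then show ?thesis by simp
qed simp

lemma open_cylinder: "open (cylinder K c)"
  unfolding open_fls_def
proof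
  fix \<alpha> assume \<alpha>: "\<alpha> \<in> cylinder K c"
  have "{\<beta>. dist \<beta> \<alpha> < inverse (2 ^ K)} \<subseteq> cylinder K c"
  proof
    fix \<beta> assume "\<beta> \<in> {\<beta>. dist \<beta> \<alpha> < inverse (2 ^ K)}"
    then have "fls_nth \<beta> j = fls_nth \<alpha> j" if "j \<le> int K" for j
      using that nth_eq_if_dist_less by blast
    then show "\<beta> \<in> cylinder K c" using \<alpha> by (auto simp: cylinder_def)
  qed
  then show "\<exists>r>0. {\<beta>. dist \<beta> \<alpha> < r} \<subseteq> cylinder K c"
    by (intro exI[of _ "inverse (2 ^ K)"]) simp
qed

lemma cylinder_translate:
  obtains \<beta> where "cylinder K c = (+) \<beta> ` cylinder K 0"
proof
  define \<beta> where "\<beta> = (\<Sum>i<K. fls_const (coeff c i) * fls_X ^ (Suc i))"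
  have nth: "fls_nth \<beta> j = (\<Sum>i<K. if j = 1 + int i then coeff c i else 0)" for j
    unfolding \<beta>_def fls_nth_sum by (intro sum.cong refl) (simp del: power_Suc)
  have nonpos: "fls_nth \<beta> j = 0" if "j \<le> 0" for j
    unfolding nth using that by (intro sum.neutral) auto
  have pos: "fls_nth \<beta> (1 + int i) = coeff c i" if "i < K" for i
    unfolding nth using that by simp
  show "cylinder K c = (+) \<beta> ` cylinder K 0"
  proof (intro equalityI subsetI)
    fix \<alpha> assume "\<alpha> \<in> cylinder K c"
    then have "\<alpha> - \<beta> \<in> cylinder K 0" using nonpos pos by (auto simp: cylinder_def)
    then show "\<alpha> \<in> (+) \<beta> ` cylinder K 0" by (intro image_eqI[of _ _ "\<alpha> - \<beta>"]) auto
  qed (use nonpos pos in \<open>auto simp: cylinder_def\<close>)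
qed

lemma torus_eq_Union_cylinder: "torus = (\<Union>c\<in>polys_lt K. cylinder K c)"
proof (intro equalityI subsetI)
  fix \<alpha> :: "'a fls" assume \<alpha>: "\<alpha> \<in> torus"
  define c where "c = (\<Sum>i<K. monom (fls_nth \<alpha> (1 + int i)) i)"
  have coeff: "coeff c j = (if j < K then fls_nth \<alpha> (1 + int j) else 0)" for j
    unfolding c_def coeff_sum by (simp add: coeff_monom)
  have "c \<in> polys_lt K" by (simp add: polys_lt_def coeff)
  moreover have "\<alpha> \<in> cylinder K c" using \<alpha> by (simp add: cylinder_def torus_eq coeff)
  ultimately show "\<alpha> \<in> (\<Union>c\<in>polys_lt K. cylinder K c)" by blast
qed (auto simp: cylinder_def torus_eq)

lemma cylinder_disjoint:
  assumes "c \<in> polys_lt K" "d \<in> polys_lt K" "\<alpha> \<in> cylinder K c" "\<alpha> \<in> cylinder K d"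
  shows "c = d"
proof (rule poly_eqI)
  fix i show "coeff c i = coeff d i"
    using assms by (cases "i < K") (auto simp: cylinder_def polys_lt_def)
qed

lemma measure_cylinder:
  fixes \<mu> :: "'a::finite_field fls measure"
  assumes \<mu>: "normalized_haar \<mu>"
  shows "emeasure \<mu> (cylinder K c) = ennreal (1 / real CARD('a) ^ K)"
proof -
  have sets: "cylinder K d \<in> sets \<mu>" for d :: "'a poly"
    using \<mu> borel_open[OF open_cylinder] by (simp add: normalized_haar_def)
  have same: "emeasure \<mu> (cylinder K d) = emeasure \<mu> (cylinder K 0)" for d :: "'a poly"
  proof -
    obtain \<beta> where "cylinder K d = (+) \<beta> ` cylinder K 0" by (rule cylinder_translate)
    then show ?thesis using \<mu> sets[of 0] by (simp add: normalized_haar_def)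
  qed
  have "1 = emeasure \<mu> (\<Union>c\<in>polys_lt K. cylinder K c)"
    using \<mu> unfolding torus_eq_Union_cylinder[of K, symmetric] by (simp add: normalized_haar_def)
  also have "\<dots> = (\<Sum>d\<in>polys_lt K. emeasure \<mu> (cylinder K d))"
    using sets
    by (intro sum_emeasure[symmetric]) (auto simp: disjoint_family_on_def dest: cylinder_disjoint)
  also have "\<dots> = (\<Sum>d\<in>(polys_lt K :: 'a poly set). emeasure \<mu> (cylinder K c))"
    by (intro sum.cong refl) (metis same)
  also have "\<dots> = ennreal (real CARD('a) ^ K) * emeasure \<mu> (cylinder K c)"
    by (simp add: card_polys_lt ennreal_of_nat_eq_real_of_nat)
  finally have one: "ennreal (real CARD('a) ^ K) * emeasure \<mu> (cylinder K c) = 1" ..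
  have pos: "real CARD('a) ^ K > 0" by simp
  have "emeasure \<mu> (cylinder K c)
      = ennreal (1 / real CARD('a) ^ K) * (ennreal (real CARD('a) ^ K) * emeasure \<mu> (cylinder K c))"
    using pos by (simp add: mult.assoc[symmetric] ennreal_mult[symmetric])
  then show ?thesis unfolding one by simp
qed

lemma torus_integral_eq_average:
  fixes \<mu> :: "'a::finite_field fls measure" and F :: "'a fls \<Rightarrow> real" and G :: "'a poly \<Rightarrow> real"
  assumes \<mu>: "normalized_haar \<mu>"
    and F: "\<And>c \<alpha>. c \<in> polys_lt K \<Longrightarrow> \<alpha> \<in> cylinder K c \<Longrightarrow> F \<alpha> = G c"
  shows "(LINT \<alpha>:torus|\<mu>. F \<alpha>) = (\<Sum>c\<in>polys_lt K. G c) / real CARD('a) ^ K"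
proof -
  have sets: "cylinder K d \<in> sets \<mu>" for d :: "'a poly"
    using \<mu> borel_open[OF open_cylinder] by (simp add: normalized_haar_def)
  have meas: "measure \<mu> (cylinder K c) = 1 / real CARD('a) ^ K" for c
    unfolding measure_def measure_cylinder[OF \<mu>] by (simp add: enn2real_ennreal)
  have int: "integrable \<mu> (\<lambda>\<alpha>. G c * indicator (cylinder K c) \<alpha>)" for c
    using sets measure_cylinder[OF \<mu>, of K c]
    by (intro integrable_mult_right integrable_real_indicator) auto
  have "indicator torus \<alpha> *\<^sub>R F \<alpha> = (\<Sum>c\<in>polys_lt K. G c * indicator (cylinder K c) \<alpha>)" for \<alpha>
  proof (cases "\<alpha> \<in> torus")
    case True
    then obtain c where c: "c \<in> polys_lt K" "\<alpha> \<in> cylinder K c"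
      using torus_eq_Union_cylinder[where 'a = 'a and K = K] by blast
    have "(\<Sum>d\<in>polys_lt K. G d * indicator (cylinder K d) \<alpha>) = (\<Sum>d\<in>polys_lt K. if d = c then G c else 0)"
      using c cylinder_disjoint by (intro sum.cong refl) (auto simp: indicator_def)
    then show ?thesis using c True F by simp
  next
    case False
    then have "\<alpha> \<notin> cylinder K d" if "d \<in> polys_lt K" for d
      using torus_eq_Union_cylinder[where 'a = 'a and K = K] that by blast
    then show ?thesis using False by simp
  qed
  then have "(LINT \<alpha>:torus|\<mu>. F \<alpha>) = (LINT \<alpha>|\<mu>. (\<Sum>c\<in>polys_lt K. G c * indicator (cylinder K c) \<alpha>))"
    unfolding set_lebesgue_integral_def by simp
  also have "\<dots> = (\<Sum>c\<in>polys_lt K. LINT \<alpha>|\<mu>. G c * indicator (cylinder K c) \<alpha>)"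
    using int by (intro Bochner_Integration.integral_sum) auto
  also have "\<dots> = (\<Sum>c\<in>polys_lt K. G c * (1 / real CARD('a) ^ K))"
    using sets by (intro sum.cong refl) (simp add: meas sets.Int_space_eq2)
  finally show ?thesis by (simp add: sum_divide_distrib)
qed

lemma t_coeff_mult:
  assumes "degree f < K"
  shows "t_coeff (laurent_of_poly f * \<alpha>) (-1) = (\<Sum>i<K. coeff f i * fls_nth \<alpha> (1 + int i))"
proof -
  have "t_coeff (laurent_of_poly f * \<alpha>) (-1) = (\<Sum>i\<le>degree f. coeff f i * fls_nth \<alpha> (1 + int i))"
    unfolding t_coeff_def laurent_of_poly_def sum_distrib_right fls_nth_sum
    by (intro sum.cong refl)
       (simp only: mult.assoc fls_X_inv_power_times_conv_shift(1), simp)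
  also have "\<dots> = (\<Sum>i<K. coeff f i * fls_nth \<alpha> (1 + int i))"
    using assms by (intro sum.mono_neutral_left) (auto simp: coeff_eq_0)
  finally show ?thesis .
qed

context r_free_sums
begin

lemma total_sum_eq_r_free_sum:
  assumes \<psi>: "\<psi> = e_q p h" and \<alpha>: "\<alpha> \<in> cylinder (N + 1) c"
  shows "r_free_sum p h r N \<alpha> = total_sum N c"
proof -
  have chi: "e_char p h (laurent_of_poly f * \<alpha>) = chi (N + 1) c f" if "degree f \<le> N" for f
  proof -
    have "t_coeff (laurent_of_poly f * \<alpha>) (-1) = (\<Sum>i<N + 1. coeff f i * coeff c i)"
      using that \<alpha> t_coeff_mult[of f "N + 1" \<alpha>] by (simp add: cylinder_def)
    then show ?thesis unfolding e_char_def chi_def by (simp only: \<psi>)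
  qed
  have eq: "{f :: 'a poly. lead_coeff f = 1 \<and> degree f \<le> N} = (\<Union>n\<in>{..N}. monics n)"
    by (auto simp: monics_def)
  have "total_sum N c = (\<Sum>f\<in>(\<Union>n\<in>{..N}. monics n). (if r_free r f then 1 else 0) * chi (N + 1) c f)"
    unfolding total_sum_def expsum_def
    by (intro sum.UNION_disjoint[symmetric] ballI finite_monics) (auto simp: monics_def)
  also have "\<dots> = r_free_sum p h r N \<alpha>"
    unfolding r_free_sum_def eq[symmetric] by (intro sum.cong refl) (auto simp: chi)
  finally show ?thesis by simp
qed

lemma r_free_moment_eq_finite_moment:
  fixes \<mu> :: "'a fls measure"
  assumes \<psi>: "\<psi> = e_q p h" and \<mu>: "normalized_haar \<mu>"
  shows "r_free_moment \<mu> p h r k N = finite_moment k N"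
proof -
  have "r_free_moment \<mu> p h r k N
      = (\<Sum>c\<in>polys_lt (N + 1). real_pow (cmod (total_sum N c)) k) / real CARD('a) ^ (N + 1)"
    unfolding r_free_moment_def
    by (rule torus_integral_eq_average[OF \<mu>]) (simp add: total_sum_eq_r_free_sum[OF \<psi>])
  then show ?thesis unfolding finite_moment_def by (simp only: q_eq[symmetric])
qed

end

section \<open>The order of the moments\<close>

theorem theorem1p1:
  fixes \<mu> :: "'a::finite_field fls measure"
    and p h r :: nat
    and k :: real
  assumes "prime p" and "h \<ge> 1" and "CARD('a) = p ^ h"
    and "normalized_haar \<mu>"
    and "k \<ge> 0" and "r \<ge> 2"
  shows "\<exists>C\<^sub>1 > 0. \<exists>C\<^sub>2 > 0. \<forall>N \<ge> 1.
    r_free_moment \<mu> p h r k N \<le> C\<^sub>1 * moment_order (real CARD('a)) r k N \<and>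
    moment_order (real CARD('a)) r k N \<le> C\<^sub>2 * r_free_moment \<mu> p h r k N"
proof -
  interpret r_free_sums "e_q p h :: 'a \<Rightarrow> complex" "real CARD('a)" r
    by unfold_locales
       (use assms(1-3,6) in \<open>auto intro: e_q_add cmod_e_q e_q_nontrivial\<close>)
  show ?thesis
    using finite_moment_order[OF assms(5)] r_free_moment_eq_finite_moment[OF refl assms(4)] by simp
qed

end
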